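(* Let $\tau>0$, $N\in\mathbb{N}$, $0<\alpha<N$ and $1+\frac{\alpha}{N}<p<\frac{2_\alpha^*}{2}$. Then $(u,v)$ is a positive ground state of the system \[ \begin{cases} -\Delta u+\tau u=(I_\alpha*|v|^p)|u|^{p-2}u & \text{in } \mathbb{R}^N,\\ -\Delta v+\tau v=(I_\alpha*|u|^p)|v|^{p-2}v & \text{in } \mathbb{R}^N, \end{cases} \] if and only if $u=v$ and $u$ is a positive ground state of the equation \[ -\Delta w+\tau w=(I_\alpha*|w|^p)|w|^{p-2}w\quad\text{in }\mathbb{R}^N. \]
   Context: $I_\alpha(x)=\dfrac{\Gamma(\frac{N-\alpha}{2})}{\Gamma(\frac{\alpha}{2})\pi^{N/2}2^\alpha}|x|^{-(N-\alpha)}$ is the Riesz potential; $2_\alpha^*=\infty$ if $N\in\{1,2\}$ and $2_\alpha^*=\frac{2(N+\alpha)}{N-2}$ if $N\ge3$. Let $E(\mathbb{R}^N)=H^1(\mathbb{R}^N)\times H^1(\mathbb{R}^N)$ and define the $C^1$ functional $J:E(\mathbb{R}^N)\to\mathbb{R}$, $J(u,v)=\frac12\int_{\mathbb{R}^N}|\nabla u|^2+|\nabla v|^2+\tau(u^2+v^2)\,dx-\frac1p\int_{\mathbb{R}^N}(I_\alpha*|u|^p)|v|^p\,dx$, whose critical points are exactly the solutions in $E(\mathbb{R}^N)$ of the system. Let $\mathcal{N}_J=\{(u,v)\in E(\mathbb{R}^N)\setminus\{(0,0)\}: \langle J'(u,v),(u,v)\rangle=0\}$ and $c=\inf_{\mathcal{N}_J}J$.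 A ground state of the system is $(u,v)\in\mathcal{N}_J$ with $J(u,v)=c$; it is positive if $u>0$ and $v>0$. Similarly let $\mathcal{A}:H^1(\mathbb{R}^N)\to\mathbb{R}$, $\mathcal{A}(u)=\frac12\int|\nabla u|^2+\tau u^2\,dx-\frac1{2p}\int(I_\alpha*|u|^p)|u|^p\,dx$, $\mathcal{N}_\mathcal{A}=\{u\in H^1(\mathbb{R}^N)\setminus\{0\}:\langle\mathcal{A}'(u),u\rangle=0\}$, $\mathcal{T}=\inf_{\mathcal{N}_\mathcal{A}}\mathcal{A}$; a ground state of the equation is $u\in\mathcal{N}_\mathcal{A}$ with $\mathcal{A}(u)=\mathcal{T}$, positive if $u>0$. *)

theory Defs
  imports "HOL-Analysis.Analysis"
begin

definition smooth_fun :: "(real^'n::finite \<Rightarrow> real) \<Rightarrow> bool" where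
  "smooth_fun f \<longleftrightarrow> (\<exists>S. f \<in> S \<and>
     (\<forall>g\<in>S. (\<forall>x. g differentiable (at x)) \<and>
        (\<forall>i. (\<lambda>x. frechet_derivative g (at x) (axis i 1)) \<in> S)))"

definition test_fun :: "(real^'n::finite \<Rightarrow> real) \<Rightarrow> bool" where
  "test_fun \<phi> \<longleftrightarrow> smooth_fun \<phi> \<and> compact (closure {x. \<phi> x \<noteq> 0})"

definition partial_deriv :: "'n::finite \<Rightarrow> (real^'n::finite \<Rightarrow> real) \<Rightarrow> real^'n \<Rightarrow> real" where
  "partial_deriv i f x = frechet_derivative f (at x) (axis i 1)"

definition L2 :: "(real^'n::finite \<Rightarrow> real) \<Rightarrow> bool" where
  "L2 u \<longleftrightarrow> u \<in> borel_measurable lebesgue \<and> integrable lebesgue (\<lambda>x. (u x)\<^sup>2)"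

definition weak_gradient :: "(real^'n::finite \<Rightarrow> real) \<Rightarrow> (real^'n \<Rightarrow> real^'n) \<Rightarrow> bool" where
  "weak_gradient u g \<longleftrightarrow> (\<forall>\<phi> i. test_fun \<phi> \<longrightarrow>
     (\<integral>x. u x * partial_deriv i \<phi> x \<partial>lebesgue) = - (\<integral>x. g x $ i * \<phi> x \<partial>lebesgue))"

definition H1 :: "(real^'n::finite \<Rightarrow> real) set" where
  "H1 = {u. L2 u \<and> (\<exists>g. (\<forall>i. L2 (\<lambda>x. g x $ i)) \<and> weak_gradient u g)}"

definition wgrad :: "(real^'n::finite \<Rightarrow> real) \<Rightarrow> real^'n \<Rightarrow> real^'n" where
  "wgrad u = (SOME g. (\<forall>i. L2 (\<lambda>x. g x $ i)) \<and> weak_gradient u g)"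

definition riesz :: "real \<Rightarrow> real^'n::finite \<Rightarrow> real" where
  "riesz \<alpha> x = (let N = real CARD('n) in
     Gamma ((N - \<alpha>) / 2) / (Gamma (\<alpha> / 2) * pi powr (N / 2) * 2 powr \<alpha>)
       * norm x powr (-(N - \<alpha>)))"

definition riesz_conv :: "real \<Rightarrow> (real^'n::finite \<Rightarrow> real) \<Rightarrow> real^'n \<Rightarrow> real" where
  "riesz_conv \<alpha> f x = (\<integral>y. riesz \<alpha> (x - y) * f y \<partial>lebesgue)"

definition Jfun :: "real \<Rightarrow> real \<Rightarrow> real \<Rightarrow> (real^'n::finite \<Rightarrow> real) \<Rightarrow> (real^'n \<Rightarrow> real) \<Rightarrow> real" where
  "Jfun \<tau> \<alpha> p u v =
     1/2 * (\<integral>x. (norm (wgrad u x))\<^sup>2 + (norm (wgrad v x))\<^sup>2 + \<tau> * ((u x)\<^sup>2 + (v x)\<^sup>2) \<partial>lebesgue)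
     - 1/p * (\<integral>x. riesz_conv \<alpha> (\<lambda>y. \<bar>u y\<bar> powr p) x * \<bar>v x\<bar> powr p \<partial>lebesgue)"

definition Afun :: "real \<Rightarrow> real \<Rightarrow> real \<Rightarrow> (real^'n::finite \<Rightarrow> real) \<Rightarrow> real" where
  "Afun \<tau> \<alpha> p u =
     1/2 * (\<integral>x. (norm (wgrad u x))\<^sup>2 + \<tau> * (u x)\<^sup>2 \<partial>lebesgue)
     - 1/(2*p) * (\<integral>x. riesz_conv \<alpha> (\<lambda>y. \<bar>u y\<bar> powr p) x * \<bar>u x\<bar> powr p \<partial>lebesgue)"

definition nonzero_fun :: "(real^'n::finite \<Rightarrow> real) \<Rightarrow> bool" where
  "nonzero_fun u \<longleftrightarrow> \<not> (AE x in lebesgue. u x = 0)"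

text \<open>Nehari manifolds: \<langle>J'(w), w\<rangle> is the directional derivative of J at w in direction w.\<close>
definition nehari_J :: "real \<Rightarrow> real \<Rightarrow> real \<Rightarrow> ((real^'n::finite \<Rightarrow> real) \<times> (real^'n \<Rightarrow> real)) set" where
  "nehari_J \<tau> \<alpha> p = {(u, v). u \<in> H1 \<and> v \<in> H1 \<and> (nonzero_fun u \<or> nonzero_fun v) \<and>
      deriv (\<lambda>t::real. Jfun \<tau> \<alpha> p (\<lambda>x. (1 + t) * u x) (\<lambda>x. (1 + t) * v x)) 0 = 0}"

definition nehari_A :: "real \<Rightarrow> real \<Rightarrow> real \<Rightarrow> (real^'n::finite \<Rightarrow> real) set" where
  "nehari_A \<tau> \<alpha> p = {u. u \<in> H1 \<and> nonzero_fun u \<and>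
      deriv (\<lambda>t::real. Afun \<tau> \<alpha> p (\<lambda>x. (1 + t) * u x)) 0 = 0}"

definition ground_state_system :: "real \<Rightarrow> real \<Rightarrow> real \<Rightarrow> (real^'n::finite \<Rightarrow> real) \<Rightarrow> (real^'n \<Rightarrow> real) \<Rightarrow> bool" where
  "ground_state_system \<tau> \<alpha> p u v \<longleftrightarrow> (u, v) \<in> nehari_J \<tau> \<alpha> p \<and>
     Jfun \<tau> \<alpha> p u v = Inf ((\<lambda>(a, b). Jfun \<tau> \<alpha> p a b) ` (nehari_J \<tau> \<alpha> p :: ((real^'n \<Rightarrow> real) \<times> (real^'n \<Rightarrow> real)) set))"

definition ground_state_eq :: "real \<Rightarrow> real \<Rightarrow> real \<Rightarrow> (real^'n::finite \<Rightarrow> real) \<Rightarrow> bool" where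
  "ground_state_eq \<tau> \<alpha> p u \<longleftrightarrow> u \<in> nehari_A \<tau> \<alpha> p \<and>
     Afun \<tau> \<alpha> p u = Inf (Afun \<tau> \<alpha> p ` (nehari_A \<tau> \<alpha> p :: (real^'n \<Rightarrow> real) set))"

definition positive_fun :: "(real^'n::finite \<Rightarrow> real) \<Rightarrow> bool" where
  "positive_fun u \<longleftrightarrow> (AE x in lebesgue. u x > 0)"

end

theory Submission
  imports Defs
begin

text \<open>
  Write $Q(u) = \int |\nabla u|^2 + \tau u^2$ and $D(u,v) = \int (I_\alpha * |u|^p) |v|^p$. The Gaussian
  representation $|x-y|^{-2s} = c \int_0^\infty t^{s-1} e^{-t|x-y|^2}\,dt$, in which every Gaussian is a
  convolution square, turns $D$ into an inner product of the heat-like averages of $|u|^p$ and $|v|^p$.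
  Hence $D(u,v)^2 \le D(u,u) D(v,v)$, and $D(u,u) = D(v,v) = D(u,v)$ forces $|u| = |v|$ almost everywhere.

  If every $z$ on the Nehari set of the equation has $Q(z) \ge L$, then scaling gives
  $L^{p-1} D(w,w) \le Q(w)^p$ for all $w$. For $(u,v)$ on the Nehari set of the system with
  $K = D(u,v) = (Q(u)+Q(v))/2$, multiplying the bounds for $u$ and $v$ yields
  $L^{2(p-1)} K^2 \le (Q(u)Q(v))^p \le K^{2p}$, so $L \le K$, and $L = K$ forces equality everywhere.
  Minimal $K$ and minimal $Q$ thus correspond to each other through $u = v$.

  The energy $D(u,u)$ is finite on $H^1$ because all exponents are strictly subcritical: splitting the
  kernel near and far from the origin, Young's inequality replaces the Hardy--Littlewood--Sobolev
  inequality, and likewise the Sobolev embedding follows from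
  $|u(x+z) - u(x)| \le |z| \int_0^1 |\nabla u(x+tz)|\,dt$ averaged over $|z| < 1$.
\<close>

section \<open>Integrability of powers of the norm\<close>

text \<open>Rigidity is the delicate half: equality of the energies only says that the Gaussian
  averages of |u|^p and |v|^p agree for almost every scale t, so the inversion may use only some
  sequence of scales tending to infinity, and it is carried out weakly, by integration over boxes.

  The two bounds on p meet in one place. For y = 1 - alpha/N the kernel raised to the power 1/y is
  |x|^(-N), which fails to be integrable both at 0 and at infinity. The bounds say that y lies
  strictly inside the interval of parameters for which the Sobolev embedding controls |u|^p, so
  there is room on either side.

  In the comparison of Nehari sets, L is any positive lower bound and not the infimum. Hence the
  same estimate serves both directions, once with L = K and once with L = Q(u).

  The functionals are real-valued, with default values for divergent integrals, and
  \<open>wgrad\<close> is a choice among weak gradients. Finiteness is therefore settled in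
  \<open>ennreal\<close> on Borel representatives, and gradients are compared almost
  everywhere.\<close>

lemma nn_integral_lborel_affine:
  fixes f :: "'a::euclidean_space \<Rightarrow> ennreal"
  assumes [measurable]: "f \<in> borel_measurable borel" and c: "c \<noteq> 0"
  shows "(\<integral>\<^sup>+x. f x \<partial>lborel) = ennreal (\<bar>c\<bar> ^ DIM('a)) * (\<integral>\<^sup>+x. f (t + c *\<^sub>R x) \<partial>lborel)"
  by (subst lborel_affine[OF c, of t])
     (simp add: nn_integral_density nn_integral_distr nn_integral_cmult)

lemma nn_integral_lborel_plus:
  fixes f :: "'a::euclidean_space \<Rightarrow> ennreal"
  assumes [measurable]: "f \<in> borel_measurable borel"
  shows "(\<integral>\<^sup>+x. f (t + x) \<partial>lborel) = (\<integral>\<^sup>+x. f x \<partial>lborel)"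
  using nn_integral_lborel_affine[of f 1 t] by simp

lemma nn_integral_lborel_minus:
  fixes f :: "'a::euclidean_space \<Rightarrow> ennreal"
  assumes [measurable]: "f \<in> borel_measurable borel"
  shows "(\<integral>\<^sup>+x. f (t - x) \<partial>lborel) = (\<integral>\<^sup>+x. f x \<partial>lborel)"
  using nn_integral_lborel_affine[of f "-1" t] by simp

lemma nn_integral_powr_tail:
  fixes r s :: real
  assumes "r > 0" "s > 0"
  shows "(\<integral>\<^sup>+t. ennreal (t powr (-s-1)) * indicator {r..} t \<partial>lborel) = ennreal (r powr (-s) / s)"
proof -
  have "((\<lambda>t. t powr (-s-1)) has_integral (r powr (-s) / s)) {r..}"
    using has_integral_powr_to_inf[of "-s-1" r] assms by simp
  then have "(\<integral>\<^sup>+t. ennreal (indicator {r..} t * (t powr (-s-1))) \<partial>lborel) = ennreal (r powr (-s) / s)"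
    by (intro nn_integral_has_integral_lebesgue) auto
  then show ?thesis
    by (simp add: ennreal_mult' mult.commute ennreal_indicator)
qed

lemma nn_integral_powr_unit:
  fixes s :: real
  assumes "s > -1"
  shows "(\<integral>\<^sup>+t. ennreal (t powr s) * indicator {0..1} t \<partial>lborel) = ennreal (1 / (s + 1))"
proof -
  have "((\<lambda>t. t powr s) has_integral (1 / (s+1))) {0..1}"
    using has_integral_powr_from_0[of s 1] assms by simp
  then have "(\<integral>\<^sup>+t. ennreal (indicator {0..1} t * (t powr s)) \<partial>lborel) = ennreal (1 / (s+1))"
    by (intro nn_integral_has_integral_lebesgue) auto
  then show ?thesis
    by (simp add: ennreal_mult' mult.commute ennreal_indicator)
qed

text \<open>Layer cake: |x|^(-s) is s times the integral of t^(-s-1) over t >= |x|. After Tonelli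
  only volumes of balls intersected with \<open>A\<close> remain, which takes the place of polar
  coordinates.\<close>

lemma nn_integral_norm_powr_layer:
  fixes A :: "'a::euclidean_space set" and s :: real
  assumes "s > 0" and [measurable]: "A \<in> sets borel"
  shows "(\<integral>\<^sup>+x. ennreal (norm x powr (-s)) * indicator A x \<partial>lborel) =
    ennreal s * (\<integral>\<^sup>+t. ennreal (t powr (-s-1)) * indicator {0..} t * emeasure lborel (A \<inter> cball 0 t) \<partial>lborel)"
proof -
  let ?e = "\<lambda>t. ennreal (t powr (-s-1)) * indicator {0..} t"
  have "(\<integral>\<^sup>+x. ennreal (norm x powr (-s)) * indicator A x \<partial>lborel) =
     (\<integral>\<^sup>+x. (\<integral>\<^sup>+t. ennreal s * (?e t * indicator (A \<inter> cball 0 t) (x::'a)) \<partial>lborel) \<partial>lborel)"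
  \<comment> \<open>At the origin the two sides can differ: \<open>0 powr (-s)\<close> is 0, while
    the tail integral from 0 diverges.\<close>
  proof (intro nn_integral_cong_AE, use AE_lborel_singleton[of "0::'a"] in eventually_elim)
    fix x :: 'a assume x: "x \<noteq> 0"
    have "(\<integral>\<^sup>+t. ennreal s * (?e t * indicator (A \<inter> cball 0 t) x) \<partial>lborel)
       = (\<integral>\<^sup>+t. (ennreal s * indicator A x) * (ennreal (t powr (-s-1)) * indicator {norm x..} t) \<partial>lborel)"
      by (intro nn_integral_cong) (auto simp: indicator_def intro: order_trans[OF norm_ge_zero])
    also have "\<dots> = (ennreal s * indicator A x) * ennreal (norm x powr (-s) / s)"
      using nn_integral_powr_tail[of "norm x" s] x assms by (subst nn_integral_cmult) auto
    also have "\<dots> = ennreal (norm x powr (-s)) * indicator A x"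
      using assms by (auto simp: indicator_def simp flip: ennreal_mult')
    finally show "ennreal (norm x powr (-s)) * indicator A x =
      (\<integral>\<^sup>+t. ennreal s * (?e t * indicator (A \<inter> cball 0 t) x) \<partial>lborel)" by simp
  qed
  also have "\<dots> = (\<integral>\<^sup>+t. (\<integral>\<^sup>+x. ennreal s * (?e t * (indicator A (x::'a) * indicator {0..t} (norm x))) \<partial>lborel) \<partial>lborel)"
    by (subst lborel_pair.Fubini') (auto intro!: nn_integral_cong simp: indicator_def)
  also have "\<dots> = (\<integral>\<^sup>+t. ennreal s * (?e t * emeasure lborel (A \<inter> cball 0 t)) \<partial>lborel)"
  proof (intro nn_integral_cong)
    fix t
    have "emeasure lborel (A \<inter> cball 0 t) = (\<integral>\<^sup>+x. indicator A (x::'a) * indicator {0..t} (norm x) \<partial>lborel)"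
      by (subst nn_integral_indicator[symmetric]) (auto intro!: nn_integral_cong simp: indicator_def simp del: nn_integral_indicator)
    then show "(\<integral>\<^sup>+x. ennreal s * (?e t * (indicator A (x::'a) * indicator {0..t} (norm x))) \<partial>lborel) =
      ennreal s * (?e t * emeasure lborel (A \<inter> cball 0 t))"
      by (simp add: nn_integral_cmult)
  qed
  also have "\<dots> = ennreal s * (\<integral>\<^sup>+t. ?e t * emeasure lborel (A \<inter> cball 0 t) \<partial>lborel)"
  proof (rule nn_integral_cmult)
    have "(\<lambda>t. emeasure lborel (A \<inter> cball 0 t)) = (\<lambda>t. \<integral>\<^sup>+x. indicator A (x::'a) * indicator {0..t} (norm x) \<partial>lborel)"
      by (subst nn_integral_indicator[symmetric]) (auto intro!: nn_integral_cong simp: indicator_def simp del: nn_integral_indicator)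
    moreover have "(\<lambda>t. \<integral>\<^sup>+x. indicator A (x::'a) * indicator {0..t} (norm x) \<partial>lborel) \<in> borel_measurable borel"
    proof -
      have "(\<lambda>(t::real, x). indicator A (x::'a) * (if 0 \<le> norm x \<and> norm x \<le> t then 1 else 0) :: ennreal) \<in> borel_measurable (borel \<Otimes>\<^sub>M lborel)"
        by measurable
      then show ?thesis
        by (intro lborel.borel_measurable_nn_integral) (simp add: indicator_def)
    qed
    ultimately have [measurable]: "(\<lambda>t. emeasure lborel (A \<inter> cball 0 t)) \<in> borel_measurable borel" by simp
    show "(\<lambda>t. ?e t * emeasure lborel (A \<inter> cball 0 t)) \<in> borel_measurable lborel"
      by measurable
  qed
  finally show ?thesis .
qed

lemma emeasure_cball_le:
  "emeasure lborel (A \<inter> cball (0::'a::euclidean_space) t) \<le> ennreal (unit_ball_vol (DIM('a)) * \<bar>t\<bar> ^ DIM('a))"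
proof (cases "t \<ge> 0")
  case True
  have "emeasure lborel (A \<inter> cball (0::'a) t) \<le> emeasure lborel (cball (0::'a) t)"
    by (intro emeasure_mono) auto
  then show ?thesis using True by (simp add: emeasure_cball)
qed auto

text \<open>In the layer-cake formula a ball of radius t <= 1 has volume of order t^N, which leaves
  t^(N-s-1), integrable at 0 because s < N. For t > 1 the volume no longer grows and t^(-s-1) is
  integrable at infinity.\<close>

lemma nn_integral_norm_powr_ball_finite:
  fixes s :: real
  assumes s: "s < DIM('a)"
  shows "(\<integral>\<^sup>+x. ennreal (norm x powr (-s)) * indicator (ball 0 1) (x::'a::euclidean_space) \<partial>lborel) < \<infinity>"
proof (cases "s > 0")
  case False
  have "(\<integral>\<^sup>+x. ennreal (norm x powr (-s)) * indicator (ball 0 1) (x::'a) \<partial>lborel) \<le>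
     (\<integral>\<^sup>+x. indicator (ball 0 1) (x::'a) \<partial>lborel)"
    using False by (intro nn_integral_mono) (auto simp: indicator_def powr_le1)
  also have "\<dots> < \<infinity>" by (simp add: emeasure_ball)
  finally show ?thesis .
next
  case True
  define V where "V = unit_ball_vol (real DIM('a))"
  have V: "V \<ge> 0" by (simp add: V_def)
  let ?N = "real DIM('a)"
  have bound: "ennreal (t powr (-s-1)) * indicator {0..} t * emeasure lborel (ball (0::'a) 1 \<inter> cball 0 t)
     \<le> ennreal V * (ennreal (t powr (?N-s-1)) * indicator {0..1} t + ennreal (t powr (-s-1)) * indicator {1..} t)" for t
  proof -
    consider "t \<le> 0" | "0 < t" "t \<le> 1" | "1 < t" by linarith
    then show ?thesis
    proof cases
      case 1
      then show ?thesis by (cases "t = 0") auto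
    next
      case 2
      have "ennreal (t powr (-s-1)) * emeasure lborel (ball (0::'a) 1 \<inter> cball 0 t) \<le> ennreal (t powr (-s-1)) * ennreal (V * \<bar>t\<bar> ^ DIM('a))"
        unfolding V_def by (intro mult_left_mono emeasure_cball_le) auto
      also have "\<dots> = ennreal V * ennreal (t powr (?N-s-1))"
      proof -
        have "t powr (-s-1) * (V * \<bar>t\<bar> ^ DIM('a)) = V * t powr (?N-s-1)"
          using 2 by (simp add: powr_realpow[symmetric] powr_add[symmetric] algebra_simps)
        then show ?thesis using V by (simp flip: ennreal_mult')
      qed
      finally show ?thesis using 2 by (auto simp: indicator_def distrib_left intro: add_increasing2)
    next
      case 3
      have "emeasure lborel (ball (0::'a) 1 \<inter> cball 0 t) \<le> emeasure lborel (ball (0::'a) 1)"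
        by (intro emeasure_mono) auto
      then have "emeasure lborel (ball (0::'a) 1 \<inter> cball 0 t) \<le> ennreal V"
        by (simp add: emeasure_ball V_def)
      then show ?thesis using 3 by (auto simp: mult.commute[of "ennreal V"] intro!: mult_left_mono)
    qed
  qed
  have "(\<integral>\<^sup>+t. ennreal (t powr (-s-1)) * indicator {0..} t * emeasure lborel (ball (0::'a) 1 \<inter> cball 0 t) \<partial>lborel) \<le>
     (\<integral>\<^sup>+t. ennreal V * (ennreal (t powr (?N-s-1)) * indicator {0..1} t + ennreal (t powr (-s-1)) * indicator {1..} t) \<partial>lborel)"
    by (intro nn_integral_mono bound)
  also have "\<dots> = ennreal V * (ennreal (1/(?N-s)) + ennreal (1/s))"
    using nn_integral_powr_tail[of 1 s] nn_integral_powr_unit[of "?N-s-1"] True s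
    by (subst nn_integral_cmult) (auto simp: nn_integral_add)
  also have "\<dots> < \<infinity>" by (simp add: ennreal_mult_less_top)
  finally show ?thesis
    using nn_integral_norm_powr_layer[OF True, of "ball (0::'a) 1"] by (simp add: ennreal_mult_less_top)
qed

text \<open>Counterpart at infinity: the layers with t < 1 are empty, and for t >= 1 the integrand
  is of order t^(N-s-1), integrable because s > N.\<close>

lemma nn_integral_norm_powr_outside_finite:
  fixes s :: real
  assumes s: "s > DIM('a)"
  shows "(\<integral>\<^sup>+x. ennreal (norm x powr (-s)) * indicator (- ball 0 1) (x::'a::euclidean_space) \<partial>lborel) < \<infinity>"
proof -
  let ?e = "\<lambda>t. ennreal (t powr (-s-1)) * indicator {0..} t * emeasure lborel (- ball (0::'a) 1 \<inter> cball 0 t)"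
  define V where "V = unit_ball_vol (real DIM('a))"
  have V: "V \<ge> 0" by (simp add: V_def)
  let ?N = "real DIM('a)"
  have s0: "s > 0" using s by (smt (verit) of_nat_0_le_iff)
  have bound: "?e t
     \<le> ennreal V * (ennreal (t powr (-(s-?N)-1)) * indicator {1..} t)" for t
  proof (cases "t \<ge> 1")
    case False
    then have "- ball (0::'a) 1 \<inter> cball 0 t = {}" by auto
    then show ?thesis by simp
  next
    case True
      have "ennreal (t powr (-s-1)) * emeasure lborel (- ball (0::'a) 1 \<inter> cball 0 t) \<le> ennreal (t powr (-s-1)) * ennreal (V * \<bar>t\<bar> ^ DIM('a))"
        unfolding V_def by (intro mult_left_mono emeasure_cball_le) auto
      also have "\<dots> = ennreal V * ennreal (t powr (-(s-?N)-1))"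
      proof -
        have "t powr (-s-1) * (V * \<bar>t\<bar> ^ DIM('a)) = V * t powr (-(s-?N)-1)"
          using True by (simp add: powr_realpow[symmetric] powr_add[symmetric] algebra_simps)
        then show ?thesis using V by (simp flip: ennreal_mult')
      qed
      finally show ?thesis using True by (auto simp: indicator_def)
  qed
  have "(\<integral>\<^sup>+t. ?e t \<partial>lborel) \<le>
     (\<integral>\<^sup>+t. ennreal V * (ennreal (t powr (-(s-?N)-1)) * indicator {1..} t) \<partial>lborel)"
    by (intro nn_integral_mono bound)
  also have "\<dots> = ennreal V * ennreal (1/(s-?N))"
    using nn_integral_powr_tail[of 1 "s-?N"] s
    by (subst nn_integral_cmult) auto
  also have "\<dots> < \<infinity>" by (simp add: ennreal_mult_less_top)
  finally show ?thesis
    using nn_integral_norm_powr_layer[OF s0, of "- ball (0::'a) 1"] by (simp add: ennreal_mult_less_top)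
qed

section \<open>Young's inequality\<close>

lemma weighted_arith_geo_mean3:
  fixes x y z a b c :: real
  assumes "x \<ge> 0" "y \<ge> 0" "z \<ge> 0" "a > 0" "b > 0" "c > 0" "a + b + c = 1"
  shows "x powr a * y powr b * z powr c \<le> a * x + b * y + c * z"
proof (cases "x = 0 \<or> y = 0 \<or> z = 0")
  case True
  then show ?thesis using assms by auto
next
  case False
  then have pos: "x > 0" "y > 0" "z > 0" using assms by auto
  \<comment> \<open>The weighted geometric mean of \<open>y\<close> and \<open>z\<close>, with
    weights rescaled to sum to 1, reduces the three-term inequality to two two-term ones.\<close>
  define w where "w = y powr (b/(b+c)) * z powr (c/(b+c))"
  have w: "w > 0" using pos by (simp add: w_def)
  have "x powr a * w powr (b+c) \<le> a * x + (b+c) * w"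
    using assms pos w by (intro Youngs_inequality_0) auto
  moreover have "w powr (b+c) = y powr b * z powr c"
    using assms pos by (simp add: w_def powr_mult powr_powr)
  moreover have "w \<le> (b/(b+c)) * y + (c/(b+c)) * z"
    unfolding w_def using assms pos by (intro Youngs_inequality_0) (auto simp flip: add_divide_distrib)
  then have "(b+c) * w \<le> (b+c) * ((b/(b+c)) * y + (c/(b+c)) * z)"
    using assms by (intro mult_left_mono) auto
  moreover have "b + c \<noteq> 0" using assms by simp
  then have "(b+c) * ((b/(b+c)) * y + (c/(b+c)) * z) = b * y + c * z"
    by (simp add: distrib_left)
  ultimately show ?thesis by (simp add: mult.assoc)
qed

text \<open>The weighted arithmetic-geometric mean inequality bounds the integrand by three products, each of which Tonelli integrates.\<close>
lemma young_bilinear_finite: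
  fixes f k :: "'a::euclidean_space \<Rightarrow> real" and r m :: real
  assumes [measurable]: "f \<in> borel_measurable borel" "k \<in> borel_measurable borel"
    and f0: "\<And>x. f x \<ge> 0" and k0: "\<And>x. k x \<ge> 0"
    and r: "r > 1" and m: "m * (1 - 1 / (2 * r)) = 1"
    and fm: "(\<integral>\<^sup>+x. ennreal (f x powr m) \<partial>lborel) < \<infinity>"
    and kr: "(\<integral>\<^sup>+x. ennreal (k x powr r) \<partial>lborel) < \<infinity>"
  shows "(\<integral>\<^sup>+x. \<integral>\<^sup>+y. ennreal (f x * k (x - y) * f y) \<partial>lborel \<partial>lborel) < \<infinity>"
proof -
  let ?X = "\<lambda>x y. ennreal (1 - 1/r) * (ennreal (f x powr m) * ennreal (f y powr m))"
  let ?Y = "\<lambda>x z. ennreal (1/(2*r)) * (ennreal (f x powr m) * ennreal (k z powr r))"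
  define F where "F = (\<integral>\<^sup>+x. ennreal (f x powr m) \<partial>lborel)"
  define K where "K = (\<integral>\<^sup>+x. ennreal (k x powr r) \<partial>lborel)"
  have r1: "1 - 1/(2*r) > 0" using r by (simp add: field_simps)
  have m0: "m > 0" using m r1 by (metis zero_less_mult_pos2 zero_less_one)
  have m1: "m * (1 - 1 / r) + m / (2*r) = 1" using m by (simp add: algebra_simps add_divide_distrib)
  \<comment> \<open>The weights \<open>1 - 1/r\<close>, \<open>1/(2*r)\<close>,
    \<open>1/(2*r)\<close> sum to 1. In the geometric mean the kernel gets total exponent r/(2r) +
    r/(2r) = 1 and each factor \<open>f\<close> gets m (1 - 1/(2r)) = 1, so it is exactly the
    integrand.\<close>
  have pw: "f x * k (x - y) * f y \<le> (1 - 1/r) * (f x powr m * f y powr m)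
      + 1/(2*r) * (f x powr m * k (x - y) powr r) + 1/(2*r) * (f y powr m * k (x - y) powr r)" for x y
  proof -
    have "(f x powr m * f y powr m) powr (1 - 1/r) * (f x powr m * k (x - y) powr r) powr (1/(2*r)) * (f y powr m * k (x - y) powr r) powr (1/(2*r))
        \<le> (1 - 1/r) * (f x powr m * f y powr m)
      + 1/(2*r) * (f x powr m * k (x - y) powr r) + 1/(2*r) * (f y powr m * k (x - y) powr r)"
      using r by (intro weighted_arith_geo_mean3) auto
    also have "(f x powr m * f y powr m) powr (1 - 1/r) * (f x powr m * k (x - y) powr r) powr (1/(2*r)) * (f y powr m * k (x - y) powr r) powr (1/(2*r))
       = f x * k (x - y) * f y"
    proof (cases "f x = 0 \<or> f y = 0 \<or> k (x - y) = 0")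
      case True then show ?thesis by auto
    next
      case False
      then have pos: "f x > 0" "f y > 0" "k (x - y) > 0" using f0[of x] f0[of y] k0[of "x - y"] by auto
      have "(f x powr m * f y powr m) powr (1 - 1/r) * (f x powr m * k (x - y) powr r) powr (1/(2*r)) * (f y powr m * k (x - y) powr r) powr (1/(2*r))
        = f x powr (m * (1 - 1 / r) + m / (2*r)) * f y powr (m * (1 - 1 / r) + m / (2*r)) * k (x - y) powr (1/2 + 1/2)"
        using pos r unfolding powr_add by (simp add: powr_mult powr_powr)
      then show ?thesis using m1 pos by simp
    qed
    finally show ?thesis .
  qed
  have "(\<integral>\<^sup>+x. \<integral>\<^sup>+y. ennreal (f x * k (x - y) * f y) \<partial>lborel \<partial>lborel) \<le>
     (\<integral>\<^sup>+x. \<integral>\<^sup>+y. (?X x y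
      + ?Y x (x - y)) + ?Y y (x - y) \<partial>lborel \<partial>lborel)"
    using pw r by (intro nn_integral_mono) (simp flip: ennreal_mult'  ennreal_plus add: ennreal_leI)
  also have "\<dots> = (\<integral>\<^sup>+x. (\<integral>\<^sup>+y. ?X x y \<partial>lborel)
      + (\<integral>\<^sup>+y. ?Y x (x - y) \<partial>lborel) + (\<integral>\<^sup>+y. ?Y y (x - y) \<partial>lborel) \<partial>lborel)"
    by (intro nn_integral_cong) (simp add: nn_integral_add)
  also have "\<dots> = (\<integral>\<^sup>+x. (\<integral>\<^sup>+y. ?X x y \<partial>lborel) \<partial>lborel)
      + (\<integral>\<^sup>+x. (\<integral>\<^sup>+y. ?Y x (x - y) \<partial>lborel) \<partial>lborel)
      + (\<integral>\<^sup>+x. (\<integral>\<^sup>+y. ?Y y (x - y) \<partial>lborel) \<partial>lborel)"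
    by (simp add: nn_integral_add)
  also have "(\<integral>\<^sup>+x. (\<integral>\<^sup>+y. ?X x y \<partial>lborel) \<partial>lborel) = ennreal (1 - 1/r) * (F * F)"
    by (simp add: nn_integral_cmult nn_integral_multc F_def)
  also have "(\<integral>\<^sup>+x. (\<integral>\<^sup>+y. ?Y x (x - y) \<partial>lborel) \<partial>lborel) = ennreal (1/(2*r)) * (F * K)"
    using nn_integral_lborel_minus[of "\<lambda>z. ennreal (k z powr r)"]
    by (simp add: nn_integral_cmult nn_integral_multc F_def K_def)
  also have "(\<integral>\<^sup>+x. (\<integral>\<^sup>+y. ?Y y (x - y) \<partial>lborel) \<partial>lborel)
     = (\<integral>\<^sup>+y. (\<integral>\<^sup>+x. ?Y y (x - y) \<partial>lborel) \<partial>lborel)"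
    by (subst lborel_pair.Fubini') simp_all
  also have "\<dots> = ennreal (1/(2*r)) * (F * K)"
    using nn_integral_lborel_plus[of "\<lambda>z. ennreal (k z powr r)" "- _"]
    by (simp add: nn_integral_cmult nn_integral_multc F_def K_def)
  also have "ennreal (1 - 1/r) * (F * F) + ennreal (1/(2*r)) * (F * K) + ennreal (1/(2*r)) * (F * K) < \<infinity>"
    using fm kr unfolding F_def[symmetric] K_def[symmetric] by (simp add: ennreal_mult_less_top)
  finally show ?thesis .
qed

text \<open>Qualitative form of Young's convolution inequality from L^r and L^2 to L^q. The usual
  pointwise Hoelder estimate becomes an arithmetic-geometric mean inequality, made homogeneous by
  dividing by the value of A(x), the integral of k^r G^2; the outcome u <= C A^(1/q) has an
  integrable q-th power.\<close>

lemma young_power_finite: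
  fixes u G k :: "'a::euclidean_space \<Rightarrow> real" and r q :: real
  assumes [measurable]: "u \<in> borel_measurable borel" "G \<in> borel_measurable borel" "k \<in> borel_measurable borel"
    and u0: "\<And>x. u x \<ge> 0" and G0: "\<And>x. G x \<ge> 0" and k0: "\<And>x. k x \<ge> 0"
    and q: "q > 2" and r: "r * (1/2 + 1/q) = 1"
    and kr: "(\<integral>\<^sup>+x. ennreal (k x powr r) \<partial>lborel) < \<infinity>"
    and G2: "(\<integral>\<^sup>+x. ennreal ((G x)\<^sup>2) \<partial>lborel) < \<infinity>"
    and le: "AE x in lborel. ennreal (u x) \<le> (\<integral>\<^sup>+w. ennreal (k w * G (x + w)) \<partial>lborel)"
  shows "(\<integral>\<^sup>+x. ennreal (u x powr q) \<partial>lborel) < \<infinity>"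
proof -
  let ?a = "\<lambda>x w. k w powr r * (G (x + w))\<^sup>2"
  define K where "K = (\<integral>\<^sup>+x. ennreal (k x powr r) \<partial>lborel)"
  define g where "g = (\<integral>\<^sup>+x. ennreal ((G x)\<^sup>2) \<partial>lborel)"
  define A where "A x = (\<integral>\<^sup>+w. ennreal (?a x w) \<partial>lborel)" for x
  have [measurable]: "A \<in> borel_measurable borel" unfolding A_def by measurable
  have intA: "(\<integral>\<^sup>+x. A x \<partial>lborel) = K * g"
  proof -
    have "(\<integral>\<^sup>+x. A x \<partial>lborel) = (\<integral>\<^sup>+w. (\<integral>\<^sup>+x. ennreal (?a x w) \<partial>lborel) \<partial>lborel)"
      unfolding A_def by (subst lborel_pair.Fubini') simp_all
    also have "\<dots> = (\<integral>\<^sup>+w. ennreal (k w powr r) * g \<partial>lborel)"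
    proof (intro nn_integral_cong)
      fix w
      have "(\<integral>\<^sup>+x. ennreal (?a x w) \<partial>lborel) = (\<integral>\<^sup>+x. ennreal (k w powr r) * ennreal ((G (w + x))\<^sup>2) \<partial>lborel)"
        by (simp add: ennreal_mult add.commute)
      then show "(\<integral>\<^sup>+x. ennreal (?a x w) \<partial>lborel) = ennreal (k w powr r) * g"
        using nn_integral_lborel_plus[of "\<lambda>z. ennreal ((G z)\<^sup>2)" w] by (simp add: nn_integral_cmult g_def)
    qed
    finally show ?thesis by (simp add: nn_integral_multc K_def)
  qed
  have Kfin: "K < \<infinity>" and gfin: "g < \<infinity>" using kr G2 by (auto simp: K_def g_def)
  have Afin: "AE x in lborel. A x \<noteq> \<infinity>"
    using intA Kfin gfin by (intro nn_integral_PInf_AE) (auto simp: ennreal_mult_less_top ennreal_mult_eq_top_iff)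
  \<comment> \<open>The weights are 1/q, 1/2 and \<open>c3\<close>. They are placed so that
    \<open>k\<close> receives the exponent r/q + r/2 = 1 and \<open>G\<close> the exponent 2/q + 2
    \<open>c3\<close> = 1.\<close>
  define c3 where "c3 = 1/2 - 1/q"
  have c3: "c3 > 0" using q by (simp add: c3_def field_simps)
  \<comment> \<open>The integrals over \<open>w\<close> of the three terms of the mean: the first is
    normalised by A(x) and so contributes just its weight 1/q.\<close>
  define C where "C = 1/q + enn2real K / 2 + c3 * enn2real g"
  have C0: "C \<ge> 0" using q c3 by (auto simp: C_def)
  have rpos: "r > 0" using r q by (smt (verit) divide_pos_pos zero_less_mult_pos2)
  have rq: "r / q + r / 2 = 1" using r by (simp add: algebra_simps)
  have bound: "AE x in lborel. ennreal (u x powr q) \<le> ennreal (C powr q) * A x"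
    using le Afin
  proof eventually_elim
    fix x assume le: "ennreal (u x) \<le> (\<integral>\<^sup>+w. ennreal (k w * G (x + w)) \<partial>lborel)" and fin: "A x \<noteq> \<infinity>"
    obtain a where a: "a \<ge> 0" "A x = ennreal a" using fin by (cases "A x") auto
    \<comment> \<open>The normalisation divides by \<open>a\<close>. If \<open>a = 0\<close>, the
      integrand that bounds \<open>u x\<close> vanishes almost everywhere, and so
      \<open>u x = 0\<close>.\<close>
    show "ennreal (u x powr q) \<le> ennreal (C powr q) * A x"
    proof (cases "a = 0")
      case True
      then have "AE w in lborel. ennreal (?a x w) = 0"
      proof -
        have "(\<integral>\<^sup>+w. ennreal (?a x w) \<partial>lborel) = 0"
          using a(2) True unfolding A_def by simp
        then show ?thesis by (subst (asm) nn_integral_0_iff_AE) auto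
      qed
      then have "AE w in lborel. ennreal (k w * G (x + w)) = 0"
        by eventually_elim (use k0 G0 in \<open>auto simp: ennreal_eq_0_iff mult_le_0_iff not_less antisym\<close>)
      then have "(\<integral>\<^sup>+w. ennreal (k w * G (x + w)) \<partial>lborel) = 0"
        by (subst nn_integral_0_iff_AE) auto
      then have "u x = 0" using le u0[of x] by (simp add: ennreal_eq_0_iff)
      then show ?thesis by simp
    next
      case False
      then have apos: "a > 0" using a by simp
      have pw: "k w * G (x + w) \<le> a powr (1/q) * (1/q * (?a x w / a) + 1/2 * k w powr r + c3 * (G (x + w))\<^sup>2)" for w
      proof -
        have "(?a x w / a) powr (1/q) * (k w powr r) powr (1/2) * ((G (x + w))\<^sup>2) powr c3
           \<le> 1/q * (?a x w / a) + 1/2 * k w powr r + c3 * (G (x + w))\<^sup>2"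
          using apos q c3 by (intro weighted_arith_geo_mean3) (auto simp: c3_def)
        moreover have "k w * G (x + w) = a powr (1/q) * ((?a x w / a) powr (1/q) * (k w powr r) powr (1/2) * ((G (x + w))\<^sup>2) powr c3)"
        proof (cases "k w = 0 \<or> G (x + w) = 0")
          case True then show ?thesis by auto
        next
          case False
          then have pos: "k w > 0" "G (x + w) > 0" using k0[of w] G0[of "x + w"] by auto
          have G2: "(G (x + w))\<^sup>2 = G (x + w) powr 2" using pos by (simp add: powr_numeral)
          have "a powr (1/q) * ((?a x w / a) powr (1/q) * (k w powr r) powr (1/2) * ((G (x + w))\<^sup>2) powr c3)
             = k w powr (r / q + r / 2) * G (x + w) powr (2/q + 2 * c3)"
            unfolding G2 powr_add using pos apos by (simp add: powr_mult powr_divide powr_powr del: powr_numeral)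
          also have "2/q + 2 * c3 = 1" by (simp add: c3_def)
          finally show ?thesis using rq pos by simp
        qed
        ultimately show ?thesis by (simp add: mult_left_mono)
      qed
      have "(\<integral>\<^sup>+w. ennreal (k w * G (x + w)) \<partial>lborel) \<le> (\<integral>\<^sup>+w. ennreal (a powr (1/q)) * (ennreal (1/q/a) * ennreal (?a x w)
          + ennreal (1/2) * ennreal (k w powr r) + ennreal c3 * ennreal ((G (x + w))\<^sup>2)) \<partial>lborel)"
      proof (intro nn_integral_mono)
        fix w
        have "ennreal (k w * G (x + w)) \<le> ennreal (a powr (1/q) * (1/q/a * (?a x w) + 1/2 * k w powr r + c3 * (G (x + w))\<^sup>2))"
          using pw[of w] by (intro ennreal_leI) simp
        also have "\<dots> = ennreal (a powr (1/q)) * (ennreal (1/q/a) * ennreal (?a x w)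
          + ennreal (1/2) * ennreal (k w powr r) + ennreal c3 * ennreal ((G (x + w))\<^sup>2))"
          using apos q c3 by (subst ennreal_mult ennreal_plus | simp)+
        finally show "ennreal (k w * G (x + w)) \<le> \<dots>" .
      qed
      also have "\<dots> = ennreal (a powr (1/q)) * (ennreal (1/q/a) * A x + ennreal (1/2) * K + ennreal c3 * g)"
        using nn_integral_lborel_plus[of "\<lambda>z. ennreal ((G z)\<^sup>2)" x]
        by (simp add: nn_integral_cmult nn_integral_add A_def K_def g_def)
      also have "\<dots> = ennreal (a powr (1/q) * C)"
      proof -
        have "K = ennreal (enn2real K)" "g = ennreal (enn2real g)" using Kfin gfin by auto
        then have "ennreal (1/q/a) * A x + ennreal (1/2) * K + ennreal c3 * g = ennreal (1/q/a) * ennreal a + ennreal (1/2) * ennreal (enn2real K) + ennreal c3 * ennreal (enn2real g)"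
          using a by simp
        also have "\<dots> = ennreal (1/q/a * a + 1/2 * enn2real K + c3 * enn2real g)"
          using apos q c3 by (subst ennreal_mult ennreal_plus | simp)+
        also have "1/q/a * a + 1/2 * enn2real K + c3 * enn2real g = C" using apos by (simp add: C_def)
        finally show ?thesis using C0 by (simp add: ennreal_mult)
      qed
      finally have "u x \<le> a powr (1/q) * C" using le C0 by (meson ennreal_le_iff mult_nonneg_nonneg order_trans powr_ge_zero)
      then have "u x powr q \<le> (a powr (1/q) * C) powr q"
        using u0 q by (intro powr_mono2) auto
      also have "\<dots> = C powr q * a" using apos C0 q by (simp add: powr_mult powr_powr)
      finally show ?thesis using a by (simp add: ennreal_leI flip: ennreal_mult)
    qed
  qed
  have "(\<integral>\<^sup>+x. ennreal (u x powr q) \<partial>lborel) \<le> (\<integral>\<^sup>+x. ennreal (C powr q) * A x \<partial>lborel)"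
    using bound by (rule nn_integral_mono_AE)
  also have "\<dots> = ennreal (C powr q) * (K * g)" by (simp add: nn_integral_cmult intA)
  also have "\<dots> < \<infinity>" using Kfin gfin by (simp add: ennreal_mult_less_top)
  finally show ?thesis .
qed

section \<open>Gaussian approximation of the identity\<close>

text \<open>Boxes form an intersection-stable generator of the Borel sets, so the measures with
  densities \<open>f\<close> and \<open>g\<close> coincide; finiteness on the exhausting boxes makes
  the uniqueness theorem applicable.\<close>

lemma nn_integral_box_unique:
  fixes f g :: "'a::euclidean_space \<Rightarrow> ennreal"
  assumes [measurable]: "f \<in> borel_measurable borel" "g \<in> borel_measurable borel"
    and eq: "\<And>a b. (\<integral>\<^sup>+x. f x * indicator (box a b) x \<partial>lborel) = (\<integral>\<^sup>+x. g x * indicator (box a b) x \<partial>lborel)"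
    and fin: "\<And>a b. (\<integral>\<^sup>+x. f x * indicator (box a b) x \<partial>lborel) \<noteq> \<infinity>"
  shows "AE x in lborel. f x = g x"
proof -
  let ?E = "range (\<lambda>(a, b). box a b :: 'a set)"
  let ?A = "\<lambda>n::nat. box (- (real n *\<^sub>R One)) (real n *\<^sub>R One) :: 'a set"
  have "density lborel f = density lborel g"
  proof (rule measure_eqI_generator_eq)
    show "Int_stable ?E"
      by (rule Int_stableI, clarsimp simp: box_Int_box image_iff, intro exI, rule refl)
    show "?E \<subseteq> Pow UNIV" "sets (density lborel f) = sigma_sets UNIV ?E" "sets (density lborel g) = sigma_sets UNIV ?E"
      by (simp_all add: borel_eq_box)
    show "range ?A \<subseteq> ?E" "(\<Union>i. ?A i) = UNIV"
      unfolding UN_box_eq_UNIV by auto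
    show "emeasure (density lborel f) X = emeasure (density lborel g) X" if "X \<in> ?E" for X
      using that eq by (auto simp: emeasure_density)
    show "emeasure (density lborel f) (?A i) \<noteq> \<infinity>" for i
      using fin by (simp add: emeasure_density)
  qed
  then show ?thesis by (subst (asm) sigma_finite_measure.density_unique_iff[OF sigma_finite_lborel]) auto
qed

text \<open>Outside the unit ball, (x/n)^n <= exp x with n = N + 1 compares the Gaussian with a
  multiple of |z|^(-2n), whose exponent exceeds the dimension. This is also the origin of the
  constant \<open>K\<close>.\<close>

lemma nn_integral_gauss_finite:
  fixes c :: real
  assumes c: "c > 0"
  shows "(\<integral>\<^sup>+z. ennreal (exp (- c * (norm (z::'a::euclidean_space))\<^sup>2)) \<partial>lborel) < \<infinity>"
proof -
  define n where "n = Suc DIM('a)"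
  define K where "K = (real n / c) ^ n"
  have K: "K \<ge> 0" using c by (simp add: K_def)
  have pw: "ennreal (exp (- c * (norm z)\<^sup>2)) \<le> indicator (ball 0 1) z + ennreal K * (ennreal (norm z powr (- real (2*n))) * indicator (- ball 0 1) z)" for z :: 'a
  proof (cases "norm z < 1")
    case True
    then show ?thesis using c by (auto simp: indicator_def )
  next
    case False
    then have z: "norm z \<ge> 1" by simp
    have "(c * (norm z)\<^sup>2 / real n) ^ n \<le> (1 + c * (norm z)\<^sup>2 / real n) ^ n"
      using c by (intro power_mono) auto
    also have "\<dots> \<le> exp (c * (norm z)\<^sup>2)"
    proof (rule exp_ge_one_plus_x_over_n_power_n)
      have "c * (norm z)\<^sup>2 \<ge> 0" using c by simp
      then show "- real n \<le> c * (norm z)\<^sup>2" by linarith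
    qed (simp add: n_def)
    finally have "exp (- c * (norm z)\<^sup>2) \<le> inverse ((c * (norm z)\<^sup>2 / real n) ^ n)"
    proof -
      assume *: "(c * (norm z)\<^sup>2 / real n) ^ n \<le> exp (c * (norm z)\<^sup>2)"
      have "(c * (norm z)\<^sup>2 / real n) ^ n > 0" using c z less_le_trans[OF zero_less_one z] by (intro zero_less_power divide_pos_pos mult_pos_pos) (auto simp: n_def)
      then have "inverse (exp (c * (norm z)\<^sup>2)) \<le> inverse ((c * (norm z)\<^sup>2 / real n) ^ n)"
        using * by (intro le_imp_inverse_le)
      then show ?thesis by (simp add: exp_minus)
    qed
    also have "\<dots> = K * norm z powr (- real (2*n))"
    proof -
      have "norm z powr (- real (2*n)) = inverse ((norm z)\<^sup>2 ^ n)"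
        using z by (subst powr_minus, subst powr_realpow) (auto simp: power_mult)
      then show ?thesis by (simp add: K_def power_divide power_mult_distrib power_inverse divide_inverse mult_ac)
    qed
    finally show ?thesis using False K by (simp add: ennreal_leI flip: ennreal_mult)
  qed
  have "(\<integral>\<^sup>+z. ennreal (exp (- c * (norm (z::'a))\<^sup>2)) \<partial>lborel) \<le>
     (\<integral>\<^sup>+z. indicator (ball 0 1) (z::'a) + ennreal K * (ennreal (norm z powr (- real (2*n))) * indicator (- ball 0 1) z) \<partial>lborel)"
    by (intro nn_integral_mono pw)
  also have "\<dots> = emeasure lborel (ball (0::'a) 1) + ennreal K * (\<integral>\<^sup>+z. ennreal (norm z powr (- real (2*n))) * indicator (- ball 0 1) (z::'a) \<partial>lborel)"
  proof -
    have [measurable]: "- ball (0::'a) 1 \<in> sets borel" "ball (0::'a) 1 \<in> sets borel" by (auto intro: borel_comp)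
    have "(\<lambda>z. ennreal (norm z powr (- real (2*n))) * indicator (- ball 0 1) (z::'a)) \<in> borel_measurable lborel"
      by measurable
    then show ?thesis by (subst nn_integral_add) (auto simp: nn_integral_cmult)
  qed
  also have "\<dots> < \<infinity>"
    using nn_integral_norm_powr_outside_finite[where 'a='a, of "real (2*n)"]
    by (auto simp: emeasure_ball ennreal_mult_less_top n_def)
  finally show ?thesis .
qed

lemma nn_integral_gauss_pos:
  "(\<integral>\<^sup>+z. ennreal (exp (- c * (norm (z::'a::euclidean_space))\<^sup>2)) \<partial>lborel) > 0"
proof (rule ccontr)
  assume "\<not> ?thesis"
  then have "AE z in (lborel::'a measure). False"
    by (subst (asm) not_gr_zero, subst (asm) nn_integral_0_iff_AE) (auto simp: ennreal_eq_0_iff)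
  then have "UNIV \<in> null_sets (lborel::'a measure)"
    by (subst (asm) AE_iff_null) auto
  then show False by (simp add: null_sets_def)
qed

text \<open>The averages are integrated over a box and the Gaussian is moved by Tonelli from
  \<open>f\<close> onto the indicator. Only mollified indicators then need a limit, and these are
  dominated by a multiple of a fixed Gaussian weight, for which \<open>f\<close> and
  \<open>g\<close> are assumed integrable.\<close>

lemma gauss_mollifier_unique:
  fixes f g :: "'a::euclidean_space \<Rightarrow> ennreal"
  assumes [measurable]: "f \<in> borel_measurable borel" "g \<in> borel_measurable borel"
    and ffin: "(\<integral>\<^sup>+x. ennreal (exp (- (1/2) * (norm x)\<^sup>2)) * f x \<partial>lborel) < \<infinity>"
    and gfin: "(\<integral>\<^sup>+x. ennreal (exp (- (1/2) * (norm x)\<^sup>2)) * g x \<partial>lborel) < \<infinity>"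
    and eq: "\<And>n::nat. \<exists>t > real n. AE z in lborel. (\<integral>\<^sup>+x. ennreal (exp (-2 * t * (norm (x - z))\<^sup>2)) * f x \<partial>lborel)
        = (\<integral>\<^sup>+x. ennreal (exp (-2 * t * (norm (x - z))\<^sup>2)) * g x \<partial>lborel)"
  shows "AE x in lborel. f x = g x"
proof -
  let ?T = "\<lambda>s x z. ennreal (exp (-2 * s * (norm (x - z :: 'a))\<^sup>2))"
  let ?B = "\<lambda>h a b. \<integral>\<^sup>+x. h x * indicator (box a (b :: 'a)) x \<partial>lborel"
  let ?W = "\<lambda>x. ennreal (exp (- (1/2) * (norm (x :: 'a))\<^sup>2))"
  let ?E = "\<lambda>w. ennreal (exp (-2 * (norm (w :: 'a))\<^sup>2))"
  \<comment> \<open>Scales beyond \<open>Suc n\<close> rather than \<open>n\<close> keep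
    \<open>t n\<close> at least 1, hence the width \<open>c n\<close> at most 1, which the
    domination of \<open>p n\<close> relies on.\<close>
  define t where "t n = (SOME t. t > real (Suc n) \<and> (AE z in lborel. (\<integral>\<^sup>+x. ?T t x z * f x \<partial>lborel)
        = (\<integral>\<^sup>+x. ?T t x z * g x \<partial>lborel)))" for n
  have t: "t n > real (Suc n)" "AE z in lborel. (\<integral>\<^sup>+x. ?T (t n) x z * f x \<partial>lborel)
        = (\<integral>\<^sup>+x. ?T (t n) x z * g x \<partial>lborel)" for n
    using someI_ex[OF eq[of "Suc n"]] unfolding t_def by blast+
  have t1: "t n \<ge> 1" for n using t(1)[of n] by simp
  \<comment> \<open>The width of the Gaussian: z = x + c w turns exp(-2 t |x - z|^2) into exp(-2
    |w|^2), whatever the scale.\<close>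
  define c where "c n = 1 / sqrt (t n)" for n
  have c: "c n > 0" "c n \<le> 1" "t n * (c n)\<^sup>2 = 1" for n
    using t1[of n] by (auto simp: c_def power_divide)
  have c0: "c \<longlonglongrightarrow> 0"
  proof -
    have "filterlim t at_top sequentially"
      by (rule filterlim_at_top_mono[OF filterlim_compose[OF filterlim_real_sequentially filterlim_Suc]])
         (use t(1) in \<open>auto intro!: always_eventually less_imp_le\<close>)
    then show ?thesis unfolding c_def
      by (intro real_tendsto_divide_at_top[OF tendsto_const] filterlim_compose[OF sqrt_at_top])
  qed
  define M where "M = (\<integral>\<^sup>+w. ?E w \<partial>lborel)"
  have M: "M > 0" "M < \<infinity>" unfolding M_def
    using nn_integral_gauss_pos[of 2, where 'a='a] nn_integral_gauss_finite[of 2, where 'a='a] by simp_all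
  have box: "?B f a b = ?B g a b \<and>
     ?B f a b \<noteq> \<infinity>" for a b
  proof -
    define p where "p n x = (\<integral>\<^sup>+w. ?E w * indicator (box a b) (x + c n *\<^sub>R w) \<partial>lborel)" for n x
    have [measurable]: "p n \<in> borel_measurable borel" for n unfolding p_def by measurable
    obtain R where R: "R > 0" "\<And>x. x \<in> box a b \<Longrightarrow> norm x \<le> R"
      using bounded_box[of a b] by (auto simp: bounded_pos)
    \<comment> \<open>If x + c w lies in the box, then |x|^2 <= 2 R^2 + 2 |w|^2. Half of the
      exponent -2 |w|^2 is thus spent on decay in x, and the other half stays integrable in
      w.\<close>
    define L where "L = ennreal (exp (R\<^sup>2)) * (\<integral>\<^sup>+w. ennreal (exp (-1 * (norm (w::'a))\<^sup>2)) \<partial>lborel)"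
    have L: "L < \<infinity>" unfolding L_def using nn_integral_gauss_finite[of 1, where 'a='a] by (simp add: ennreal_mult_less_top)
    have dom: "p n x \<le> ?W x * L" for n x
    proof -
      have "p n x \<le> (\<integral>\<^sup>+w. ?W x * (ennreal (exp (R\<^sup>2)) * ennreal (exp (-1 * (norm (w::'a))\<^sup>2))) \<partial>lborel)"
        unfolding p_def
      proof (intro nn_integral_mono)
        fix w :: 'a
        show "?E w * indicator (box a b) (x + c n *\<^sub>R w) \<le> ?W x * (ennreal (exp (R\<^sup>2)) * ennreal (exp (-1 * (norm w)\<^sup>2)))"
        proof (cases "x + c n *\<^sub>R w \<in> box a b")
          case True
          have "norm x \<le> norm (x + c n *\<^sub>R w) + norm (c n *\<^sub>R w)"
            by (metis add_diff_cancel_right' norm_triangle_ineq4)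
          also have "\<dots> \<le> R + norm w"
            using R(2)[OF True] c[of n] by (intro add_mono) (auto simp: mult_left_le_one_le)
          finally have "(norm x)\<^sup>2 \<le> (R + norm w)\<^sup>2" by (intro power_mono) auto
          also have "\<dots> \<le> 2 * R\<^sup>2 + 2 * (norm w)\<^sup>2"
            using zero_le_power2[of "R - norm w"] by (simp add: power2_eq_square algebra_simps)
          finally have "-2 * (norm w)\<^sup>2 \<le> - (1/2) * (norm x)\<^sup>2 + R\<^sup>2 + -1 * (norm w)\<^sup>2" by simp
          then have "exp (-2 * (norm w)\<^sup>2) \<le> exp (- (1/2) * (norm x)\<^sup>2 + R\<^sup>2 + -1 * (norm w)\<^sup>2)" by simp
          also have "\<dots> = exp (- (1/2) * (norm x)\<^sup>2) * (exp (R\<^sup>2) * exp (-1 * (norm w)\<^sup>2))"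
            by (simp only: exp_add mult.assoc)
          finally show ?thesis using True by (simp add: ennreal_leI flip: ennreal_mult)
        qed auto
      qed
      also have "\<dots> = ?W x * L"
        unfolding L_def by (simp add: nn_integral_cmult)
      finally show ?thesis .
    qed
    have swap: "(\<integral>\<^sup>+z. (\<integral>\<^sup>+x. ?T (t n) x z * h x \<partial>lborel) * indicator (box a b) z \<partial>lborel)
       = ennreal (c n ^ DIM('a)) * (\<integral>\<^sup>+x. h x * p n x \<partial>lborel)"
      if [measurable]: "h \<in> borel_measurable borel" for h :: "'a \<Rightarrow> ennreal" and n
    proof -
      have "(\<integral>\<^sup>+z. (\<integral>\<^sup>+x. ?T (t n) x z * h x \<partial>lborel) * indicator (box a b) z \<partial>lborel)
        = (\<integral>\<^sup>+z. (\<integral>\<^sup>+x. h x * (?T (t n) x z * indicator (box a b) z) \<partial>lborel) \<partial>lborel)"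
      proof (intro nn_integral_cong)
        fix z
        show "(\<integral>\<^sup>+x. ?T (t n) x z * h x \<partial>lborel) * indicator (box a b) z
          = (\<integral>\<^sup>+x. h x * (?T (t n) x z * indicator (box a b) z) \<partial>lborel)"
          by (subst nn_integral_multc[symmetric]) (simp_all only: mult_ac, measurable)
      qed
      also have "\<dots> = (\<integral>\<^sup>+x. (\<integral>\<^sup>+z. h x * (?T (t n) x z * indicator (box a b) z) \<partial>lborel) \<partial>lborel)"
        by (subst lborel_pair.Fubini') simp_all
      also have "\<dots> = (\<integral>\<^sup>+x. ennreal (c n ^ DIM('a)) * (h x * p n x) \<partial>lborel)"
      proof (intro nn_integral_cong)
        fix x
        have "(\<integral>\<^sup>+z. ?T (t n) x z * indicator (box a b) z \<partial>lborel)
           = ennreal (\<bar>c n\<bar> ^ DIM('a)) * (\<integral>\<^sup>+w. ?T (t n) x (x + c n *\<^sub>R w) * indicator (box a b) (x + c n *\<^sub>R w) \<partial>lborel)"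
          using c(1)[of n] by (intro nn_integral_lborel_affine) auto
        also have "(\<lambda>w. ?T (t n) x (x + c n *\<^sub>R w) * indicator (box a b) (x + c n *\<^sub>R w))
           = (\<lambda>w. ?E w * indicator (box a b) (x + c n *\<^sub>R w))"
        proof
          fix w
          have "t n * (norm (x - (x + c n *\<^sub>R w)))\<^sup>2 = (t n * (c n)\<^sup>2) * (norm w)\<^sup>2"
            by (simp add: power_mult_distrib)
          then show "?T (t n) x (x + c n *\<^sub>R w) * indicator (box a b) (x + c n *\<^sub>R w)
             = ?E w * indicator (box a b) (x + c n *\<^sub>R w)"
            unfolding c(3) mult.assoc by simp
        qed
        finally show "(\<integral>\<^sup>+z. h x * (?T (t n) x z * indicator (box a b) z) \<partial>lborel)
          = ennreal (c n ^ DIM('a)) * (h x * p n x)"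
          using c(1)[of n] by (simp add: nn_integral_cmult p_def mult_ac)
      qed
      finally show ?thesis by (simp add: nn_integral_cmult)
    qed
    have peq: "(\<integral>\<^sup>+x. f x * p n x \<partial>lborel) = (\<integral>\<^sup>+x. g x * p n x \<partial>lborel)" for n
    proof -
      have "ennreal (c n ^ DIM('a)) * (\<integral>\<^sup>+x. f x * p n x \<partial>lborel) = ennreal (c n ^ DIM('a)) * (\<integral>\<^sup>+x. g x * p n x \<partial>lborel)"
        using t(2)[of n] by (subst (1 2) swap[symmetric]) (auto intro!: nn_integral_cong_AE)
      then show ?thesis using zero_less_power[OF c(1)[of n], of "DIM('a)"] by (auto simp: ennreal_mult_cancel_left ennreal_eq_0_iff not_le)
    qed
    \<comment> \<open>Off the frontier of the box the shifted indicators are eventually constant;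
      the frontier of a convex set is a null set.\<close>
    have plim: "AE x in lborel. (\<lambda>n. p n x) \<longlonglongrightarrow> M * indicator (box a b) x"
    proof -
      have "frontier (box a b) \<in> null_sets lborel"
        using negligible_convex_frontier[of "box a b"] by (auto simp: negligible_iff_null_sets null_sets_completion_iff)
      then have "AE x in lborel. x \<notin> frontier (box a b)" by (rule AE_not_in)
      then show ?thesis
      proof eventually_elim
        fix x assume x: "x \<notin> frontier (box a b)"
        have ind: "(\<lambda>n. indicator (box a b) (x + c n *\<^sub>R w) :: ennreal) \<longlonglongrightarrow> indicator (box a b) x" for w
        proof -
          have lim: "(\<lambda>n. x + c n *\<^sub>R w) \<longlonglongrightarrow> x"
            using tendsto_add[OF tendsto_const[of x] tendsto_scaleR[OF c0 tendsto_const[of w]]] by simp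
          show ?thesis
          proof (cases "x \<in> box a b")
            case True
            then have "\<forall>\<^sub>F n in sequentially. x + c n *\<^sub>R w \<in> box a b"
              using topological_tendstoD[OF lim open_box] by blast
            then show ?thesis using True by (intro tendsto_eventually) (auto elim: eventually_mono)
          next
            case False
            then have "x \<in> - closure (box a b)" using x unfolding frontier_def interior_open[OF open_box] by simp
            then have "\<forall>\<^sub>F n in sequentially. x + c n *\<^sub>R w \<in> - closure (box a b)"
              using topological_tendstoD[OF lim, of "- closure (box a b)"] by auto
            then have "\<forall>\<^sub>F n in sequentially. x + c n *\<^sub>R w \<notin> box a b"
              by eventually_elim (use closure_subset in auto)
            then show ?thesis using False by (intro tendsto_eventually) (auto elim: eventually_mono)
          qed
        qed
        have "(\<lambda>n. p n x) \<longlonglongrightarrow> (\<integral>\<^sup>+w. ?E w * indicator (box a b) x \<partial>lborel)"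
          unfolding p_def
        proof (rule nn_integral_dominated_convergence[where w="\<lambda>w. ?E w"])
          show "(\<integral>\<^sup>+w. ?E w \<partial>lborel) < \<infinity>" using M by (simp add: M_def)
          show "AE w in lborel. (\<lambda>i. ?E w * indicator (box a b) (x + c i *\<^sub>R w)) \<longlonglongrightarrow> ?E w * indicator (box a b) x"
            by (intro AE_I2 ennreal_tendsto_cmult ind) auto
        qed (auto simp: indicator_def)
        then show "(\<lambda>n. p n x) \<longlonglongrightarrow> M * indicator (box a b) x"
          by (simp add: nn_integral_multc M_def)
      qed
    qed
    have lim: "(\<lambda>n. \<integral>\<^sup>+x. h x * p n x \<partial>lborel) \<longlonglongrightarrow> M * ?B h a b
       \<and> ?B h a b < \<infinity>"
      if [measurable]: "h \<in> borel_measurable borel" and h: "(\<integral>\<^sup>+x. ?W x * h x \<partial>lborel) < \<infinity>" for h :: "'a \<Rightarrow> ennreal"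
    proof -
      have hL: "(\<integral>\<^sup>+x. h x * (?W x * L) \<partial>lborel) < \<infinity>"
      proof -
        have "(\<integral>\<^sup>+x. h x * (?W x * L) \<partial>lborel) = (\<integral>\<^sup>+x. ?W x * h x * L \<partial>lborel)"
          by (intro nn_integral_cong) (simp only: mult_ac)
        also have "\<dots> = (\<integral>\<^sup>+x. ?W x * h x \<partial>lborel) * L"
          by (rule nn_integral_multc) simp
        finally show ?thesis using h L by (simp add: ennreal_mult_less_top)
      qed
      have hfin: "AE x in lborel. h x \<noteq> \<infinity>"
      proof -
        have "AE x in lborel. ?W x * h x \<noteq> \<infinity>"
          using h by (intro nn_integral_PInf_AE) auto
        then show ?thesis by eventually_elim (auto simp: ennreal_mult_eq_top_iff ennreal_eq_0_iff)
      qed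
      have 1: "(\<lambda>n. \<integral>\<^sup>+x. h x * p n x \<partial>lborel) \<longlonglongrightarrow> (\<integral>\<^sup>+x. h x * (M * indicator (box a b) x) \<partial>lborel)"
      proof (rule nn_integral_dominated_convergence[where w="\<lambda>x. h x * (?W x * L)"])
        show "AE x in lborel. (\<lambda>n. h x * p n x) \<longlonglongrightarrow> h x * (M * indicator (box a b) x)"
          using plim hfin by eventually_elim (intro ennreal_tendsto_cmult, metis infinity_ennreal_def less_top, assumption)
        show "AE x in lborel. h x * p j x \<le> h x * (?W x * L)" for j
          using dom by (intro AE_I2 mult_left_mono) auto
      qed (use hL in auto)
      have 2: "(\<integral>\<^sup>+x. h x * (M * indicator (box a b) x) \<partial>lborel) = M * ?B h a b"
        by (subst nn_integral_cmult[symmetric]) (simp_all only: mult_ac, measurable)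
      \<comment> \<open>In the limit, the domination of \<open>p n\<close> bounds the box indicator
        itself by the Gaussian weight, which yields finiteness of the integral of \<open>h\<close>
        over the box.\<close>
      have "(\<integral>\<^sup>+x. h x * (M * indicator (box a b) x) \<partial>lborel) \<le> (\<integral>\<^sup>+x. h x * (?W x * L) \<partial>lborel)"
      proof (intro nn_integral_mono_AE, use plim in eventually_elim)
        fix x assume "(\<lambda>n. p n x) \<longlonglongrightarrow> M * indicator (box a b) x"
        then have "M * indicator (box a b) x \<le> ?W x * L"
          using dom by (intro LIMSEQ_le_const2) auto
        then show "h x * (M * indicator (box a b) x) \<le> h x * (?W x * L)"
          by (intro mult_left_mono) auto
      qed
      with hL have "M * ?B h a b < \<infinity>" unfolding 2 by simp
      then have 3: "?B h a b < \<infinity>" using M(1) by (auto simp: ennreal_mult_less_top)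
      show ?thesis using 1 2 3 by simp
    qed
    note limf = lim[OF assms(1) ffin] and limg = lim[OF assms(2) gfin]
    have "(\<lambda>n. \<integral>\<^sup>+x. g x * p n x \<partial>lborel) \<longlonglongrightarrow> M * ?B f a b"
      using limf unfolding peq by (rule conjunct1)
    then have "M * ?B f a b = M * ?B g a b"
      using limg by (blast intro: LIMSEQ_unique)
    then have "?B f a b = ?B g a b"
      using M unfolding ennreal_mult_cancel_left by auto
    then show ?thesis using limf by (metis infinity_ennreal_def less_irrefl)
  qed
  show ?thesis using box by (intro nn_integral_box_unique[OF assms(1,2)]) blast+
qed

section \<open>Positive definiteness of the Riesz energy\<close>

text \<open>The integral of (a - b)^2 is C - 2C + C = 0. The identity is kept in additive form,
  since cancellation in \<open>ennreal\<close> is safe only for the finite summand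
  \<open>C + C\<close>.\<close>

lemma nn_integral_Cauchy_Schwarz_eq_imp_AE_eq:
  fixes a b :: "'b \<Rightarrow> ennreal"
  assumes [measurable]: "a \<in> borel_measurable M" "b \<in> borel_measurable M"
    and aa: "(\<integral>\<^sup>+x. a x * a x \<partial>M) = C" and bb: "(\<integral>\<^sup>+x. b x * b x \<partial>M) = C"
    and ab: "(\<integral>\<^sup>+x. a x * b x \<partial>M) = C" and C: "C < \<infinity>"
  shows "AE x in M. a x = b x"
proof -
  let ?d = "\<lambda>x. ennreal ((enn2real (a x) - enn2real (b x))\<^sup>2)"
  have fin: "AE x in M. h x \<noteq> \<infinity>" if [measurable]: "h \<in> borel_measurable M" and "(\<integral>\<^sup>+x. h x * h x \<partial>M) = C" for h
  proof -
    have "AE x in M. h x * h x \<noteq> \<infinity>" using that C by (intro nn_integral_PInf_AE) auto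
    then show ?thesis by eventually_elim (auto simp: ennreal_mult_eq_top_iff)
  qed
  note fa = fin[OF assms(1) aa] and fb = fin[OF assms(2) bb]
  have "(\<integral>\<^sup>+x. ?d x \<partial>M) + (C + C) =
      (\<integral>\<^sup>+x. ?d x + (a x * b x + a x * b x) \<partial>M)"
    by (simp add: nn_integral_add ab)
  also have "\<dots> = (\<integral>\<^sup>+x. a x * a x + b x * b x \<partial>M)"
  proof (intro nn_integral_cong_AE, use fa fb in eventually_elim)
    fix x assume "a x \<noteq> \<infinity>" "b x \<noteq> \<infinity>"
    then obtain r s where rs: "r \<ge> 0" "s \<ge> 0" "a x = ennreal r" "b x = ennreal s"
      by (cases "a x"; cases "b x") auto
    have "(r - s)\<^sup>2 + (r * s + r * s) = r * r + s * s" by (simp add: power2_eq_square algebra_simps)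
    then show "?d x + (a x * b x + a x * b x) = a x * a x + b x * b x"
      using rs by (simp flip: ennreal_mult ennreal_plus)
  qed
  also have "\<dots> = C + C" by (simp add: nn_integral_add aa bb)
  finally have "(C + C) + (\<integral>\<^sup>+x. ?d x \<partial>M) = (C + C) + 0"
    by (simp add: add.commute)
  then have "(\<integral>\<^sup>+x. ?d x \<partial>M) = 0"
    using C unfolding ennreal_add_left_cancel by auto
  then have "AE x in M. ?d x = 0"
    by (subst (asm) nn_integral_0_iff_AE) auto
  then show ?thesis using fa fb
  proof eventually_elim
    fix x assume "?d x = 0" "a x \<noteq> \<infinity>" "b x \<noteq> \<infinity>"
    then show "a x = b x"
      by (cases "a x"; cases "b x") (auto simp: ennreal_eq_0_iff)
  qed
qed

section \<open>The Riesz kernel as a mixture of Gaussian products\<close>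

lemma nn_integral_powr_exp:
  fixes s c :: real
  assumes s: "s > 0" and c: "c > 0"
  shows "(\<integral>\<^sup>+t. indicator {0<..} t * ennreal (t powr (s - 1) * exp (- t * c)) \<partial>lborel) = ennreal (Gamma s * c powr (- s))"
proof -
  let ?e = "\<lambda>t c. indicator {0<..} t * ennreal (t powr (s - 1) * exp (- t * c)) :: ennreal"
  have G: "(\<integral>\<^sup>+t. indicator {0<..} t * ennreal (t powr (s - 1) * exp (- t)) \<partial>lborel) = ennreal (Gamma s)"
  proof -
    have "((\<lambda>t. t powr (s - 1) / exp t) has_integral Gamma s) {0..}"
      using Gamma_integral_real[OF s] .
    then have "(\<integral>\<^sup>+t. ennreal (indicator {0..} t * (t powr (s - 1) / exp t)) \<partial>lborel) = ennreal (Gamma s)"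
      by (intro nn_integral_has_integral_lebesgue) auto
    also have "(\<integral>\<^sup>+t. ennreal (indicator {0..} t * (t powr (s - 1) / exp t)) \<partial>lborel) = (\<integral>\<^sup>+t. indicator {0<..} t * ennreal (t powr (s - 1) * exp (- t)) \<partial>lborel)"
      by (intro nn_integral_cong) (auto simp: indicator_def exp_minus divide_inverse)
    finally show ?thesis .
  qed
  have "(\<integral>\<^sup>+t. ?e t c \<partial>lborel)
     = ennreal \<bar>1/c\<bar> * (\<integral>\<^sup>+t. ?e (0 + (1/c) * t) c \<partial>lborel)"
    using c by (intro nn_integral_real_affine) auto
  also have "(\<integral>\<^sup>+t. ?e (0 + (1/c) * t) c \<partial>lborel)
     = (\<integral>\<^sup>+t. ennreal (c powr (1 - s)) * (indicator {0<..} t * ennreal (t powr (s - 1) * exp (- t))) \<partial>lborel)"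
  proof (intro nn_integral_cong)
    fix t :: real
    have "(t / c) powr (s - 1) * exp (- t) = c powr (1 - s) * (t powr (s - 1) * exp (- t))" if "t > 0"
      using c that by (simp add: powr_divide powr_diff field_simps)
    then show "?e (0 + (1/c) * t) c
      = ennreal (c powr (1 - s)) * (indicator {0<..} t * ennreal (t powr (s - 1) * exp (- t)))"
      using c by (auto simp: indicator_def zero_less_divide_iff simp flip: ennreal_mult')
  qed
  also have "\<dots> = ennreal (c powr (1 - s)) * ennreal (Gamma s)"
    by (simp add: nn_integral_cmult G)
  also have "ennreal \<bar>1/c\<bar> * \<dots> = ennreal (Gamma s * c powr (- s))"
  proof -
    have "1 / c * (c powr (1 - s) * Gamma s) = Gamma s * c powr (- s)"
      using c by (simp add: powr_diff powr_minus field_simps)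
    then show ?thesis using c Gamma_real_pos[OF s] by (simp flip: ennreal_mult)
  qed
  finally show ?thesis .
qed

text \<open>The rates fit together: two factors of rate \<open>2 * t\<close>, centred at x and y,
  multiply to a factor of rate \<open>t\<close> in x - y and one of rate \<open>4 * t\<close> in z,
  whose integral is this mass.\<close>

definition gauss_mass :: "'a::euclidean_space itself \<Rightarrow> real \<Rightarrow> ennreal" where
  "gauss_mass _ t = (\<integral>\<^sup>+z. ennreal (exp (- 4 * t * (norm (z::'a))\<^sup>2)) \<partial>lborel)"

definition gauss_trans :: "real \<Rightarrow> ('a::euclidean_space \<Rightarrow> ennreal) \<Rightarrow> 'a \<Rightarrow> ennreal" where
  "gauss_trans t f z = (\<integral>\<^sup>+x. ennreal (exp (- 2 * t * (norm (x - z))\<^sup>2)) * f x \<partial>lborel)"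

text \<open>The exponent is written \<open>- 2 * s\<close> so that the kernel is (|x - y|^2)^(-s),
  the form produced by a Gamma integral in the squared distance. Values in \<open>ennreal\<close>
  make Tonelli available before finiteness is known.\<close>

definition riesz_energy :: "real \<Rightarrow> ('a::euclidean_space \<Rightarrow> ennreal) \<Rightarrow> ('a \<Rightarrow> ennreal) \<Rightarrow> ennreal" where
  "riesz_energy s f g = (\<integral>\<^sup>+x. (\<integral>\<^sup>+y. ennreal (norm (x - y) powr (- 2 * s)) * (f x * g y) \<partial>lborel) \<partial>lborel)"

text \<open>The parallelogram law: \<open>2|x - z|\<^sup>2 + 2|y - z|\<^sup>2 = |x - y|\<^sup>2 + 4|z - (x + y)/2|\<^sup>2\<close>.\<close>
lemma gauss_convolution:
  fixes x y :: "'a::euclidean_space"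
  shows "(\<integral>\<^sup>+z. ennreal (exp (- 2 * t * (norm (x - z))\<^sup>2)) * ennreal (exp (- 2 * t * (norm (y - z))\<^sup>2)) \<partial>lborel)
     = ennreal (exp (- t * (norm (x - y))\<^sup>2)) * gauss_mass TYPE('a) t"
proof -
  let ?m = "(1/2) *\<^sub>R (x + y)"
  have par: "2 * (norm (x - (m + z)))\<^sup>2 + 2 * (norm (y - (m + z)))\<^sup>2 = (norm (x - y))\<^sup>2 + 4 * (norm z)\<^sup>2"
    if m: "m = (1/2) *\<^sub>R (x + y)" for z m
  proof -
    have 1: "x - (m + z) = (1/2) *\<^sub>R (x - y) - z" "y - (m + z) = - ((1/2) *\<^sub>R (x - y)) - z"
      unfolding m by (simp_all add: algebra_simps flip: scaleR_add_left)
    show ?thesis unfolding 1 power2_norm_eq_inner by (simp add: inner_simps inner_commute)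
  qed
  have "(\<integral>\<^sup>+z. ennreal (exp (- 2 * t * (norm (x - z))\<^sup>2)) * ennreal (exp (- 2 * t * (norm (y - z))\<^sup>2)) \<partial>lborel)
    = (\<integral>\<^sup>+z. ennreal (exp (- 2 * t * (norm (x - (?m + z)))\<^sup>2)) * ennreal (exp (- 2 * t * (norm (y - (?m + z)))\<^sup>2)) \<partial>lborel)"
    by (rule nn_integral_lborel_plus[symmetric]) simp
  also have "\<dots> = (\<integral>\<^sup>+z. ennreal (exp (- t * (norm (x - y))\<^sup>2)) * ennreal (exp (- 4 * t * (norm (z::'a))\<^sup>2)) \<partial>lborel)"
  proof (intro nn_integral_cong)
    fix z
    have "- 2 * t * (norm (x - (?m + z)))\<^sup>2 + - 2 * t * (norm (y - (?m + z)))\<^sup>2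
       = - t * (2 * (norm (x - (?m + z)))\<^sup>2 + 2 * (norm (y - (?m + z)))\<^sup>2)" by (simp add: algebra_simps)
    also have "\<dots> = - t * (norm (x - y))\<^sup>2 + - 4 * t * (norm z)\<^sup>2"
      unfolding par[OF refl] by (simp add: algebra_simps)
    finally show "ennreal (exp (- 2 * t * (norm (x - (?m + z)))\<^sup>2)) * ennreal (exp (- 2 * t * (norm (y - (?m + z)))\<^sup>2))
      = ennreal (exp (- t * (norm (x - y))\<^sup>2)) * ennreal (exp (- 4 * t * (norm z)\<^sup>2))"
      by (simp only: ennreal_mult[symmetric] exp_ge_zero exp_add[symmetric])
  qed
  finally show ?thesis by (simp add: nn_integral_cmult gauss_mass_def)
qed

lemma gauss_mass_bounds:
  assumes "t > 0"
  shows "gauss_mass TYPE('a::euclidean_space) t \<noteq> 0" "gauss_mass TYPE('a) t \<noteq> \<infinity>"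
  using nn_integral_gauss_finite[of "4 * t", where 'a='a] nn_integral_gauss_pos[of "4 * t", where 'a='a] assms
  by (auto simp: gauss_mass_def)

text \<open>Mixing density of the scales: t^(s-1) comes from the Gamma integral, and the division
  cancels the mass left over from convolving two Gaussians. The indicator restricts to scales at
  which this mass is finite.\<close>

definition riesz_weight :: "'a::euclidean_space itself \<Rightarrow> real \<Rightarrow> real \<Rightarrow> real" where
  "riesz_weight T s t = indicator {0<..} t * (t powr (s - 1) / enn2real (gauss_mass T t))"

lemma riesz_weight_pos: "t > 0 \<Longrightarrow> riesz_weight TYPE('a::euclidean_space) s t > 0"
  using gauss_mass_bounds[of t, where 'a='a] by (cases "gauss_mass TYPE('a) t") (auto simp: riesz_weight_def ennreal_eq_0_iff not_le)

lemma riesz_weight_nonneg: "riesz_weight TYPE('a::euclidean_space) s t \<ge> 0"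
  by (auto simp: riesz_weight_def)

lemma borel_measurable_gauss_trans [measurable]:
  assumes [measurable]: "f \<in> borel_measurable borel"
  shows "(\<lambda>(t, z). gauss_trans t f z) \<in> borel_measurable (lborel \<Otimes>\<^sub>M lborel)"
  unfolding gauss_trans_def case_prod_beta by measurable

lemma borel_measurable_riesz_weight [measurable]:
  "riesz_weight TYPE('a::euclidean_space) s \<in> borel_measurable borel"
  unfolding riesz_weight_def gauss_mass_def by measurable

text \<open>Once the kernel is an integral over t and z of a factor in x times a factor in y, the
  double integral over x and y splits into a product of transforms. Symmetry in \<open>f\<close> and
  \<open>g\<close> then exhibits an inner product.\<close>

lemma riesz_energy_gauss:
  fixes f g :: "'a::euclidean_space \<Rightarrow> ennreal"
  assumes s: "s > 0" and [measurable]: "f \<in> borel_measurable borel" "g \<in> borel_measurable borel"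
  shows "ennreal (Gamma s) * riesz_energy s f g =
    (\<integral>\<^sup>+t. \<integral>\<^sup>+z. ennreal (riesz_weight TYPE('a) s t) * (gauss_trans t f z * gauss_trans t g z) \<partial>lborel \<partial>lborel)"
proof -
  let ?F = "\<lambda>t x y z. ennreal (riesz_weight TYPE('a) s t) * (ennreal (exp (- 2 * t * (norm (x - z :: 'a))\<^sup>2)) * ennreal (exp (- 2 * t * (norm (y - z))\<^sup>2))) * (f x * g y)"
  let ?G = "\<lambda>t x y z. ennreal (exp (- 2 * t * (norm (x - z :: 'a))\<^sup>2)) * ennreal (exp (- 2 * t * (norm (y - z))\<^sup>2))"
  let ?g = "\<lambda>t x z. ennreal (exp (- 2 * t * (norm (x - z :: 'a))\<^sup>2))"
  let ?W = "riesz_weight TYPE('a) s"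
  have kernel: "ennreal (Gamma s) * ennreal (norm (x - y) powr (- 2 * s)) =
      (\<integral>\<^sup>+t. (\<integral>\<^sup>+z. ennreal (?W t) * (?G t x y z) \<partial>lborel) \<partial>lborel)"
    if "x \<noteq> y" for x y :: 'a
  proof -
    have "(\<integral>\<^sup>+t. (\<integral>\<^sup>+z. ennreal (?W t) * (?G t x y z) \<partial>lborel) \<partial>lborel)
      = (\<integral>\<^sup>+t. ennreal (?W t) * (ennreal (exp (- t * (norm (x - y))\<^sup>2)) * gauss_mass TYPE('a) t) \<partial>lborel)"
      by (intro nn_integral_cong) (subst nn_integral_cmult, simp, simp only: gauss_convolution)
    also have "\<dots> = (\<integral>\<^sup>+t. indicator {0<..} t * ennreal (t powr (s - 1) * exp (- t * (norm (x - y))\<^sup>2)) \<partial>lborel)"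
    proof (intro nn_integral_cong)
      fix t :: real
      show "ennreal (?W t) * (ennreal (exp (- t * (norm (x - y))\<^sup>2)) * gauss_mass TYPE('a) t) = indicator {0<..} t * ennreal (t powr (s - 1) * exp (- t * (norm (x - y))\<^sup>2))"
      proof (cases "t > 0")
        case True
        then obtain m where m: "m > 0" "gauss_mass TYPE('a) t = ennreal m"
          using gauss_mass_bounds[OF True, where 'a='a] by (cases "gauss_mass TYPE('a) t") (auto simp: ennreal_eq_0_iff not_le)
        have "t powr (s - 1) / m * (exp (- t * (norm (x - y))\<^sup>2) * m) = t powr (s - 1) * exp (- t * (norm (x - y))\<^sup>2)"
          using m by simp
        then show ?thesis using True m by (simp add: riesz_weight_def flip: ennreal_mult)
      qed (simp add: riesz_weight_def)
    qed
    also have "\<dots> = ennreal (Gamma s * (norm (x - y))\<^sup>2 powr (- s))"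
      using s that by (intro nn_integral_powr_exp) auto
    also have "(norm (x - y))\<^sup>2 powr (- s) = norm (x - y) powr (- 2 * s)"
    proof -
      have "(norm (x - y))\<^sup>2 = norm (x - y) powr 2" using that by (simp add: powr_numeral)
      then show ?thesis by (simp only: powr_powr) simp
    qed
    finally show ?thesis using Gamma_real_pos[OF s] by (simp add: ennreal_mult)
  qed
  have "ennreal (Gamma s) * riesz_energy s f g = (\<integral>\<^sup>+x. (\<integral>\<^sup>+y. ennreal (Gamma s) * (ennreal (norm (x - y) powr (- 2 * s)) * (f x * g y)) \<partial>lborel) \<partial>lborel)"
    unfolding riesz_energy_def by (simp add: nn_integral_cmult)
  also have "\<dots> = (\<integral>\<^sup>+x. (\<integral>\<^sup>+y. (\<integral>\<^sup>+t. (\<integral>\<^sup>+z. ?F t x y z \<partial>lborel) \<partial>lborel) \<partial>lborel) \<partial>lborel)"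
  \<comment> \<open>On the diagonal \<open>powr\<close> gives 0 although the Gaussian mixture is
    infinite; for each \<open>x\<close> only the single point \<open>y = x\<close> is lost.\<close>
  proof (rule nn_integral_cong, rule nn_integral_cong_AE, rule AE_mp[OF AE_lborel_singleton AE_I2], rule impI)
    fix x y :: 'a assume "y \<noteq> x"
    then show "ennreal (Gamma s) * (ennreal (norm (x - y) powr (- 2 * s)) * (f x * g y)) =
      (\<integral>\<^sup>+t. (\<integral>\<^sup>+z. ?F t x y z \<partial>lborel) \<partial>lborel)"
      using kernel[of x y] by (simp add: nn_integral_multc mult.assoc[symmetric])
  qed
  \<comment> \<open>Four exchanges of neighbouring integrals bring \<open>t\<close> and then
    \<open>z\<close> outside \<open>x\<close> and \<open>y\<close>.\<close>
  also have "\<dots> = (\<integral>\<^sup>+x. (\<integral>\<^sup>+t. (\<integral>\<^sup>+y. (\<integral>\<^sup>+z. ?F t x y z \<partial>lborel) \<partial>lborel) \<partial>lborel) \<partial>lborel)"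
    by (intro nn_integral_cong lborel_pair.Fubini') measurable
  also have "\<dots> = (\<integral>\<^sup>+t. (\<integral>\<^sup>+x. (\<integral>\<^sup>+y. (\<integral>\<^sup>+z. ?F t x y z \<partial>lborel) \<partial>lborel) \<partial>lborel) \<partial>lborel)"
    by (intro lborel_pair.Fubini') measurable
  also have "\<dots> = (\<integral>\<^sup>+t. (\<integral>\<^sup>+x. (\<integral>\<^sup>+z. (\<integral>\<^sup>+y. ?F t x y z \<partial>lborel) \<partial>lborel) \<partial>lborel) \<partial>lborel)"
    by (intro nn_integral_cong lborel_pair.Fubini') measurable
  also have "\<dots> = (\<integral>\<^sup>+t. (\<integral>\<^sup>+z. (\<integral>\<^sup>+x. (\<integral>\<^sup>+y. ?F t x y z \<partial>lborel) \<partial>lborel) \<partial>lborel) \<partial>lborel)"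
    by (intro nn_integral_cong lborel_pair.Fubini') measurable
  also have "\<dots> = (\<integral>\<^sup>+t. (\<integral>\<^sup>+z. ennreal (?W t) * (gauss_trans t f z * gauss_trans t g z) \<partial>lborel) \<partial>lborel)"
  proof (intro nn_integral_cong)
    fix t :: real and z :: 'a
    have "(\<integral>\<^sup>+x. (\<integral>\<^sup>+y. ?F t x y z \<partial>lborel) \<partial>lborel)
       = (\<integral>\<^sup>+x. (\<integral>\<^sup>+y. (ennreal (?W t) * (?g t x z * f x)) * (?g t y z * g y) \<partial>lborel) \<partial>lborel)"
      by (intro nn_integral_cong) (simp add: mult_ac)
    also have "\<dots> = ennreal (?W t) * (gauss_trans t f z * gauss_trans t g z)"
    proof -
      have "(\<integral>\<^sup>+x. (\<integral>\<^sup>+y. (ennreal (?W t) * (?g t x z * f x)) * (?g t y z * g y) \<partial>lborel) \<partial>lborel)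
         = (\<integral>\<^sup>+x. (ennreal (?W t) * (?g t x z * f x)) * gauss_trans t g z \<partial>lborel)"
        unfolding gauss_trans_def by (intro nn_integral_cong nn_integral_cmult) measurable
      also have "\<dots> = (\<integral>\<^sup>+x. ennreal (?W t) * (?g t x z * f x) \<partial>lborel) * gauss_trans t g z"
        by (rule nn_integral_multc) measurable
      also have "(\<integral>\<^sup>+x. ennreal (?W t) * (?g t x z * f x) \<partial>lborel) = ennreal (?W t) * gauss_trans t f z"
        unfolding gauss_trans_def by (rule nn_integral_cmult) measurable
      finally show ?thesis by (simp only: mult.assoc)
    qed
    finally show "(\<integral>\<^sup>+x. (\<integral>\<^sup>+y. ?F t x y z \<partial>lborel) \<partial>lborel)
      = ennreal (?W t) * (gauss_trans t f z * gauss_trans t g z)" .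
  qed
  finally show ?thesis .
qed

text \<open>Feature map of the positive definite kernel: giving each argument the square root of the
  weight turns the energy, up to the factor Gamma(s), into a plain L^2 pairing over pairs (t,
  z).\<close>

definition gauss_feature :: "real \<Rightarrow> ('a::euclidean_space \<Rightarrow> ennreal) \<Rightarrow> real \<times> 'a \<Rightarrow> ennreal" where
  "gauss_feature s h = (\<lambda>(t, z). ennreal (sqrt (riesz_weight TYPE('a) s t)) * gauss_trans t h z)"

lemma borel_measurable_gauss_feature [measurable]:
  assumes [measurable]: "h \<in> borel_measurable borel"
  shows "gauss_feature s h \<in> borel_measurable (lborel \<Otimes>\<^sub>M lborel)"
  unfolding gauss_feature_def by measurable

lemma riesz_energy_gauss_pair:
  fixes f g :: "'a::euclidean_space \<Rightarrow> ennreal"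
  assumes s: "s > 0" and [measurable]: "f \<in> borel_measurable borel" "g \<in> borel_measurable borel"
  shows "ennreal (Gamma s) * riesz_energy s f g = (\<integral>\<^sup>+w. gauss_feature s f w * gauss_feature s g w \<partial>(lborel \<Otimes>\<^sub>M lborel))"
proof -
  have sq: "ennreal (sqrt (riesz_weight TYPE('a) s t)) * ennreal (sqrt (riesz_weight TYPE('a) s t)) = ennreal (riesz_weight TYPE('a) s t)" for t
    by (simp add: riesz_weight_nonneg flip: ennreal_mult)
  have "(\<integral>\<^sup>+w. gauss_feature s f w * gauss_feature s g w \<partial>(lborel \<Otimes>\<^sub>M lborel)) = (\<integral>\<^sup>+t. \<integral>\<^sup>+z. gauss_feature s f (t, z) * gauss_feature s g (t, z) \<partial>lborel \<partial>lborel)"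
    by (rule lborel.nn_integral_fst[symmetric]) simp
  also have "\<dots> = (\<integral>\<^sup>+t. \<integral>\<^sup>+z. ennreal (riesz_weight TYPE('a) s t) * (gauss_trans t f z * gauss_trans t g z) \<partial>lborel \<partial>lborel)"
    by (intro nn_integral_cong) (simp add: gauss_feature_def sq[symmetric] mult_ac)
  finally show ?thesis using riesz_energy_gauss[OF assms] by simp
qed

lemma riesz_energy_Cauchy_Schwarz:
  fixes f g :: "'a::euclidean_space \<Rightarrow> ennreal"
  assumes s: "s > 0" and [measurable]: "f \<in> borel_measurable borel" "g \<in> borel_measurable borel"
  shows "(riesz_energy s f g)\<^sup>2 \<le> riesz_energy s f f * riesz_energy s g g"
proof -
  have "(ennreal (Gamma s) * riesz_energy s f g)\<^sup>2 \<le> (ennreal (Gamma s) * riesz_energy s f f) * (ennreal (Gamma s) * riesz_energy s g g)"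
    unfolding riesz_energy_gauss_pair[OF s assms(2,3)] riesz_energy_gauss_pair[OF s assms(2,2)] riesz_energy_gauss_pair[OF s assms(3,3)] power2_eq_square[symmetric, where 'a=ennreal]
    by (rule Cauchy_Schwarz_nn_integral) measurable
  then have "(ennreal (Gamma s) * ennreal (Gamma s)) * (riesz_energy s f g)\<^sup>2 \<le> (ennreal (Gamma s) * ennreal (Gamma s)) * (riesz_energy s f f * riesz_energy s g g)"
    by (simp add: power2_eq_square mult_ac)
  moreover have "ennreal (Gamma s) * ennreal (Gamma s) = ennreal (Gamma s * Gamma s)"
    using Gamma_real_pos[OF s] by (simp add: ennreal_mult)
  ultimately show ?thesis
    using Gamma_real_pos[OF s] by (simp add: ennreal_mult_le_mult_iff)
qed

text \<open>Equality in Cauchy-Schwarz makes the features agree almost everywhere, and the weight is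
  positive for t > 0. So for almost every scale the Gaussian transforms agree for almost every
  centre, which is what the inversion consumes.\<close>

lemma riesz_energy_strict:
  fixes f g :: "'a::euclidean_space \<Rightarrow> ennreal"
  assumes s: "s > 0" and [measurable]: "f \<in> borel_measurable borel" "g \<in> borel_measurable borel"
    and ffin: "(\<integral>\<^sup>+x. ennreal (exp (- (1/2) * (norm x)\<^sup>2)) * f x \<partial>lborel) < \<infinity>"
    and gfin: "(\<integral>\<^sup>+x. ennreal (exp (- (1/2) * (norm x)\<^sup>2)) * g x \<partial>lborel) < \<infinity>"
    and eq: "riesz_energy s f f = C" "riesz_energy s g g = C" "riesz_energy s f g = C" and C: "C < \<infinity>"
  shows "AE x in lborel. f x = g x"
proof -
  have "AE w in lborel \<Otimes>\<^sub>M lborel. gauss_feature s f w = gauss_feature s g w"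
  proof (rule nn_integral_Cauchy_Schwarz_eq_imp_AE_eq)
    show "(\<integral>\<^sup>+w. gauss_feature s f w * gauss_feature s f w \<partial>(lborel \<Otimes>\<^sub>M lborel)) = ennreal (Gamma s) * C"
      using riesz_energy_gauss_pair[OF s assms(2,2)] eq by simp
    show "(\<integral>\<^sup>+w. gauss_feature s g w * gauss_feature s g w \<partial>(lborel \<Otimes>\<^sub>M lborel)) = ennreal (Gamma s) * C"
      using riesz_energy_gauss_pair[OF s assms(3,3)] eq by simp
    show "(\<integral>\<^sup>+w. gauss_feature s f w * gauss_feature s g w \<partial>(lborel \<Otimes>\<^sub>M lborel)) = ennreal (Gamma s) * C"
      using riesz_energy_gauss_pair[OF s assms(2,3)] eq by simp
    show "ennreal (Gamma s) * C < \<infinity>" using C by (simp add: ennreal_mult_less_top)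
  qed measurable
  then have ae: "AE t in lborel. AE z in lborel. gauss_feature s f (t, z) = gauss_feature s g (t, z)"
    by (rule lborel_pair.AE_pair)
  show ?thesis
  proof (rule gauss_mollifier_unique[OF assms(2,3) ffin gfin])
    fix n :: nat
    show "\<exists>t>real n. AE z in lborel. (\<integral>\<^sup>+x. ennreal (exp (-2 * t * (norm (x - z))\<^sup>2)) * f x \<partial>lborel)
        = (\<integral>\<^sup>+x. ennreal (exp (-2 * t * (norm (x - z))\<^sup>2)) * g x \<partial>lborel)"
    proof (rule ccontr)
      \<comment> \<open>If no scale beyond \<open>n\<close> were good, the exceptional scales would
        contain a half-line, which is not a null set.\<close>
      assume neg: "\<not> ?thesis"
      have "AE t in lborel. \<not> t > real n"
        using ae
      proof eventually_elim
        fix t assume t: "AE z in lborel. gauss_feature s f (t, z) = gauss_feature s g (t, z)"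
        show "\<not> t > real n"
        proof
          assume tn: "t > real n"
          then have "riesz_weight TYPE('a) s t > 0" by (intro riesz_weight_pos) auto
          with t have "AE z in lborel. gauss_trans t f z = gauss_trans t g z"
            by (auto simp: gauss_feature_def ennreal_mult_cancel_left ennreal_eq_0_iff)
          with neg tn show False unfolding gauss_trans_def by auto
        qed
      qed
      then have "{real n<..} \<in> null_sets lborel"
        by (subst (asm) AE_iff_null) (auto simp: greaterThan_def)
      moreover have "emeasure lborel {real n<..<real n + 1} \<le> emeasure lborel {real n<..}"
        by (intro emeasure_mono) auto
      ultimately show False by (simp add: null_sets_def)
    qed
  qed
qed

section \<open>Finiteness of the Riesz energy\<close>

lemma riesz_energy_finite:
  fixes f :: "'a::euclidean_space \<Rightarrow> real" and s :: real
  assumes [measurable]: "f \<in> borel_measurable borel" and f0: "\<And>x. f x \<ge> 0"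
    and near: "r > 1" "r * (2 * s) < DIM('a)" "m * (1 - 1 / (2 * r)) = 1" "(\<integral>\<^sup>+x. ennreal (f x powr m) \<partial>lborel) < \<infinity>"
    and far: "r' > 1" "r' * (2 * s) > DIM('a)" "m' * (1 - 1 / (2 * r')) = 1" "(\<integral>\<^sup>+x. ennreal (f x powr m') \<partial>lborel) < \<infinity>"
  shows "riesz_energy s f f < \<infinity>"
proof -
  let ?F = "\<lambda>k. \<integral>\<^sup>+x. \<integral>\<^sup>+y. ennreal (f x * k (x - y) * f y) \<partial>lborel \<partial>lborel" and ?e = "\<lambda>k x y. ennreal (f x * k (x - y) * f y)"
  \<comment> \<open>No single power of |z|^(-2s) is integrable on the whole space: near 0 the power
    r must satisfy 2 s r < N, far away 2 s r' > N. This is why \<open>f\<close> is required to lie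
    in two different spaces, with exponents \<open>m\<close> and \<open>m'\<close>.\<close>
  define k1 where "k1 z = norm z powr (- 2 * s) * indicator (ball 0 1) z" for z :: 'a
  define k2 where "k2 z = norm z powr (- 2 * s) * indicator (- ball 0 1) z" for z :: 'a
  have [measurable]: "- ball (0::'a) 1 \<in> sets borel" by (auto intro: borel_comp)
  have [measurable]: "k1 \<in> borel_measurable borel" "k2 \<in> borel_measurable borel"
    unfolding k1_def k2_def by (intro borel_measurable_times borel_measurable_indicator; measurable)+
  have k0: "k1 z \<ge> 0" "k2 z \<ge> 0" for z by (auto simp: k1_def k2_def)
  have "(\<integral>\<^sup>+x. ennreal (k1 x powr r) \<partial>lborel) = (\<integral>\<^sup>+x. ennreal (norm x powr (- (r * (2 * s)))) * indicator (ball 0 1) (x::'a) \<partial>lborel)"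
    by (intro nn_integral_cong) (auto simp: k1_def indicator_def powr_powr mult_ac)
  also have "\<dots> < \<infinity>" using near(2) by (rule nn_integral_norm_powr_ball_finite)
  finally have K1: "?F k1 < \<infinity>"
    using f0 k0 near by (intro young_bilinear_finite[where r=r and m=m]) auto
  have "(\<integral>\<^sup>+x. ennreal (k2 x powr r') \<partial>lborel) = (\<integral>\<^sup>+x. ennreal (norm x powr (- (r' * (2 * s)))) * indicator (- ball 0 1) (x::'a) \<partial>lborel)"
    by (intro nn_integral_cong) (auto simp: k2_def indicator_def powr_powr mult_ac)
  also have "\<dots> < \<infinity>" using far(2) by (rule nn_integral_norm_powr_outside_finite)
  finally have K2: "?F k2 < \<infinity>"
    using f0 k0 far by (intro young_bilinear_finite[where r=r' and m=m']) auto
  have "riesz_energy s f f = (\<integral>\<^sup>+x. (\<integral>\<^sup>+y. ?e k1 x y + ?e k2 x y \<partial>lborel) \<partial>lborel)"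
    unfolding riesz_energy_def
  proof (intro nn_integral_cong)
    fix x y
    have "norm (x - y) powr (- 2 * s) * (f x * f y) = f x * k1 (x - y) * f y + f x * k2 (x - y) * f y"
      unfolding k1_def k2_def by (cases "x - y \<in> ball 0 1") auto
    then show "ennreal (norm (x - y) powr (- 2 * s)) * (ennreal (f x) * ennreal (f y)) = ?e k1 x y + ?e k2 x y"
      using f0 by (simp flip: ennreal_mult ennreal_plus add: k1_def k2_def)
  qed
  also have "\<dots> = (\<integral>\<^sup>+x. (\<integral>\<^sup>+y. ?e k1 x y \<partial>lborel) + (\<integral>\<^sup>+y. ?e k2 x y \<partial>lborel) \<partial>lborel)"
    by (intro nn_integral_cong nn_integral_add) measurable
  also have "\<dots> = ?F k1 + ?F k2"
    by (intro nn_integral_add) measurable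
  finally show ?thesis using K1 K2 by simp
qed

text \<open>Write y for the reciprocal Young exponent, so m = 1/(1 - y/2) and q = p m. Then q > 2
  means y > 2 - p, and 1/q > 1/2 - 1/N means y < 2 - p (1 - 2/N). The critical value c = 1 - alpha/N
  satisfies both strictly: the first is p > 1 + alpha/N, the second (for N >= 3) is p < (N +
  alpha)/(N - 2).\<close>

lemma riesz_energy_powr_finite:
  fixes u :: "'a::euclidean_space \<Rightarrow> real" and \<alpha> p :: real
  assumes [measurable]: "u \<in> borel_measurable borel"
    and Lq: "\<And>q. q > 2 \<Longrightarrow> 1 / q > 1 / 2 - 1 / DIM('a) \<Longrightarrow> (\<integral>\<^sup>+x. ennreal (\<bar>u x\<bar> powr q) \<partial>lborel) < \<infinity>"
    and \<alpha>: "0 < \<alpha>" "\<alpha> < DIM('a)" and p: "1 + \<alpha> / DIM('a) < p"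
    and p': "DIM('a) \<ge> 3 \<Longrightarrow> p < (DIM('a) + \<alpha>) / (real DIM('a) - 2)"
  shows "riesz_energy ((DIM('a) - \<alpha>) / 2) (\<lambda>x. \<bar>u x\<bar> powr p) (\<lambda>x. \<bar>u x\<bar> powr p) < \<infinity>"
    and "(\<integral>\<^sup>+x. ennreal (exp (- (1/2) * (norm x)\<^sup>2)) * ennreal (\<bar>u x\<bar> powr p) \<partial>lborel) < \<infinity>"
proof -
  let ?W = "\<lambda>x. exp (- (1/2) * (norm (x :: 'a))\<^sup>2)"
  define N where "N = real DIM('a)"
  have N: "N > 0" by (simp add: N_def)
  define c where "c = 1 - \<alpha> / N"
  have c: "0 < c" "c < 1" using \<alpha> N by (auto simp: c_def N_def field_simps)
  have p1: "p > 1" using p \<alpha> by (smt (verit) divide_pos_pos of_nat_0_less_iff DIM_positive)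
  have c1: "c > 2 - p" using p by (simp add: c_def N_def)
  have c2: "c < 2 - p * (1 - 2 / N)"
  proof (cases "DIM('a) \<ge> 3")
    case True
    then have "N > 2" by (simp add: N_def)
    with p'[OF True] have "p * (N - 2) < N + \<alpha>" by (simp add: N_def field_simps)
    then have "p * (N - 2) / N < (N + \<alpha>) / N" using N by (intro divide_strict_right_mono)
    then show ?thesis using N by (simp add: c_def field_simps)
  next
    \<comment> \<open>In dimensions 1 and 2 the factor 1 - 2/N is at most 0, so the upper bound on y
      is at least 2.\<close>
    case False
    then have "N \<le> 2" by (simp add: N_def)
    then have "1 - 2 / N \<le> 0" using N by (simp add: field_simps)
    then have "p * (1 - 2 / N) \<le> 0" using p1 by (simp add: mult_nonneg_nonpos)
    then show ?thesis using c by linarith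
  qed
  \<comment> \<open>\<open>y1\<close> above \<open>c\<close> serves the singular part of the kernel
    and \<open>y2\<close> below \<open>c\<close> the part at infinity; both stay in the admissible
    interval, inside (0, 1).\<close>
  obtain y1 where y1: "c < y1" "y1 < 1" "y1 < 2 - p * (1 - 2 / N)"
    using dense[of c "min 1 (2 - p * (1 - 2 / N))"] c c2 by auto
  obtain y2 where y2: "0 < y2" "2 - p < y2" "y2 < c"
    using dense[of "max 0 (2 - p)" c] c c1 by auto
  define m where "m y = 1 / (1 - y / 2)" for y :: real
  have fin: "(\<integral>\<^sup>+x. ennreal ((\<bar>u x\<bar> powr p) powr m y) \<partial>lborel) < \<infinity>"
    if y: "0 < y" "y < 1" "2 - p < y" "y < 2 - p * (1 - 2 / N)" for y
  proof -
    have my: "m y > 0" using y by (simp add: m_def)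
    have q: "1 / (p * m y) = (1 - y / 2) / p" by (simp add: m_def)
    have "p * m y > 2" using y p1 by (simp add: m_def field_simps)
    moreover have "(1 - y / 2) / p > 1 / 2 - 1 / N"
      using y p1 N by (simp add: field_simps)
    ultimately show ?thesis using Lq[of "p * m y"] unfolding N_def[symmetric] q by (simp add: powr_powr)
  qed
  have fin1: "(\<integral>\<^sup>+x. ennreal ((\<bar>u x\<bar> powr p) powr m y1) \<partial>lborel) < \<infinity>"
    using y1 c c1 by (intro fin) auto
  have fin2: "(\<integral>\<^sup>+x. ennreal ((\<bar>u x\<bar> powr p) powr m y2) \<partial>lborel) < \<infinity>"
    using y2 c c2 by (intro fin) auto
  show "riesz_energy ((DIM('a) - \<alpha>) / 2) (\<lambda>x. \<bar>u x\<bar> powr p) (\<lambda>x. \<bar>u x\<bar> powr p) < \<infinity>"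
  proof (rule riesz_energy_finite[where r="1/y1" and r'="1/y2", OF _ _ _ _ _ fin1 _ _ _ fin2])
    have "N - \<alpha> = c * N" using N by (simp add: c_def field_simps)
    then have "N - \<alpha> < y1 * N" "y2 * N < N - \<alpha>"
      using mult_strict_right_mono[OF y1(1) N] mult_strict_right_mono[OF y2(3) N] by auto
    then show "1 / y1 * (2 * ((real DIM('a) - \<alpha>) / 2)) < real DIM('a)"
       "1 / y2 * (2 * ((real DIM('a) - \<alpha>) / 2)) > real DIM('a)"
      unfolding N_def[symmetric] using y1 y2 c by (auto simp: field_simps)
    show "1 / y1 > 1" "1 / y2 > 1" using y1 y2 c by auto
    show "m y1 * (1 - 1 / (2 * (1 / y1))) = 1" "m y2 * (1 - 1 / (2 * (1 / y2))) = 1"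
      using y1 y2 c by (auto simp: m_def)
  qed auto
  \<comment> \<open>Where |u|^p is at most 1 the Gaussian weight dominates; elsewhere |u|^p is below
    its power of exponent \<open>m y1 >= 1\<close>, already known to be integrable.\<close>
  have m1: "m y1 \<ge> 1" using y1 c by (simp add: m_def)
  have "(\<integral>\<^sup>+x. ennreal (?W x) * ennreal (\<bar>u x\<bar> powr p) \<partial>lborel) \<le>
    (\<integral>\<^sup>+x. ennreal (?W x) + ennreal ((\<bar>u x\<bar> powr p) powr m y1) \<partial>lborel)"
  proof (intro nn_integral_mono)
    fix x
    define a where "a = \<bar>u x\<bar> powr p"
    have a: "a \<ge> 0" by (simp add: a_def)
    have "?W x * a \<le> ?W x + a powr m y1"
    proof (cases "a \<le> 1")
      case True
      then show ?thesis using a by (intro add_increasing2) (auto simp: mult_left_le)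
    next
      case False
      then have "a \<le> a powr m y1" using m1 powr_mono[of 1 "m y1" a] by simp
      moreover have "?W x * a \<le> a" using a by (simp add: mult_left_le_one_le)
      ultimately show ?thesis by (smt (verit) exp_ge_zero)
    qed
    then show "ennreal (?W x) * ennreal (\<bar>u x\<bar> powr p) \<le> ennreal (?W x) + ennreal ((\<bar>u x\<bar> powr p) powr m y1)"
      unfolding a_def[symmetric] using a by (simp flip: ennreal_mult ennreal_plus add: ennreal_leI)
  qed
  also have "\<dots> = (\<integral>\<^sup>+x. ennreal (exp (- (1/2) * (norm (x::'a))\<^sup>2)) \<partial>lborel) + (\<integral>\<^sup>+x. ennreal ((\<bar>u x\<bar> powr p) powr m y1) \<partial>lborel)"
    by (intro nn_integral_add) measurable
  also have "\<dots> < \<infinity>" using fin1 nn_integral_gauss_finite[of "1/2", where 'a='a] by simp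
  finally show "(\<integral>\<^sup>+x. ennreal (?W x) * ennreal (\<bar>u x\<bar> powr p) \<partial>lborel) < \<infinity>" .
qed

section \<open>Test functions\<close>

text \<open>For \<open>k = 0\<close> this is the classical smooth function exp(-c/t), extended by 0.
  The extra factors t^(-k) make the family closed under differentiation up to linear
  combinations.\<close>

definition cutoff :: "nat \<Rightarrow> real \<Rightarrow> real \<Rightarrow> real" where
  "cutoff k c t = (if t > 0 then inverse t ^ k * exp (- c / t) else 0)"

lemma cutoff_nonneg: "cutoff k c t \<ge> 0"
  by (simp add: cutoff_def)

lemma cutoff_0_le_1: "c \<ge> 0 \<Longrightarrow> cutoff 0 c t \<le> 1"
  by (simp add: cutoff_def)

text \<open>A quadratic bound at 0 forces the difference quotient there to tend to 0, which settles
  the only delicate point of differentiability.\<close>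

lemma cutoff_le_square:
  assumes c: "c > 0"
  shows "cutoff k c t \<le> (real (k + 2) / c) ^ (k + 2) * t\<^sup>2"
proof (cases "t > 0")
  case False
  then show ?thesis using c by (simp add: cutoff_def)
next
  case True
  \<comment> \<open>In exp(-c/t) <= (m t/c)^m, \<open>k\<close> powers of t absorb the factor t^(-k)
    and two remain.\<close>
  define m where "m = k + 2"
  have m: "m > 0" by (simp add: m_def)
  have ct: "c / t > 0" using c True by simp
  have ct': "c / t / real m > 0" by (rule divide_pos_pos[OF ct]) (use m in simp)
  have "(c / t / real m) ^ m \<le> (1 + c / t / real m) ^ m"
    using ct' by (intro power_mono) linarith+
  also have "\<dots> \<le> exp (c / t)"
    using ct m by (intro exp_ge_one_plus_x_over_n_power_n) (auto intro: order_trans[of _ 0])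
  finally have le: "(c / t / real m) ^ m \<le> exp (c / t)" .
  have pos: "(c / t / real m) ^ m > 0" using ct' by (rule zero_less_power)
  have "exp (- c / t) = inverse (exp (c / t))" by (simp add: exp_minus)
  also have "\<dots> \<le> inverse ((c / t / real m) ^ m)" by (rule le_imp_inverse_le[OF le pos])
  also have "\<dots> = (real m / c) ^ m * t ^ m"
    using c True m by (simp add: power_divide power_mult_distrib field_simps)
  finally have "inverse t ^ k * exp (- c / t) \<le> inverse t ^ k * ((real m / c) ^ m * t ^ m)"
    using True by (intro mult_left_mono) auto
  also have "\<dots> = (real m / c) ^ m * t\<^sup>2"
  proof -
    have "inverse t ^ k * t ^ m = t\<^sup>2" using True unfolding m_def power_add by (simp add: power_inverse)
    then show ?thesis by (simp only: mult.left_commute[of "inverse t ^ k"])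
  qed
  finally show ?thesis using True by (simp add: cutoff_def m_def)
qed

lemma DERIV_cutoff:
  assumes c: "c > 0"
  shows "DERIV (cutoff k c) t :> - real k * cutoff (k + 1) c t + c * cutoff (k + 2) c t"
proof -
  consider "t > 0" | "t < 0" | "t = 0" by linarith
  then show ?thesis
  proof cases
    case 1
    have "((\<lambda>t. inverse t ^ k * exp (- c / t)) has_real_derivative - real k * cutoff (k + 1) c t + c * cutoff (k + 2) c t) (at t)"
    proof -
      have "((\<lambda>t. inverse t ^ k * exp (- c / t)) has_real_derivative
          (real k * (- (inverse t ^ 2) * inverse t ^ (k - Suc 0))) * exp (- c / t) + (exp (- c / t) * (c * inverse t ^ 2)) * inverse t ^ k) (at t)"
        using 1 by (intro DERIV_mult DERIV_power DERIV_fun_exp)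
          (auto intro!: derivative_eq_intros simp: divide_inverse power2_eq_square)
      moreover have "real k * (- (inverse t ^ 2) * inverse t ^ (k - Suc 0)) = - real k * inverse t ^ (k + 1)"
        by (cases k) (auto simp: power2_eq_square algebra_simps)
      ultimately have "((\<lambda>t. inverse t ^ k * exp (- c / t)) has_real_derivative
          (- real k * inverse t ^ (k + 1)) * exp (- c / t) + (exp (- c / t) * (c * inverse t ^ 2)) * inverse t ^ k) (at t)"
        by (simp only:)
      then show ?thesis using 1 by (simp add: cutoff_def power2_eq_square mult_ac)
    qed
    moreover have "\<forall>\<^sub>F s in nhds t. cutoff k c s = inverse s ^ k * exp (- c / s)"
      using eventually_nhds_in_open[of "{0<..}" t] 1 by (auto simp: cutoff_def elim: eventually_mono)
    ultimately show ?thesis using 1 by (subst DERIV_cong_ev) auto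
  next
    case 2
    have "((\<lambda>t. 0) has_real_derivative 0) (at t)" by simp
    moreover have "\<forall>\<^sub>F s in nhds t. cutoff k c s = 0"
      using eventually_nhds_in_open[of "{..<0}" t] 2 by (auto simp: cutoff_def elim: eventually_mono)
    ultimately have "DERIV (cutoff k c) t :> 0" by (subst DERIV_cong_ev) auto
    then show ?thesis using 2 by (simp add: cutoff_def)
  next
    case 3
    define C where "C = (real (k + 2) / c) ^ (k + 2)"
    have C: "C \<ge> 0" using c by (simp add: C_def)
    have "((\<lambda>h. cutoff k c h / h) \<longlongrightarrow> 0) (at 0)"
    proof (rule Lim_null_comparison)
      show "\<forall>\<^sub>F h in at 0. norm (cutoff k c h / h) \<le> C * \<bar>h\<bar>"
      proof (rule always_eventually, rule allI)
        fix h :: real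
        have "\<bar>cutoff k c h\<bar> \<le> C * \<bar>h\<bar> * \<bar>h\<bar>"
          using cutoff_le_square[OF c, of k h] cutoff_nonneg[of k c h] by (simp add: C_def power2_eq_square)
        then show "norm (cutoff k c h / h) \<le> C * \<bar>h\<bar>"
          using C by (cases "h = 0") (auto simp: field_simps)
      qed
      show "((\<lambda>h. C * \<bar>h\<bar>) \<longlongrightarrow> 0) (at 0)" by (auto intro!: tendsto_eq_intros)
    qed
    then have "DERIV (cutoff k c) 0 :> 0"
      by (simp add: DERIV_def cutoff_def)
    then show ?thesis using 3 by (simp add: cutoff_def)
  qed
qed

text \<open>\<open>smooth_fun\<close> asks for a set of differentiable functions closed under
  partial derivatives. This algebra is such a set: its generators differentiate into itself, and the
  product rule does the rest.\<close>

inductive_set cutoff_algebra :: "real \<Rightarrow> (real^'n::finite \<Rightarrow> real) set" for c :: real where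
  up: "(\<lambda>x. cutoff k c (x $ i - a)) \<in> cutoff_algebra c"
| down: "(\<lambda>x. cutoff k c (a - x $ i)) \<in> cutoff_algebra c"
| const: "(\<lambda>x. r) \<in> cutoff_algebra c"
| add: "f \<in> cutoff_algebra c \<Longrightarrow> g \<in> cutoff_algebra c \<Longrightarrow> (\<lambda>x. f x + g x) \<in> cutoff_algebra c"
| mult: "f \<in> cutoff_algebra c \<Longrightarrow> g \<in> cutoff_algebra c \<Longrightarrow> (\<lambda>x. f x * g x) \<in> cutoff_algebra c"

lemma cutoff_algebra_prod:
  "finite I \<Longrightarrow> (\<And>i. i \<in> I \<Longrightarrow> f i \<in> cutoff_algebra c) \<Longrightarrow> (\<lambda>x. \<Prod>i\<in>I. f i x) \<in> cutoff_algebra c"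
  by (induction I rule: finite_induct) (auto intro: cutoff_algebra.intros)

lemma cutoff_algebra_derivative:
  fixes f :: "real^'n::finite \<Rightarrow> real"
  assumes c: "c > 0" and "f \<in> cutoff_algebra c"
  shows "\<exists>F. (\<forall>x. (f has_derivative F x) (at x)) \<and> (\<forall>i. (\<lambda>x. F x (axis i 1)) \<in> cutoff_algebra c)"
  using assms(2)
proof induction
  case (up k j a)
  have "((\<lambda>x. cutoff k c (x $ j - a)) has_derivative (\<lambda>h. (- real k * cutoff (k + 1) c (x $ j - a) + c * cutoff (k + 2) c (x $ j - a)) * (h $ j))) (at x)" for x :: "real^'n"
  proof -
    have "((\<lambda>x. x $ j - a) has_derivative (\<lambda>h. h $ j)) (at x)"
      by (auto intro!: derivative_eq_intros bounded_linear_imp_has_derivative bounded_linear_vec_nth)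
    from has_derivative_compose[OF this DERIV_cutoff[OF c, of k, unfolded has_field_derivative_def]]
    show ?thesis .
  qed
  moreover have "(\<lambda>x. (- real k * cutoff (k + 1) c (x $ j - a) + c * cutoff (k + 2) c (x $ j - a)) * ((axis i 1 :: real^'n) $ j)) \<in> cutoff_algebra c" for i
    by (intro cutoff_algebra.intros)
  ultimately show ?case by (intro exI conjI allI)
next
  case (down k a j)
  have "((\<lambda>x. cutoff k c (a - x $ j)) has_derivative (\<lambda>h. (- real k * cutoff (k + 1) c (a - x $ j) + c * cutoff (k + 2) c (a - x $ j)) * (- (h $ j)))) (at x)" for x :: "real^'n"
  proof -
    have "((\<lambda>x. a - x $ j) has_derivative (\<lambda>h. - (h $ j))) (at x)"
      by (auto intro!: derivative_eq_intros bounded_linear_imp_has_derivative bounded_linear_vec_nth)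
    from has_derivative_compose[OF this DERIV_cutoff[OF c, of k, unfolded has_field_derivative_def]]
    show ?thesis .
  qed
  moreover have "(\<lambda>x. (- real k * cutoff (k + 1) c (a - x $ j) + c * cutoff (k + 2) c (a - x $ j)) * (- ((axis i 1 :: real^'n) $ j))) \<in> cutoff_algebra c" for i
    by (intro cutoff_algebra.intros)
  ultimately show ?case by (intro exI conjI allI)
next
  case (const r)
  have "((\<lambda>x. r) has_derivative (\<lambda>h. 0)) (at x)" for x :: "real^'n" by simp
  then show ?case by (intro exI[of _ "\<lambda>x h. 0"]) (auto intro: cutoff_algebra.intros)
next
  case (add f g)
  then obtain F G where "\<And>x. (f has_derivative F x) (at x)" "\<And>i. (\<lambda>x. F x (axis i 1)) \<in> cutoff_algebra c"
    "\<And>x. (g has_derivative G x) (at x)" "\<And>i. (\<lambda>x. G x (axis i 1)) \<in> cutoff_algebra c" by blast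
  then show ?case
    by (intro exI[of _ "\<lambda>x h. F x h + G x h"]) (auto intro: cutoff_algebra.intros has_derivative_add)
next
  case (mult f g)
  then obtain F G where "\<And>x. (f has_derivative F x) (at x)" "\<And>i. (\<lambda>x. F x (axis i 1)) \<in> cutoff_algebra c"
    "\<And>x. (g has_derivative G x) (at x)" "\<And>i. (\<lambda>x. G x (axis i 1)) \<in> cutoff_algebra c" by blast
  note FG = this
  show ?case
  proof (intro exI[of _ "\<lambda>x h. f x * G x h + F x h * g x"] conjI allI)
    show "((\<lambda>x. f x * g x) has_derivative (\<lambda>h. f x * G x h + F x h * g x)) (at x)" for x
      using FG by (intro has_derivative_mult) auto
    show "(\<lambda>x. f x * G x (axis i 1) + F x (axis i 1) * g x) \<in> cutoff_algebra c" for i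
      by (intro cutoff_algebra.add cutoff_algebra.mult FG mult.hyps)
  qed
qed

lemma cutoff_algebra_differentiable:
  assumes c: "c > 0" and f: "f \<in> cutoff_algebra c"
  shows "f differentiable (at x)" "partial_deriv i f \<in> cutoff_algebra c" "continuous_on UNIV f"
proof -
  obtain F where F: "\<And>x. (f has_derivative F x) (at x)" "\<And>i. (\<lambda>x. F x (axis i 1)) \<in> cutoff_algebra c"
    using cutoff_algebra_derivative[OF assms] by blast
  show d: "f differentiable (at x)" for x using F(1) by (auto simp: differentiable_def)
  have "frechet_derivative f (at x) = F x" for x
    using frechet_derivative_at[OF F(1)] by simp
  then show "partial_deriv i f \<in> cutoff_algebra c"
    using F(2) by (simp add: partial_deriv_def[abs_def])
  show "continuous_on UNIV f"
    using d by (simp add: continuous_on_eq_continuous_at differentiable_imp_continuous_within)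
qed

lemma smooth_fun_cutoff_algebra:
  assumes "c > 0" "f \<in> cutoff_algebra c"
  shows "smooth_fun f"
  unfolding smooth_fun_def
  using assms cutoff_algebra_differentiable[OF assms(1)]
  by (intro exI[of _ "cutoff_algebra c"]) (auto simp: partial_deriv_def[abs_def])

text \<open>As \<open>n\<close> grows, the rate \<open>1 / Suc n\<close> tends to 0 and each factor
  exp(-c/t) tends to 1, so these test functions approach the indicator of the open box while staying
  between 0 and 1.\<close>

definition bump :: "nat \<Rightarrow> real^'n::finite \<Rightarrow> real^'n \<Rightarrow> real^'n \<Rightarrow> real" where
  "bump n a b x = (\<Prod>i\<in>UNIV. cutoff 0 (1 / Suc n) (x $ i - a $ i) * cutoff 0 (1 / Suc n) (b $ i - x $ i))"

lemma bump_algebra: "bump n a b \<in> cutoff_algebra (1 / Suc n)"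
  unfolding bump_def[abs_def] by (intro cutoff_algebra_prod cutoff_algebra.intros) auto

lemma bump_eq_0: "x \<notin> box a b \<Longrightarrow> bump n a b x = 0"
  by (simp add: bump_def mem_box_cart cutoff_def prod_zero_iff)

lemma bump_bounds: "0 \<le> bump n a b x" "bump n a b x \<le> 1"
  unfolding bump_def
  by (auto intro!: prod_nonneg prod_le_1 mult_nonneg_nonneg mult_le_one cutoff_nonneg cutoff_0_le_1)

lemma bump_translate: "bump n a b (x - z) = bump n (a + z) (b + z) x"
  by (simp add: bump_def algebra_simps)

lemma test_fun_bump: "test_fun (bump n a b)"
proof -
  have "closure {x. bump n a b x \<noteq> 0} \<subseteq> cbox a b"
    using bump_eq_0[of _ a b n] box_subset_cbox[of a b] by (intro closure_minimal) (auto simp: closed_cbox)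
  then have "compact (closure {x. bump n a b x \<noteq> 0})"
    by (meson bounded_cbox bounded_subset closed_closure compact_eq_bounded_closed)
  then show ?thesis using smooth_fun_cutoff_algebra[OF _ bump_algebra] by (simp add: test_fun_def)
qed

lemma continuous_on_bump: "continuous_on UNIV (bump n a b)" "continuous_on UNIV (partial_deriv i (bump n a b))"
  using cutoff_algebra_differentiable[OF _ bump_algebra] cutoff_algebra_differentiable[OF _ cutoff_algebra_differentiable(2)[OF _ bump_algebra]] by auto

lemma borel_measurable_bump [measurable]: "bump n a b \<in> borel_measurable borel" "partial_deriv i (bump n a b) \<in> borel_measurable borel"
  by (intro borel_measurable_continuous_onI continuous_on_bump)+

lemma partial_deriv_bump_eq_0:
  assumes "x \<notin> cbox a b"
  shows "partial_deriv i (bump n a b) x = 0"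
proof -
  have "((\<lambda>_. 0::real) has_derivative (\<lambda>_. 0)) (at x)" by simp
  then have "(bump n a b has_derivative (\<lambda>_. 0)) (at x)"
    by (rule has_derivative_transform_within_open[where s="- cbox a b"])
       (use assms box_subset_cbox[of a b] bump_eq_0[of _ a b n] in \<open>auto simp: subset_iff open_Compl closed_cbox\<close>)
  then show ?thesis by (simp add: partial_deriv_def frechet_derivative_at[symmetric])
qed

lemma partial_deriv_bump_bounded: "\<exists>B. \<forall>x. \<bar>partial_deriv i (bump n a b) x\<bar> \<le> B"
proof -
  have "compact (partial_deriv i (bump n a b) ` cbox a b)"
    by (intro compact_continuous_image compact_cbox continuous_on_subset[OF continuous_on_bump(2)]) auto
  then have "\<exists>B. \<forall>x\<in>cbox a b. \<bar>partial_deriv i (bump n a b) x\<bar> \<le> B"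
    by (auto dest!: compact_imp_bounded simp: bounded_iff)
  then obtain B where B: "\<And>x. x \<in> cbox a b \<Longrightarrow> \<bar>partial_deriv i (bump n a b) x\<bar> \<le> B"
    by blast
  have "\<bar>partial_deriv i (bump n a b) x\<bar> \<le> max B 0" for x
    using B[of x] partial_deriv_bump_eq_0[of x a b i n] by (cases "x \<in> cbox a b") auto
  then show ?thesis by blast
qed

lemma bump_tendsto: "(\<lambda>n. bump n a b x) \<longlonglongrightarrow> indicator (box a b) x"
proof (cases "x \<in> box a b")
  case False
  then show ?thesis by (simp add: bump_eq_0)
next
  case True
  have c: "(\<lambda>n. cutoff 0 (1 / Suc n) t) \<longlonglongrightarrow> 1" if "t > 0" for t
  proof -
    have "(\<lambda>n. exp (- (1 / Suc n) / t)) \<longlonglongrightarrow> exp (- 0 / t)"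
      using that by (intro tendsto_intros LIMSEQ_Suc[OF lim_1_over_n]) auto
    then show ?thesis using that by (simp add: cutoff_def)
  qed
  have "(\<lambda>n. bump n a b x) \<longlonglongrightarrow> (\<Prod>i\<in>(UNIV::'a set). 1 * 1)"
    unfolding bump_def using True by (intro tendsto_prod tendsto_mult c) (auto simp: mem_box_cart)
  then show ?thesis using True by simp
qed

text \<open>Fundamental lemma of the calculus of variations, for bumps only. Dominated convergence
  passes to boxes; then the positive and negative parts of \<open>h\<close> have equal finite
  integrals over every box, hence agree, and therefore both vanish.\<close>

lemma AE_zero_if_bump_integrals_zero:
  fixes h :: "real^'n::finite \<Rightarrow> real"
  assumes [measurable]: "h \<in> borel_measurable borel"
    and int: "\<And>a b. integrable lborel (\<lambda>x. h x * indicator (box a b) x)"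
    and zero: "\<And>n a b. (\<integral>x. h x * bump n a b x \<partial>lborel) = 0"
  shows "AE x in lborel. h x = 0"
proof -
  have box0: "(\<integral>x. h x * indicator (box a b) x \<partial>lborel) = 0" for a b
  proof -
    have "(\<lambda>n. \<integral>x. h x * bump n a b x \<partial>lborel) \<longlonglongrightarrow> (\<integral>x. h x * indicator (box a b) x \<partial>lborel)"
    proof (rule integral_dominated_convergence[where w="\<lambda>x. norm (h x * indicator (box a b) x)"])
      show "integrable lborel (\<lambda>x. norm (h x * indicator (box a b) x))" using int by (rule integrable_norm)
      show "AE x in lborel. (\<lambda>n. h x * bump n a b x) \<longlonglongrightarrow> h x * indicator (box a b) x"
        by (intro AE_I2 tendsto_intros bump_tendsto)
      show "AE x in lborel. norm (h x * bump n a b x) \<le> norm (h x * indicator (box a b) x)" for n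
        using bump_bounds[of n a b] bump_eq_0[of _ a b n]
        by (intro AE_I2) (auto simp: indicator_def abs_mult mult_left_le)
    qed auto
    then show ?thesis unfolding zero by (metis LIMSEQ_unique tendsto_const)
  qed
  have key: "(\<integral>\<^sup>+x. ennreal (h x) * indicator (box a b) x \<partial>lborel) = (\<integral>\<^sup>+x. ennreal (- h x) * indicator (box a b) x \<partial>lborel) \<and>
     (\<integral>\<^sup>+x. ennreal (h x) * indicator (box a b) x \<partial>lborel) \<noteq> \<infinity>" for a b
  proof -
    define P where "P = (\<integral>\<^sup>+x. ennreal (h x * indicator (box a b) x) \<partial>lborel)"
    define Q where "Q = (\<integral>\<^sup>+x. ennreal (- (h x * indicator (box a b) x)) \<partial>lborel)"
    have fin: "P \<noteq> \<infinity>" "Q \<noteq> \<infinity>" using int[of a b] unfolding real_integrable_def P_def Q_def by auto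
    have "enn2real P - enn2real Q = 0"
      using real_lebesgue_integral_def[OF int[of a b]] box0[of a b] unfolding P_def Q_def by simp
    then have "P = Q" using fin by (metis ennreal_enn2real_if infinity_ennreal_def right_minus_eq)
    moreover have "P = (\<integral>\<^sup>+x. ennreal (h x) * indicator (box a b) x \<partial>lborel)"
      unfolding P_def by (intro nn_integral_cong) (auto simp: indicator_def)
    moreover have "Q = (\<integral>\<^sup>+x. ennreal (- h x) * indicator (box a b) x \<partial>lborel)"
      unfolding Q_def by (intro nn_integral_cong) (auto simp: indicator_def)
    ultimately show ?thesis using fin by simp
  qed
  have "AE x in lborel. ennreal (h x) = ennreal (- h x)"
    by (rule nn_integral_box_unique[OF _ _ key[THEN conjunct1] key[THEN conjunct2]]) measurable
  then show ?thesis by eventually_elim (metis ennreal_eq_0_iff ennreal_neg linorder_le_cases neg_0_le_iff_le neg_le_0_iff_le order_antisym)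
qed

section \<open>Subcritical Sobolev embedding\<close>

lemma integral_lborel_plus:
  fixes f :: "'a::euclidean_space \<Rightarrow> real"
  assumes [measurable]: "f \<in> borel_measurable borel"
  shows "(\<integral>x. f (x + c) \<partial>lborel) = (\<integral>x. f x \<partial>lborel)"
proof -
  have "(\<integral>x. f x \<partial>lborel) = (\<integral>x. f x \<partial>(distr lborel borel ((+) c)))"
    by (simp only: lborel_distr_plus)
  also have "\<dots> = (\<integral>x. f (c + x) \<partial>lborel)" by (rule integral_distr) measurable
  finally show ?thesis by (simp add: add.commute)
qed

lemma abs_mult_le_sum_squares: "\<bar>a * b\<bar> \<le> a\<^sup>2 + b\<^sup>2" for a b :: real
proof -
  have "2 * (\<bar>a\<bar> * \<bar>b\<bar>) \<le> a\<^sup>2 + b\<^sup>2" using zero_le_power2[of "\<bar>a\<bar> - \<bar>b\<bar>"] by (simp add: power2_diff)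
  moreover have "\<bar>a\<bar> * \<bar>b\<bar> \<ge> 0" by simp
  ultimately show ?thesis unfolding abs_mult by linarith
qed

text \<open>Justifies Fubini in the translation argument. The product is at most A^2 + B^2, whose
  integral over x does not depend on the shifts, and t runs through a unit interval. The factors
  \<open>c\<close> and \<open>d\<close> allow either function to be the shifted one.\<close>

lemma integrable_line_product:
  fixes A B :: "'a::euclidean_space \<Rightarrow> real"
  assumes [measurable]: "A \<in> borel_measurable borel" "B \<in> borel_measurable borel"
    and A2: "integrable lborel (\<lambda>x. (A x)\<^sup>2)" and B2: "integrable lborel (\<lambda>x. (B x)\<^sup>2)"
  shows "integrable (lborel \<Otimes>\<^sub>M lborel) (\<lambda>(x, t). indicator {0..1} t * (A (x + (c * t) *\<^sub>R z) * B (x + (d * t) *\<^sub>R z)))"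
proof -
  let ?p = "\<lambda>x t. indicator {0..1} t * (A (x + (c * t) *\<^sub>R z) * B (x + (d * t) *\<^sub>R z)) :: real"
  let ?a = "\<integral>\<^sup>+x. ennreal ((A x)\<^sup>2) \<partial>lborel" and ?b = "\<integral>\<^sup>+x. ennreal ((B x)\<^sup>2) \<partial>lborel"
  have fin: "(\<integral>\<^sup>+x. ennreal ((F x)\<^sup>2) \<partial>lborel) < \<infinity>" if "integrable lborel (\<lambda>x. (F x)\<^sup>2)" for F :: "'a \<Rightarrow> real"
    using that unfolding integrable_iff_bounded by simp
  have "(\<integral>\<^sup>+w. ennreal (norm (case w of (x, t) \<Rightarrow> ?p x t)) \<partial>(lborel \<Otimes>\<^sub>M lborel))
     = (\<integral>\<^sup>+t. (\<integral>\<^sup>+x. ennreal (norm (?p x t)) \<partial>lborel) \<partial>lborel)"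
    by (subst lborel_pair.nn_integral_snd[symmetric]) simp_all
  also have "\<dots> \<le> (\<integral>\<^sup>+t. indicator {0..1} (t::real) * (?a + ?b) \<partial>lborel)"
  proof (rule nn_integral_mono)
    fix t :: real
    have "(\<integral>\<^sup>+x. ennreal (norm (?p x t)) \<partial>lborel)
       \<le> (\<integral>\<^sup>+x. indicator {0..1} t * (ennreal ((A ((c * t) *\<^sub>R z + x))\<^sup>2) + ennreal ((B ((d * t) *\<^sub>R z + x))\<^sup>2)) \<partial>lborel)"
    proof (rule nn_integral_mono)
      fix x
      show "ennreal (norm (?p x t))
        \<le> indicator {0..1} t * (ennreal ((A ((c * t) *\<^sub>R z + x))\<^sup>2) + ennreal ((B ((d * t) *\<^sub>R z + x))\<^sup>2))"
        using abs_mult_le_sum_squares by (auto simp: indicator_def add.commute simp flip: ennreal_plus intro!: ennreal_leI)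
    qed
    also have "\<dots> = indicator {0..1} t * (?a + ?b)"
      using nn_integral_lborel_plus[of "\<lambda>x. ennreal ((A x)\<^sup>2)"] nn_integral_lborel_plus[of "\<lambda>x. ennreal ((B x)\<^sup>2)"]
      by (simp add: nn_integral_cmult nn_integral_add)
    finally show "(\<integral>\<^sup>+x. ennreal (norm (?p x t)) \<partial>lborel)
       \<le> indicator {0..1} t * (?a + ?b)" .
  qed
  also have "\<dots> = ?a + ?b"
    by (simp add: nn_integral_multc)
  also have "\<dots> < \<infinity>" using fin[OF A2] fin[OF B2] by simp
  finally show ?thesis unfolding integrable_iff_bounded by (simp add: case_prod_beta)
qed

lemma integrable_mult_L2:
  fixes A B :: "'b \<Rightarrow> real"
  assumes [measurable]: "A \<in> borel_measurable M" "B \<in> borel_measurable M"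
    and A2: "integrable M (\<lambda>x. (A x)\<^sup>2)" and B2: "integrable M (\<lambda>x. (B x)\<^sup>2)"
  shows "integrable M (\<lambda>x. A x * B x)"
proof (rule Bochner_Integration.integrable_bound[OF Bochner_Integration.integrable_add[OF A2 B2]])
  show "AE x in M. norm (A x * B x) \<le> norm ((A x)\<^sup>2 + (B x)\<^sup>2)" using abs_mult_le_sum_squares by auto
qed measurable

lemma integrable_bounded_on_cbox:
  fixes f :: "'a::euclidean_space \<Rightarrow> real"
  assumes [measurable]: "f \<in> borel_measurable borel" and B: "\<And>x. \<bar>f x\<bar> \<le> B" and "\<And>x. x \<notin> cbox a b \<Longrightarrow> f x = 0"
  shows "integrable lborel f"
proof (rule Bochner_Integration.integrable_bound)
  show "integrable lborel (\<lambda>x. B * indicator (cbox a b) x)"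
    using emeasure_lborel_cbox_finite[of a b] by (intro integrable_mult_right integrable_real_indicator) auto
  show "AE x in lborel. norm (f x) \<le> norm (B * indicator (cbox a b) x)"
    using assms(2,3) by (intro AE_I2) (auto simp: indicator_def intro: order_trans[OF B abs_ge_self])
qed measurable

lemma integrable_square_bounded_on_cbox:
  fixes f :: "'a::euclidean_space \<Rightarrow> real"
  assumes [measurable]: "f \<in> borel_measurable borel" and B: "\<And>x. \<bar>f x\<bar> \<le> B" and 0: "\<And>x. x \<notin> cbox a b \<Longrightarrow> f x = 0"
  shows "integrable lborel (\<lambda>x. (f x)\<^sup>2)"
proof (rule integrable_bounded_on_cbox[where B="B\<^sup>2"])
  show "\<bar>(f x)\<^sup>2\<bar> \<le> B\<^sup>2" for x using power_mono[OF B[of x], of 2] by simp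
qed (use 0 in auto)

lemma bump_has_derivative:
  "(bump n a b has_derivative (\<lambda>h. \<Sum>i\<in>UNIV. h $ i * partial_deriv i (bump n a b) x)) (at x)"
proof -
  let ?D = "frechet_derivative (bump n a b) (at x)"
  have "bump n a b differentiable (at x)"
    using cutoff_algebra_differentiable(1)[OF _ bump_algebra] by simp
  then have D: "(bump n a b has_derivative ?D) (at x)" by (simp add: frechet_derivative_works)
  then have lin: "linear ?D" by (rule has_derivative_linear)
  have "?D = (\<lambda>h. \<Sum>i\<in>UNIV. h $ i * partial_deriv i (bump n a b) x)"
  proof
    fix h
    have "?D h = ?D (\<Sum>i\<in>UNIV. h $ i *s axis i 1)" by (simp only: basis_expansion)
    also have "\<dots> = (\<Sum>i\<in>UNIV. h $ i * ?D (axis i 1))"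
      by (simp add: linear_sum[OF lin] scalar_mult_eq_scaleR linear_scale[OF lin])
    finally show "?D h = (\<Sum>i\<in>UNIV. h $ i * partial_deriv i (bump n a b) x)" by (simp add: partial_deriv_def)
  qed
  then show ?thesis using D by simp
qed

lemma partial_deriv_bump_translate:
  "partial_deriv i (bump n (a + z) (b + z)) x = partial_deriv i (bump n a b) (x - z)"
proof -
  have "((\<lambda>x. x - z) has_derivative (\<lambda>h. h)) (at x)" by (auto intro!: derivative_eq_intros)
  from has_derivative_compose[OF this bump_has_derivative]
  have "(bump n (a + z) (b + z) has_derivative (\<lambda>h. \<Sum>i\<in>UNIV. h $ i * partial_deriv i (bump n a b) (x - z))) (at x)"
    by (simp add: bump_translate)
  then have "frechet_derivative (bump n (a + z) (b + z)) (at x) = (\<lambda>h. \<Sum>i\<in>UNIV. h $ i * partial_deriv i (bump n a b) (x - z))"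
    by (rule frechet_derivative_at[symmetric])
  then have "partial_deriv i (bump n (a + z) (b + z)) x = (\<Sum>j\<in>UNIV. axis i 1 $ j * partial_deriv j (bump n a b) (x - z))"
    unfolding partial_deriv_def[of i "bump n (a + z) (b + z)"] by (rule fun_cong)
  also have "\<dots> = (\<Sum>j\<in>UNIV. if j = i then partial_deriv j (bump n a b) (x - z) else 0)"
    by (intro sum.cong) (auto simp: axis_def)
  finally show ?thesis by simp
qed

lemma bump_diff_integral:
  "bump n a b x - bump n a b (x - z) =
     (\<integral>t. indicator {0..1} t * (\<Sum>i\<in>UNIV. z $ i * partial_deriv i (bump n a b) (x - t *\<^sub>R z)) \<partial>lborel)"
proof -
  let ?F = "\<lambda>t. - bump n a b (x - t *\<^sub>R z)"
  let ?f = "\<lambda>t. \<Sum>i\<in>UNIV. z $ i * partial_deriv i (bump n a b) (x - t *\<^sub>R z)"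
  have der: "(?F has_vector_derivative ?f t) (at t within {0..1})" for t
  proof -
    have "((\<lambda>t. x - t *\<^sub>R z) has_derivative (\<lambda>h. - (h *\<^sub>R z))) (at t within {0..1})"
      by (auto intro!: derivative_eq_intros)
    from has_derivative_minus[OF has_derivative_compose[OF this bump_has_derivative[of n a b "x - t *\<^sub>R z"]]]
    show ?thesis unfolding has_vector_derivative_def
      by (rule has_derivative_eq_rhs) (simp add: sum_negf sum_distrib_left mult.assoc)
  qed
  have cont: "continuous_on {0..1} ?f"
    by (intro continuous_intros continuous_on_compose2[OF continuous_on_bump(2)]) auto
  have "(LBINT t:{0..1}. ?f t) = ?F 1 - ?F 0"
    unfolding set_lebesgue_integral_def by (rule integral_FTC_Icc[OF _ der cont]) simp
  then show ?thesis by (simp add: set_lebesgue_integral_def)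
qed

text \<open>The fundamental theorem of calculus along segments, for weak gradients. Tested against a
  bump, the translation moves from u to the bump, where the classical theorem holds; the weak
  gradient identity then moves the derivative back, and bumps separate functions almost
  everywhere.\<close>

lemma weak_gradient_translate:
  fixes u :: "real^'n::finite \<Rightarrow> real" and g :: "real^'n \<Rightarrow> real^'n" and z :: "real^'n"
  assumes [measurable]: "u \<in> borel_measurable borel" "\<And>i. (\<lambda>x. g x $ i) \<in> borel_measurable borel"
    and u2: "integrable lborel (\<lambda>x. (u x)\<^sup>2)" and g2: "\<And>i. integrable lborel (\<lambda>x. (g x $ i)\<^sup>2)"
    and weak: "\<And>n a b i. (\<integral>x. u x * partial_deriv i (bump n a b) x \<partial>lborel) = - (\<integral>x. g x $ i * bump n a b x \<partial>lborel)"
  shows "AE x in lborel. u x - u (x + z) + (\<integral>t. indicator {0..1} t * (\<Sum>i\<in>UNIV. z $ i * g (x + t *\<^sub>R z) $ i) \<partial>lborel) = 0"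
proof (rule AE_zero_if_bump_integrals_zero)

  let ?H = "\<lambda>x. u x - u (x + z) + (\<integral>t. indicator {0..1} t * (\<Sum>i\<in>UNIV. z $ i * g (x + t *\<^sub>R z) $ i) \<partial>lborel)"
  define G where "G x = (\<Sum>i\<in>UNIV. z $ i * g x $ i)" for x
  have [measurable]: "G \<in> borel_measurable borel" unfolding G_def by measurable
  have G2: "integrable lborel (\<lambda>x. (G x)\<^sup>2)"
  proof -
    have "integrable lborel (\<lambda>x. (g x $ i) * (g x $ j))" for i j
      by (intro integrable_mult_L2 g2) measurable
    then have "integrable lborel (\<lambda>x. \<Sum>i\<in>UNIV. \<Sum>j\<in>UNIV. (z $ i * z $ j) * ((g x $ i) * (g x $ j)))"
      by (intro Bochner_Integration.integrable_sum integrable_mult_right)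
    moreover have "(\<lambda>x. (G x)\<^sup>2) = (\<lambda>x. \<Sum>i\<in>UNIV. \<Sum>j\<in>UNIV. (z $ i * z $ j) * ((g x $ i) * (g x $ j)))"
      unfolding G_def power2_eq_square sum_product by (simp add: mult_ac)
    ultimately show ?thesis by simp
  qed
  have Geq: "(\<Sum>i\<in>UNIV. z $ i * g y $ i) = G y" for y by (simp add: G_def)
  let ?I = "\<lambda>x. \<integral>t. indicator {0..1} t * G (x + t *\<^sub>R z) \<partial>lborel"
  show "?H \<in> borel_measurable borel"
    by measurable
  have intu: "integrable lborel (\<lambda>x. u x * \<phi> x)" "integrable lborel (\<lambda>x. u (x + z) * \<phi> x)"
    and intI: "integrable lborel (\<lambda>x. ?I x * \<phi> x)"
    and fubI: "(\<integral>x. ?I x * \<phi> x \<partial>lborel) = (\<integral>t. indicator {0..1} t * (\<integral>x. G (x + t *\<^sub>R z) * \<phi> x \<partial>lborel) \<partial>lborel)"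
    if [measurable]: "\<phi> \<in> borel_measurable borel" and \<phi>: "\<And>x. \<bar>\<phi> x\<bar> \<le> 1" "\<And>x. x \<notin> cbox a b \<Longrightarrow> \<phi> x = 0" for \<phi> :: "real^'n \<Rightarrow> real" and a b
  proof -
    have \<phi>2: "integrable lborel (\<lambda>x. (\<phi> x)\<^sup>2)"
      using \<phi> by (intro integrable_square_bounded_on_cbox[where B=1]) auto
    show "integrable lborel (\<lambda>x. u x * \<phi> x)" using u2 \<phi>2 by (intro integrable_mult_L2) auto
    have "integrable lborel (\<lambda>x. (u (x + z))\<^sup>2)"
    proof -
      have "integrable (distr lborel borel ((+) z)) (\<lambda>x. (u x)\<^sup>2)" using u2 by (simp only: lborel_distr_plus)
      then have "integrable lborel (\<lambda>x. (u (z + x))\<^sup>2)" by (subst (asm) integrable_distr_eq) measurable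
      then show ?thesis by (simp add: add.commute)
    qed
    then show "integrable lborel (\<lambda>x. u (x + z) * \<phi> x)" using \<phi>2 by (intro integrable_mult_L2) auto
    have J: "integrable (lborel \<Otimes>\<^sub>M lborel) (\<lambda>(x, t). indicator {0..1} t * (G (x + t *\<^sub>R z) * \<phi> x))"
      using integrable_line_product[OF _ _ G2 \<phi>2, of 1 z 0] by simp
    have eq: "(\<integral>t. indicator {0..1} t * (G (x + t *\<^sub>R z) * \<phi> x) \<partial>lborel) = ?I x * \<phi> x" for x
      by (simp only: mult.assoc[symmetric] integral_mult_left_zero)
    show "integrable lborel (\<lambda>x. ?I x * \<phi> x)"
      using lborel_pair.integrable_fst'[OF J] by (simp add: eq)
    have "(\<integral>x. ?I x * \<phi> x \<partial>lborel) = (\<integral>t. (\<integral>x. indicator {0..1} t * (G (x + t *\<^sub>R z) * \<phi> x) \<partial>lborel) \<partial>lborel)"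
      using lborel_pair.Fubini_integral[of "\<lambda>x t. indicator {0..1} t * (G (x + t *\<^sub>R z) * \<phi> x)"] J by (simp add: eq)
    also have "\<dots> = (\<integral>t. indicator {0..1} t * (\<integral>x. G (x + t *\<^sub>R z) * \<phi> x \<partial>lborel) \<partial>lborel)"
      by simp
    finally show "(\<integral>x. ?I x * \<phi> x \<partial>lborel) = (\<integral>t. indicator {0..1} t * (\<integral>x. G (x + t *\<^sub>R z) * \<phi> x \<partial>lborel) \<partial>lborel)" .
  qed
  have expand: "?H x * \<phi> x
     = u x * \<phi> x - u (x + z) * \<phi> x + ?I x * \<phi> x" for \<phi> :: "real^'n \<Rightarrow> real" and x
    unfolding Geq by (simp add: algebra_simps)
  show "integrable lborel (\<lambda>x. ?H x * indicator (box a b) x)" for a b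
    unfolding expand
    by (intro Bochner_Integration.integrable_add Bochner_Integration.integrable_diff intu[of _ a b] intI[of _ a b])
       (auto simp: indicator_def box_subset_cbox[THEN subsetD])
  show "(\<integral>x. ?H x * bump n a b x \<partial>lborel) = 0" for n a b
  proof -
    let ?\<phi> = "bump n a b"
    define \<psi> where "\<psi> y = (\<Sum>i\<in>UNIV. z $ i * partial_deriv i ?\<phi> y)" for y
    have [measurable]: "\<psi> \<in> borel_measurable borel" unfolding \<psi>_def by measurable
    have b1: "\<bar>?\<phi> x\<bar> \<le> 1" "x \<notin> cbox a b \<Longrightarrow> ?\<phi> x = 0" for x
      using bump_bounds[of n a b x] bump_eq_0[of x a b n] box_subset_cbox[of a b] by auto
    have "\<exists>B. \<forall>x. \<bar>\<psi> x\<bar> \<le> B"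
    proof -
      obtain B where B: "\<And>i x. \<bar>partial_deriv i ?\<phi> x\<bar> \<le> B i"
        using partial_deriv_bump_bounded[of _ n a b] by metis
      have "\<bar>\<psi> x\<bar> \<le> (\<Sum>i\<in>UNIV. \<bar>z $ i\<bar> * B i)" for x
        unfolding \<psi>_def by (intro order_trans[OF sum_abs] sum_mono) (auto simp: abs_mult intro: mult_left_mono B)
      then show ?thesis by blast
    qed
    then obtain B where B: "\<And>x. \<bar>\<psi> x\<bar> \<le> B" by blast
    let ?U = "\<lambda>x t. indicator {0..1} t * (u x * \<psi> (x - t *\<^sub>R z)) :: real"
    have \<psi>2: "integrable lborel (\<lambda>x. (\<psi> x)\<^sup>2)"
      by (rule integrable_square_bounded_on_cbox[where f=\<psi> and a=a and b=b, OF _ B]) (auto simp: \<psi>_def partial_deriv_bump_eq_0)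
    have J: "integrable (lborel \<Otimes>\<^sub>M lborel) (\<lambda>(x, t). ?U x t)"
      using integrable_line_product[OF _ _ u2 \<psi>2, of 0 z "-1"] by simp
    have 1: "(\<integral>x. u (x + z) * ?\<phi> x \<partial>lborel) = (\<integral>x. u x * ?\<phi> (x - z) \<partial>lborel)"
      using integral_lborel_plus[of "\<lambda>x. u x * ?\<phi> (x - z)" z] by simp
    have iz: "integrable lborel (\<lambda>x. u x * ?\<phi> (x - z))"
      unfolding bump_translate
      using bump_bounds[of n "a + z" "b + z"] bump_eq_0[of _ "a + z" "b + z" n] box_subset_cbox[of "a + z" "b + z"]
      by (intro intu(1)[of _ "a + z" "b + z"]) auto
    have "(\<integral>x. u x * ?\<phi> x \<partial>lborel) - (\<integral>x. u (x + z) * ?\<phi> x \<partial>lborel) = (\<integral>x. u x * (?\<phi> x - ?\<phi> (x - z)) \<partial>lborel)"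
      unfolding 1 using intu(1)[OF _ b1] iz by (subst Bochner_Integration.integral_diff[symmetric]) (auto simp: right_diff_distrib)
    also have "\<dots> = (\<integral>x. (\<integral>t. ?U x t \<partial>lborel) \<partial>lborel)"
    proof (rule Bochner_Integration.integral_cong[OF refl])
      fix x
      have "u x * (?\<phi> x - ?\<phi> (x - z)) = (\<integral>t. u x * (indicator {0..1} t * \<psi> (x - t *\<^sub>R z)) \<partial>lborel)"
        unfolding bump_diff_integral \<psi>_def by simp
      then show "u x * (?\<phi> x - ?\<phi> (x - z)) = (\<integral>t. ?U x t \<partial>lborel)"
        by (simp only: mult.left_commute)
    qed
    also have "\<dots> = (\<integral>t. (\<integral>x. ?U x t \<partial>lborel) \<partial>lborel)"
      using lborel_pair.Fubini_integral[of "\<lambda>x t. ?U x t"] J by simp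
    also have "\<dots> = (\<integral>t. - (indicator {0..1} t * (\<integral>x. G (x + t *\<^sub>R z) * ?\<phi> x \<partial>lborel)) \<partial>lborel)"
    proof (rule Bochner_Integration.integral_cong[OF refl])
      fix t :: real
      \<comment> \<open>The translate of a bump is the bump of the translated box, so the hypothesis
        \<open>weak\<close> applies to it directly.\<close>
      let ?T = "bump n (a + t *\<^sub>R z) (b + t *\<^sub>R z)"
      have bT: "\<bar>?T x\<bar> \<le> 1" "x \<notin> cbox (a + t *\<^sub>R z) (b + t *\<^sub>R z) \<Longrightarrow> ?T x = 0" for x
        using bump_bounds[of n "a + t *\<^sub>R z" "b + t *\<^sub>R z" x] bump_eq_0[of x "a + t *\<^sub>R z" "b + t *\<^sub>R z" n] box_subset_cbox[of "a + t *\<^sub>R z" "b + t *\<^sub>R z"] by auto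
      have T2: "integrable lborel (\<lambda>x. (?T x)\<^sup>2)"
        by (rule integrable_square_bounded_on_cbox[where f="?T", OF _ bT]) auto
      have P2: "integrable lborel (\<lambda>x. (partial_deriv i ?T x)\<^sup>2)" for i
      proof -
        obtain C where "\<And>x. \<bar>partial_deriv i ?T x\<bar> \<le> C" using partial_deriv_bump_bounded by blast
        then show ?thesis using partial_deriv_bump_eq_0 by (intro integrable_square_bounded_on_cbox) auto
      qed
      have "(\<integral>x. u x * \<psi> (x - t *\<^sub>R z) \<partial>lborel) = (\<integral>x. (\<Sum>i\<in>UNIV. z $ i * (u x * partial_deriv i ?T x)) \<partial>lborel)"
        unfolding \<psi>_def partial_deriv_bump_translate by (simp add: sum_distrib_left mult.left_commute)
      also have "\<dots> = (\<Sum>i\<in>UNIV. z $ i * (\<integral>x. u x * partial_deriv i ?T x \<partial>lborel))"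
        by (subst Bochner_Integration.integral_sum) (auto intro!: integrable_mult_right integrable_mult_L2 u2 P2)
      also have "\<dots> = - (\<Sum>i\<in>UNIV. z $ i * (\<integral>x. g x $ i * ?T x \<partial>lborel))"
        unfolding weak by (simp add: sum_negf)
      also have "(\<Sum>i\<in>UNIV. z $ i * (\<integral>x. g x $ i * ?T x \<partial>lborel)) = (\<integral>x. (\<Sum>i\<in>UNIV. z $ i * (g x $ i * ?T x)) \<partial>lborel)"
        by (subst Bochner_Integration.integral_sum) (auto intro!: integrable_mult_right integrable_mult_L2 g2 T2)
      also have "\<dots> = (\<integral>x. G x * ?\<phi> (x - t *\<^sub>R z) \<partial>lborel)"
        unfolding G_def bump_translate by (simp add: sum_distrib_right mult.assoc)
      also have "\<dots> = (\<integral>x. G (x + t *\<^sub>R z) * ?\<phi> x \<partial>lborel)"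
        using integral_lborel_plus[of "\<lambda>x. G x * ?\<phi> (x - t *\<^sub>R z)" "t *\<^sub>R z"] by simp
      finally show "(\<integral>x. ?U x t \<partial>lborel) = - (indicator {0..1} t * (\<integral>x. G (x + t *\<^sub>R z) * ?\<phi> x \<partial>lborel))"
        by simp
    qed
    also have "\<dots> = - (\<integral>x. ?I x * ?\<phi> x \<partial>lborel)" using fubI[OF _ b1] by simp
    finally show ?thesis unfolding expand using intu[OF _ b1] intI[OF _ b1]
      by (subst Bochner_Integration.integral_add) (auto simp: Bochner_Integration.integral_diff)
  qed
qed

text \<open>For fixed t, substituting w = t z gives the factor |w| t^(-N-1) on |w| < t <= 1.
  Integrating over t >= |w| leaves |w|^(1-N)/N, the truncated Riesz potential kernel of order one;
  1/N is estimated by 1.\<close>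

lemma nn_integral_segment_average_le:
  fixes G :: "'a::euclidean_space \<Rightarrow> real"
  assumes [measurable]: "G \<in> borel_measurable borel" and G0: "\<And>x. G x \<ge> 0"
  shows "(\<integral>\<^sup>+z. indicator (ball 0 1) z * (\<integral>\<^sup>+t. indicator {0..1} t * ennreal (norm z * G (x + t *\<^sub>R z)) \<partial>lborel) \<partial>lborel)
    \<le> (\<integral>\<^sup>+w. ennreal ((norm w powr (- (real DIM('a) - 1)) * indicator (ball 0 1) w) * G (x + w)) \<partial>lborel)"
proof -
  let ?A = "\<lambda>w. ennreal (norm w * G (x + w))"
  let ?K = "\<lambda>w t. indicator {..<1} (norm (w :: 'a) / t) * (indicator {0..1} t * ennreal (t powr (- real DIM('a) - 1)))"
  let ?I = "\<lambda>z t. indicator {0..1} t * ennreal (norm z * G (x + t *\<^sub>R z))"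
  let ?N = "real DIM('a)"
  have N: "?N \<ge> 1" using DIM_positive[where 'a='a] by linarith
  have [measurable]: "(\<lambda>w::'a. indicator (ball 0 1) w :: ennreal) \<in> borel_measurable borel" "(\<lambda>w::'a. indicator (ball 0 1) w :: real) \<in> borel_measurable borel"
    by (auto intro: borel_measurable_indicator)
  have ind: "indicator (ball 0 1) z = indicator {..<1} (norm z)" for z :: 'a
    by (auto simp: indicator_def)
  have "(\<integral>\<^sup>+z. indicator (ball 0 1) z * (\<integral>\<^sup>+t. ?I z t \<partial>lborel) \<partial>lborel)
    = (\<integral>\<^sup>+z. (\<integral>\<^sup>+t. indicator {..<1} (norm z) * (?I z t) \<partial>lborel) \<partial>lborel)"
    unfolding ind by (intro nn_integral_cong nn_integral_cmult[symmetric]) measurable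
  also have "\<dots> = (\<integral>\<^sup>+t. (\<integral>\<^sup>+z. indicator {..<1} (norm z) * (?I z t) \<partial>lborel) \<partial>lborel)"
    by (intro lborel_pair.Fubini') measurable
  also have "\<dots> = (\<integral>\<^sup>+t. (\<integral>\<^sup>+w. ?A w * (?K w t) \<partial>lborel) \<partial>lborel)"
  proof (rule nn_integral_cong_AE, rule AE_mp[OF AE_lborel_singleton[of 0] AE_I2], rule impI)
    fix t :: real assume t: "t \<noteq> 0"
    show "(\<integral>\<^sup>+z. indicator {..<1} (norm z) * (?I z t) \<partial>lborel)
      = (\<integral>\<^sup>+w. ?A w * (?K w t) \<partial>lborel)"
    proof (cases "0 < t \<and> t \<le> 1")
      case False
      then have "indicator {0..1} t = (0::ennreal)" using t by (auto simp: indicator_def)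
      then show ?thesis by simp
    next
      case True
      have "(\<integral>\<^sup>+w. ?A w * (?K w t) \<partial>lborel)
         = ennreal (\<bar>t\<bar> ^ DIM('a)) * (\<integral>\<^sup>+z. ennreal (norm (0 + t *\<^sub>R z) * G (x + (0 + t *\<^sub>R z))) * (?K (0 + t *\<^sub>R z) t) \<partial>lborel)"
        using t by (intro nn_integral_lborel_affine) measurable
      also have "\<dots> = (\<integral>\<^sup>+z. ennreal (\<bar>t\<bar> ^ DIM('a)) * (ennreal (norm (0 + t *\<^sub>R z) * G (x + (0 + t *\<^sub>R z))) * (?K (0 + t *\<^sub>R z) t)) \<partial>lborel)"
        by (intro nn_integral_cmult[symmetric]) measurable
      also have "\<dots> = (\<integral>\<^sup>+z. indicator {..<1} (norm z) * (?I z t) \<partial>lborel)"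
      proof (intro nn_integral_cong)
        fix z :: 'a
        have "t ^ DIM('a) * (t * norm z * G (x + t *\<^sub>R z) * t powr (- ?N - 1)) = norm z * G (x + t *\<^sub>R z) * (t powr ?N * t powr 1 * t powr (- ?N - 1))"
          using True by (simp add: powr_realpow)
        also have "t powr ?N * t powr 1 * t powr (- ?N - 1) = 1"
          using True unfolding powr_add[symmetric] by simp
        finally have "t ^ DIM('a) * (t * norm z * G (x + t *\<^sub>R z) * t powr (- ?N - 1)) = norm z * G (x + t *\<^sub>R z)" by simp
        then show "ennreal (\<bar>t\<bar> ^ DIM('a)) * (ennreal (norm (0 + t *\<^sub>R z) * G (x + (0 + t *\<^sub>R z))) * (?K (0 + t *\<^sub>R z) t))
          = indicator {..<1} (norm z) * (?I z t)"
          using True G0[of "x + t *\<^sub>R z"] by (auto simp: indicator_def simp flip: ennreal_mult)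
      qed
      finally show ?thesis by simp
    qed
  qed
  also have "\<dots> = (\<integral>\<^sup>+w. (\<integral>\<^sup>+t. ?A w * (?K w t) \<partial>lborel) \<partial>lborel)"
    by (intro lborel_pair.Fubini') measurable
  also have "\<dots> \<le> (\<integral>\<^sup>+w. ennreal ((norm w powr (- (?N - 1)) * indicator (ball 0 1) w) * G (x + w)) \<partial>lborel)"
  proof (rule nn_integral_mono_AE, rule AE_mp[OF AE_lborel_singleton[of 0] AE_I2], rule impI)
    fix w :: 'a assume w: "w \<noteq> 0"
    have "(\<integral>\<^sup>+t. ?A w * (?K w t) \<partial>lborel)
      \<le> (\<integral>\<^sup>+t. ?A w * indicator (ball 0 1) w * (ennreal (t powr (- ?N - 1)) * indicator {norm w..} t) \<partial>lborel)"
    proof (rule nn_integral_mono)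
      fix t :: real
      have "norm w < 1 \<and> norm w \<le> t" if "norm w / t < 1" "0 \<le> t" "t \<le> 1" "t \<noteq> 0"
        using that by (simp add: field_simps)
      then show "?A w * (?K w t)
         \<le> ?A w * indicator (ball 0 1) w * (ennreal (t powr (- ?N - 1)) * indicator {norm w..} t)"
        by (cases "t = 0") (auto simp: indicator_def)
    qed
    also have "\<dots> = ?A w * indicator (ball 0 1) w * ennreal (norm w powr (- ?N) / ?N)"
      using nn_integral_powr_tail[of "norm w" ?N] w N by (subst nn_integral_cmult) auto
    also have "\<dots> \<le> ennreal ((norm w powr (- (?N - 1)) * indicator (ball 0 1) w) * G (x + w))"
    proof (cases "w \<in> ball 0 1")
      case True
      have "norm w * G (x + w) * (norm w powr (- ?N) / ?N) \<le> norm w * G (x + w) * norm w powr (- ?N)"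
        using N G0[of "x + w"] divide_left_mono[of 1 ?N "norm w powr (- ?N)"] by (intro mult_left_mono) auto
      also have "\<dots> = (norm w powr 1 * norm w powr (- ?N)) * G (x + w)" using w by simp
      also have "norm w powr 1 * norm w powr (- ?N) = norm w powr (- (?N - 1))" by (simp only: powr_add[symmetric]) simp
      finally show ?thesis using True G0[of "x + w"] by (auto simp: ennreal_leI simp flip: ennreal_mult)
    qed auto
    finally show "(\<integral>\<^sup>+t. ?A w * (?K w t) \<partial>lborel)
      \<le> ennreal ((norm w powr (- (?N - 1)) * indicator (ball 0 1) w) * G (x + w))" .
  qed
  finally show ?thesis .
qed

text \<open>Holds for every \<open>f\<close>, since the Bochner integral of a non-integrable
  function is 0.\<close>

lemma ennreal_abs_integral_le:
  fixes f :: "'b \<Rightarrow> real"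
  shows "ennreal \<bar>\<integral>x. f x \<partial>M\<bar> \<le> (\<integral>\<^sup>+x. ennreal \<bar>f x\<bar> \<partial>M)"
  using integral_norm_bound_ennreal[of M f] by (cases "integrable M f") (auto simp: not_integrable_integral_eq)

text \<open>Averaging the segment formula over the unit ball bounds |u| by a truncated potential of
  |u| + |g|, a function in L^2. Young's inequality with 1/r = 1/2 + 1/q applies as soon as r (N - 1)
  < N, which is the condition 1/q > 1/2 - 1/N.\<close>

lemma sobolev_subcritical:
  fixes u :: "real^'n::finite \<Rightarrow> real" and g :: "real^'n \<Rightarrow> real^'n"
  assumes [measurable]: "u \<in> borel_measurable borel" "\<And>i. (\<lambda>x. g x $ i) \<in> borel_measurable borel"
    and u2: "integrable lborel (\<lambda>x. (u x)\<^sup>2)" and g2: "\<And>i. integrable lborel (\<lambda>x. (g x $ i)\<^sup>2)"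
    and weak: "\<And>n a b i. (\<integral>x. u x * partial_deriv i (bump n a b) x \<partial>lborel) = - (\<integral>x. g x $ i * bump n a b x \<partial>lborel)"
    and q: "q > 2" "1 / q > 1 / 2 - 1 / real CARD('n)"
  shows "(\<integral>\<^sup>+x. ennreal (\<bar>u x\<bar> powr q) \<partial>lborel) < \<infinity>"
proof -
  let ?q = "\<lambda>x. 2 * (u x)\<^sup>2 + 2 * (\<Sum>i\<in>UNIV. (g x $ i)\<^sup>2)"
  let ?S = "\<lambda>x z. \<integral>\<^sup>+t. indicator {0..1} t * ennreal (norm z * norm (g (x + t *\<^sub>R z))) \<partial>lborel"
  let ?N = "real CARD('n)"
  have N: "?N \<ge> 1" by (simp add: Suc_leI)
  have [measurable]: "(\<lambda>w::real^'n. indicator (ball 0 1) w :: ennreal) \<in> borel_measurable borel" "(\<lambda>w::real^'n. indicator (ball 0 1) w :: real) \<in> borel_measurable borel"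
    by (auto intro: borel_measurable_indicator)
  have gm [measurable]: "g \<in> borel_measurable borel"
  proof -
    have "(\<lambda>x. \<Sum>i\<in>UNIV. g x $ i *\<^sub>R axis i (1::real)) \<in> borel_measurable borel"
      by (intro borel_measurable_sum borel_measurable_scaleR borel_measurable_const assms(2))
    moreover have "(\<lambda>x. \<Sum>i\<in>UNIV. g x $ i *\<^sub>R axis i (1::real)) = g"
      using basis_expansion[of "g _"] by (simp add: scalar_mult_eq_scaleR)
    ultimately show ?thesis by simp
  qed
  define V where "V = unit_ball_vol ?N"
  have V: "V > 0" by (simp add: V_def unit_ball_vol_pos)
  define k where "k w = norm w powr (- (?N - 1)) * indicator (ball 0 1) w" for w :: "real^'n"
  have [measurable]: "k \<in> borel_measurable borel" unfolding k_def by measurable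
  define G where "G x = \<bar>u x\<bar> + norm (g x)" for x
  have [measurable]: "G \<in> borel_measurable borel" unfolding G_def by measurable
  have step: "AE x in lborel. ennreal \<bar>u x\<bar> \<le> ennreal \<bar>u (x + z)\<bar> + ?S x z" for z
    using weak_gradient_translate[OF assms(1,2) u2 g2 weak, of z]
  proof eventually_elim
    fix x
    let ?I = "\<integral>t. indicator {0..1} t * (\<Sum>i\<in>UNIV. z $ i * g (x + t *\<^sub>R z) $ i) \<partial>lborel"
    assume "u x - u (x + z) + ?I = 0"
    then have "\<bar>u x\<bar> \<le> \<bar>u (x + z)\<bar> + \<bar>?I\<bar>" by linarith
    then have "ennreal \<bar>u x\<bar> \<le> ennreal \<bar>u (x + z)\<bar> + ennreal \<bar>?I\<bar>"
      by (simp add: ennreal_leI flip: ennreal_plus)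
    also have "ennreal \<bar>?I\<bar> \<le> (\<integral>\<^sup>+t. ennreal \<bar>indicator {0..1} t * (\<Sum>i\<in>UNIV. z $ i * g (x + t *\<^sub>R z) $ i)\<bar> \<partial>lborel)"
      by (rule ennreal_abs_integral_le)
    also have "\<dots> \<le> ?S x z"
    proof (rule nn_integral_mono)
      fix t :: real
      have "\<bar>\<Sum>i\<in>UNIV. z $ i * g (x + t *\<^sub>R z) $ i\<bar> \<le> norm z * norm (g (x + t *\<^sub>R z))"
        using Cauchy_Schwarz_ineq2[of z "g (x + t *\<^sub>R z)"] by (simp add: inner_vec_def)
      then show "ennreal \<bar>indicator {0..1} t * (\<Sum>i\<in>UNIV. z $ i * g (x + t *\<^sub>R z) $ i)\<bar> \<le> indicator {0..1} t * ennreal (norm z * norm (g (x + t *\<^sub>R z)))"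
        by (auto simp: indicator_def ennreal_leI)
    qed
    finally show "ennreal \<bar>u x\<bar> \<le> ennreal \<bar>u (x + z)\<bar> + ?S x z"
      by (simp add: add_left_mono)
  qed
  \<comment> \<open>The exceptional null set of x depends on z; Tonelli exchanges the quantifiers so
    that one x can be averaged over z.\<close>
  have "AE x in lborel. AE z in lborel. ennreal \<bar>u x\<bar> \<le> ennreal \<bar>u (x + z)\<bar> + ?S x z"
  proof (rule lborel_pair.AE_commute[THEN iffD2])
    show "AE z in lborel. AE x in lborel. ennreal \<bar>u x\<bar> \<le> ennreal \<bar>u (x + z)\<bar> + ?S x z"
      using step by simp
  qed measurable
  then have le: "AE x in lborel. ennreal (V * \<bar>u x\<bar>) \<le> (\<integral>\<^sup>+w. ennreal (k w * G (x + w)) \<partial>lborel)"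
  proof eventually_elim
    fix x
    assume *: "AE z in lborel. ennreal \<bar>u x\<bar> \<le> ennreal \<bar>u (x + z)\<bar> + ?S x z"
    have "ennreal (V * \<bar>u x\<bar>) = (\<integral>\<^sup>+z. ennreal \<bar>u x\<bar> * indicator (ball 0 1) (z::real^'n) \<partial>lborel)"
      using V by (simp add: nn_integral_cmult emeasure_ball V_def ennreal_mult mult.commute)
    also have "\<dots> \<le> (\<integral>\<^sup>+z. ennreal \<bar>u (x + z)\<bar> * indicator (ball 0 1) z + indicator (ball 0 1) z * ?S x z \<partial>lborel)"
      using * by (intro nn_integral_mono_AE, eventually_elim) (auto simp: indicator_def)
    also have "\<dots> = (\<integral>\<^sup>+z. ennreal \<bar>u (x + z)\<bar> * indicator (ball 0 1) z \<partial>lborel) + (\<integral>\<^sup>+z. indicator (ball 0 1) z * ?S x z \<partial>lborel)"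
      by (intro nn_integral_add) measurable
    also have "\<dots> \<le> (\<integral>\<^sup>+w. ennreal (k w * \<bar>u (x + w)\<bar>) \<partial>lborel) + (\<integral>\<^sup>+w. ennreal (k w * norm (g (x + w))) \<partial>lborel)"
    proof (rule add_mono)
      \<comment> \<open>The kernel is at least 1 on the punctured unit ball, so the plain average of
        |u| fits into the same potential as the gradient term.\<close>
      show "(\<integral>\<^sup>+z. ennreal \<bar>u (x + z)\<bar> * indicator (ball 0 1) z \<partial>lborel) \<le> (\<integral>\<^sup>+w. ennreal (k w * \<bar>u (x + w)\<bar>) \<partial>lborel)"
      proof (rule nn_integral_mono_AE, rule AE_mp[OF AE_lborel_singleton[of 0] AE_I2], rule impI)
        fix z :: "real^'n" assume z: "z \<noteq> 0"
        show "ennreal \<bar>u (x + z)\<bar> * indicator (ball 0 1) z \<le> ennreal (k z * \<bar>u (x + z)\<bar>)"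
        proof (cases "norm z < 1")
          case True
          have "norm z powr (?N - 1) \<le> 1" using True N by (intro powr_le1) auto
          then have "1 \<le> norm z powr (- (?N - 1))"
            using z unfolding powr_minus by (intro one_le_inverse) auto
          then have "1 * \<bar>u (x + z)\<bar> \<le> k z * \<bar>u (x + z)\<bar>"
            using True by (intro mult_right_mono) (auto simp: k_def)
          then show ?thesis using True by (simp add: ennreal_leI)
        qed (auto simp: indicator_def)
      qed
      show "(\<integral>\<^sup>+z. indicator (ball 0 1) z * ?S x z \<partial>lborel) \<le> (\<integral>\<^sup>+w. ennreal (k w * norm (g (x + w))) \<partial>lborel)"
        using nn_integral_segment_average_le[of "\<lambda>x. norm (g x)" x] by (simp add: k_def)
    qed
    also have "\<dots> = (\<integral>\<^sup>+w. ennreal (k w * \<bar>u (x + w)\<bar>) + ennreal (k w * norm (g (x + w))) \<partial>lborel)"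
      by (intro nn_integral_add[symmetric]) measurable
    also have "\<dots> = (\<integral>\<^sup>+w. ennreal (k w * G (x + w)) \<partial>lborel)"
      by (intro nn_integral_cong) (simp add: G_def k_def distrib_left flip: ennreal_plus)
    finally show "ennreal (V * \<bar>u x\<bar>) \<le> (\<integral>\<^sup>+w. ennreal (k w * G (x + w)) \<partial>lborel)" .
  qed
  define r where "r = 1 / (1 / 2 + 1 / q)"
  have rpos: "1 / 2 + 1 / q > 0" using q by (simp add: add_pos_pos)
  have "(\<integral>\<^sup>+x. ennreal ((V * \<bar>u x\<bar>) powr q) \<partial>lborel) < \<infinity>"
  proof (rule young_power_finite[where G=G and k=k and r=r, OF _ _ _ _ _ _ q(1) _ _ _ le])
    show "r * (1 / 2 + 1 / q) = 1" using rpos by (simp add: r_def)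
    have "?N - 1 < ?N * (1 / 2 + 1 / q)" using q(2) N by (simp add: field_simps)
    then have "r * (?N - 1) < real DIM(real^'n)" using rpos by (simp add: r_def field_simps)
    then have "(\<integral>\<^sup>+x. ennreal (norm x powr - (r * (?N - 1))) * indicator (ball 0 1) (x::real^'n) \<partial>lborel) < \<infinity>"
      by (rule nn_integral_norm_powr_ball_finite)
    also have "(\<integral>\<^sup>+x. ennreal (norm x powr - (r * (?N - 1))) * indicator (ball 0 1) (x::real^'n) \<partial>lborel) = (\<integral>\<^sup>+x. ennreal (k x powr r) \<partial>lborel)"
      by (intro nn_integral_cong) (auto simp: k_def indicator_def powr_powr algebra_simps)
    finally show "(\<integral>\<^sup>+x. ennreal (k x powr r) \<partial>lborel) < \<infinity>" .
    have "integrable lborel (\<lambda>x. ?q x)"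
      using u2 g2 by (intro Bochner_Integration.integrable_add integrable_mult_right Bochner_Integration.integrable_sum)
    moreover have "(\<lambda>x. (G x)\<^sup>2) \<in> borel_measurable lborel" by measurable
    moreover have "AE x in lborel. norm ((G x)\<^sup>2) \<le> norm (?q x)"
    proof (rule AE_I2)
      fix x
      have "(norm (g x))\<^sup>2 = (\<Sum>i\<in>UNIV. (g x $ i)\<^sup>2)" by (simp add: norm_vec_def L2_set_def sum_nonneg)
      moreover have "(a + b)\<^sup>2 \<le> 2 * a\<^sup>2 + 2 * b\<^sup>2" for a b :: real
        using zero_le_power2[of "a - b"] by (simp add: power2_eq_square algebra_simps)
      from this[of "\<bar>u x\<bar>" "norm (g x)"] have "(G x)\<^sup>2 \<le> 2 * (u x)\<^sup>2 + 2 * (norm (g x))\<^sup>2" by (simp add: G_def)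
      ultimately show "norm ((G x)\<^sup>2) \<le> norm (?q x)" by (simp add: sum_nonneg)
    qed
    ultimately have "integrable lborel (\<lambda>x. (G x)\<^sup>2)"
      by (rule Bochner_Integration.integrable_bound)
    then show "(\<integral>\<^sup>+x. ennreal ((G x)\<^sup>2) \<partial>lborel) < \<infinity>" unfolding integrable_iff_bounded by simp
  qed (use V in \<open>auto simp: G_def k_def\<close>)
  also have "(\<integral>\<^sup>+x. ennreal ((V * \<bar>u x\<bar>) powr q) \<partial>lborel) = ennreal (V powr q) * (\<integral>\<^sup>+x. ennreal (\<bar>u x\<bar> powr q) \<partial>lborel)"
    using V by (subst nn_integral_cmult[symmetric]) (auto simp: powr_mult ennreal_mult)
  finally show ?thesis using V by (auto simp: ennreal_mult_less_top)
qed

section \<open>The functionals on the Sobolev space\<close>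

definition kinetic :: "real \<Rightarrow> (real^'n::finite \<Rightarrow> real) \<Rightarrow> real" where
  "kinetic \<tau> u = (\<integral>x. (norm (wgrad u x))\<^sup>2 + \<tau> * (u x)\<^sup>2 \<partial>lebesgue)"

text \<open>This is D(u,v) of the overview, and \<open>kinetic\<close> is Q. As a Bochner integral
  it would also be 0 for a divergent double integral; finite Riesz energies exclude this on
  \<open>H1\<close>.\<close>

definition interaction :: "real \<Rightarrow> real \<Rightarrow> (real^'n::finite \<Rightarrow> real) \<Rightarrow> (real^'n \<Rightarrow> real) \<Rightarrow> real" where
  "interaction \<alpha> p u v = (\<integral>x. riesz_conv \<alpha> (\<lambda>y. \<bar>u y\<bar> powr p) x * \<bar>v x\<bar> powr p \<partial>lebesgue)"

text \<open>Completeness of \<open>lebesgue\<close>: preimages under \<open>u\<close> and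
  \<open>v\<close> differ only inside a null set.\<close>

lemma measurable_lebesgue_AE_cong:
  fixes u v :: "'a::euclidean_space \<Rightarrow> real"
  assumes u: "u \<in> borel_measurable lebesgue" and ae: "AE x in lebesgue. u x = v x"
  shows "v \<in> borel_measurable lebesgue"
proof (rule measurableI)
  fix A :: "real set" assume A: "A \<in> sets borel"
  show "v -` A \<inter> space lebesgue \<in> sets lebesgue"
  proof (rule completion.in_sets_AE)
    show "u -` A \<inter> space lebesgue \<in> sets lebesgue" using measurable_sets[OF u A] .
    show "AE x in lebesgue. (x \<in> u -` A \<inter> space lebesgue) = (x \<in> v -` A \<inter> space lebesgue)"
      using ae by eventually_elim auto
  qed auto
qed auto

lemma lebesgue_borel_representative:
  fixes u :: "'a::euclidean_space \<Rightarrow> real"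
  assumes "u \<in> borel_measurable lebesgue"
  obtains u' where "u' \<in> borel_measurable borel" "AE x in lebesgue. u x = u' x"
  using completion_ex_borel_measurable_real[OF assms] by (auto simp: AE_completion_iff)

lemma integral_lebesgue_eq_lborel:
  fixes f g :: "'a::euclidean_space \<Rightarrow> real"
  assumes "f \<in> borel_measurable lebesgue" "g \<in> borel_measurable borel" "AE x in lebesgue. f x = g x"
  shows "(\<integral>x. f x \<partial>lebesgue) = (\<integral>x. g x \<partial>lborel)"
proof -
  have "g \<in> borel_measurable lebesgue" using assms(2) by (intro measurable_completion) simp
  then have "(\<integral>x. f x \<partial>lebesgue) = (\<integral>x. g x \<partial>lebesgue)" using assms by (intro integral_cong_AE)
  then show ?thesis using assms(2) by (simp add: integral_completion)
qed

lemma integrable_lebesgue_iff_lborel: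
  fixes f g :: "'a::euclidean_space \<Rightarrow> real"
  assumes "f \<in> borel_measurable lebesgue" "g \<in> borel_measurable borel" "AE x in lebesgue. f x = g x"
  shows "integrable lebesgue f \<longleftrightarrow> integrable lborel g"
proof -
  have "g \<in> borel_measurable lebesgue" using assms(2) by (intro measurable_completion) simp
  then have "integrable lebesgue f \<longleftrightarrow> integrable lebesgue g" using assms by (intro integrable_cong_AE)
  then show ?thesis using assms(2) by (simp add: integrable_completion)
qed

lemma borel_imp_lebesgue_measurable: "f \<in> borel_measurable borel \<Longrightarrow> f \<in> borel_measurable lebesgue"
  by (intro measurable_completion) simp

lemma continuous_partial_deriv_test_fun:
  assumes "test_fun \<phi>"
  shows "continuous_on UNIV \<phi>" "continuous_on UNIV (partial_deriv i \<phi>)"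
proof -
  obtain S where S: "\<phi> \<in> S" "\<And>g x. g \<in> S \<Longrightarrow> g differentiable (at x)"
    "\<And>g i. g \<in> S \<Longrightarrow> (\<lambda>x. frechet_derivative g (at x) (axis i 1)) \<in> S"
    using assms unfolding test_fun_def smooth_fun_def by blast
  have c: "continuous_on UNIV g" if "g \<in> S" for g
    using S(2)[OF that] by (simp add: continuous_on_eq_continuous_at differentiable_imp_continuous_within)
  show "continuous_on UNIV \<phi>" using c S(1) by blast
  show "continuous_on UNIV (partial_deriv i \<phi>)"
    using c[OF S(3)[OF S(1)]] by (simp add: partial_deriv_def[abs_def])
qed

lemma weak_gradient_cong_AE:
  assumes u: "u \<in> borel_measurable lebesgue" and ae: "AE x in lebesgue. u x = v x"
  shows "weak_gradient u g \<longleftrightarrow> weak_gradient v g"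
proof -
  note v = measurable_lebesgue_AE_cong[OF assms]
  have "(\<integral>x. u x * partial_deriv i \<phi> x \<partial>lebesgue) = (\<integral>x. v x * partial_deriv i \<phi> x \<partial>lebesgue)" if "test_fun \<phi>" for \<phi> i
  proof -
    have "partial_deriv i \<phi> \<in> borel_measurable lebesgue"
      by (intro borel_imp_lebesgue_measurable borel_measurable_continuous_onI continuous_partial_deriv_test_fun that)
    then show ?thesis using u v ae by (intro integral_cong_AE) (auto elim: eventually_mono)
  qed
  then show ?thesis unfolding weak_gradient_def by auto
qed

lemma L2_cong_AE:
  assumes "L2 u" and ae: "AE x in lebesgue. u x = v x"
  shows "L2 v"
proof -
  have u: "u \<in> borel_measurable lebesgue" using assms by (simp add: L2_def)
  note v = measurable_lebesgue_AE_cong[OF u ae]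
  have "integrable lebesgue (\<lambda>x. (v x)\<^sup>2) \<longleftrightarrow> integrable lebesgue (\<lambda>x. (u x)\<^sup>2)"
    using u v ae by (intro integrable_cong_AE) (auto elim: eventually_mono)
  then show ?thesis using assms v by (simp add: L2_def)
qed

text \<open>\<open>weak_gradient\<close> sees the function only through integrals, so u and v have
  the same weak gradients, and the choice operator returns literally the same function for
  both.\<close>

lemma H1_cong_AE:
  assumes "u \<in> H1" and ae: "AE x in lebesgue. u x = v x"
  shows "v \<in> H1" "wgrad v = wgrad u"
proof -
  have L2: "L2 u" using assms by (simp add: H1_def)
  then have u: "u \<in> borel_measurable lebesgue" by (simp add: L2_def)
  have eq: "weak_gradient v g \<longleftrightarrow> weak_gradient u g" for g using weak_gradient_cong_AE[OF u ae] by simp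
  show "v \<in> H1" using assms L2_cong_AE[OF L2 ae] by (simp add: H1_def eq)
  show "wgrad v = wgrad u" by (simp add: wgrad_def eq)
qed

lemma wgrad_H1:
  assumes "u \<in> H1"
  shows "L2 (\<lambda>x. wgrad u x $ i)" "weak_gradient u (wgrad u)" "L2 u"
proof -
  have "\<exists>g. (\<forall>i. L2 (\<lambda>x. g x $ i)) \<and> weak_gradient u g" using assms by (simp add: H1_def)
  then have "(\<forall>i. L2 (\<lambda>x. wgrad u x $ i)) \<and> weak_gradient u (wgrad u)" unfolding wgrad_def by (rule someI_ex)
  then show "L2 (\<lambda>x. wgrad u x $ i)" "weak_gradient u (wgrad u)" by auto
  show "L2 u" using assms by (simp add: H1_def)
qed

text \<open>Controls the choice in \<open>wgrad\<close>: the gradient chosen for a multiple of u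
  need not be that multiple of the gradient chosen for u, but the two agree almost everywhere.
  Components are compared through bumps on Borel representatives.\<close>

lemma weak_gradient_unique:
  fixes g h :: "real^'n::finite \<Rightarrow> real^'n"
  assumes g: "weak_gradient u g" "\<And>i. L2 (\<lambda>x. g x $ i)" and h: "weak_gradient u h" "\<And>i. L2 (\<lambda>x. h x $ i)"
  shows "AE x in lebesgue. g x = h x"
proof -
  have "AE x in lebesgue. g x $ i = h x $ i" for i
  proof -
    have gm: "(\<lambda>x. g x $ i) \<in> borel_measurable lebesgue" and hm: "(\<lambda>x. h x $ i) \<in> borel_measurable lebesgue"
      using g(2)[of i] h(2)[of i] by (auto simp: L2_def)
    obtain g' where g': "g' \<in> borel_measurable borel" "AE x in lebesgue. g x $ i = g' x"
      using lebesgue_borel_representative[OF gm] .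
    obtain h' where h': "h' \<in> borel_measurable borel" "AE x in lebesgue. h x $ i = h' x"
      using lebesgue_borel_representative[OF hm] .
    note [measurable] = g'(1) h'(1)
    have g2: "integrable lborel (\<lambda>x. (g' x)\<^sup>2)"
    proof -
      have "AE x in lebesgue. (g x $ i)\<^sup>2 = (g' x)\<^sup>2" using g'(2) by eventually_elim simp
      moreover have "integrable lebesgue (\<lambda>x. (g x $ i)\<^sup>2)" using g(2)[of i] by (simp add: L2_def)
      ultimately show ?thesis
        using integrable_lebesgue_iff_lborel[of "\<lambda>x. (g x $ i)\<^sup>2" "\<lambda>x. (g' x)\<^sup>2"] gm by auto
    qed
    have h2: "integrable lborel (\<lambda>x. (h' x)\<^sup>2)"
    proof -
      have "AE x in lebesgue. (h x $ i)\<^sup>2 = (h' x)\<^sup>2" using h'(2) by eventually_elim simp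
      moreover have "integrable lebesgue (\<lambda>x. (h x $ i)\<^sup>2)" using h(2)[of i] by (simp add: L2_def)
      ultimately show ?thesis
        using integrable_lebesgue_iff_lborel[of "\<lambda>x. (h x $ i)\<^sup>2" "\<lambda>x. (h' x)\<^sup>2"] hm by auto
    qed
    have "AE x in lborel. g' x - h' x = 0"
    proof (rule AE_zero_if_bump_integrals_zero)
      have int: "integrable lborel (\<lambda>x. f x * \<phi> x)"
        if [measurable]: "f \<in> borel_measurable borel" "\<phi> \<in> borel_measurable borel" and f2: "integrable lborel (\<lambda>x. (f x)\<^sup>2)" and \<phi>: "\<And>x. \<bar>\<phi> x\<bar> \<le> 1" "\<And>x. x \<notin> cbox a b \<Longrightarrow> \<phi> x = 0"
        for f \<phi> :: "real^'n \<Rightarrow> real" and a b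
        using f2 integrable_square_bounded_on_cbox[where f=\<phi> and B=1 and a=a and b=b] \<phi> by (intro integrable_mult_L2) auto
      show "integrable lborel (\<lambda>x. (g' x - h' x) * indicator (box a b) x)" for a b
        unfolding left_diff_distrib
        by (intro Bochner_Integration.integrable_diff int[where a=a and b=b] g2 h2) (auto simp: indicator_def box_subset_cbox[THEN subsetD])
      show "(\<integral>x. (g' x - h' x) * bump n a b x \<partial>lborel) = 0" for n a b
      proof -
        have b1: "\<bar>bump n a b x\<bar> \<le> 1" "x \<notin> cbox a b \<Longrightarrow> bump n a b x = 0" for x
          using bump_bounds[of n a b x] bump_eq_0[of x a b n] box_subset_cbox[of a b] by auto
        have "(\<integral>x. g x $ i * bump n a b x \<partial>lebesgue) = (\<integral>x. h x $ i * bump n a b x \<partial>lebesgue)"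
        proof -
          have "(\<integral>x. u x * partial_deriv i (bump n a b) x \<partial>lebesgue) = - (\<integral>x. g x $ i * bump n a b x \<partial>lebesgue)"
            "(\<integral>x. u x * partial_deriv i (bump n a b) x \<partial>lebesgue) = - (\<integral>x. h x $ i * bump n a b x \<partial>lebesgue)"
            using g(1) h(1) test_fun_bump[of n a b] unfolding weak_gradient_def by blast+
          then show ?thesis by linarith
        qed
        moreover have "bump n a b \<in> borel_measurable lebesgue" by (intro borel_imp_lebesgue_measurable) measurable
        then have "(\<integral>x. g x $ i * bump n a b x \<partial>lebesgue) = (\<integral>x. g' x * bump n a b x \<partial>lborel)"
           "(\<integral>x. h x $ i * bump n a b x \<partial>lebesgue) = (\<integral>x. h' x * bump n a b x \<partial>lborel)"
          using gm hm by (intro integral_lebesgue_eq_lborel AE_mp[OF g'(2) AE_I2] AE_mp[OF h'(2) AE_I2]; simp)+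
        moreover have "(\<integral>x. (g' x - h' x) * bump n a b x \<partial>lborel) = (\<integral>x. g' x * bump n a b x \<partial>lborel) - (\<integral>x. h' x * bump n a b x \<partial>lborel)"
          unfolding left_diff_distrib
          by (intro Bochner_Integration.integral_diff int[where a=a and b=b] g2 h2 b1) measurable
        ultimately show ?thesis by simp
      qed
    qed measurable
    then have "AE x in lebesgue. g' x - h' x = 0" by (simp add: AE_completion_iff)
    with g'(2) h'(2) show ?thesis by eventually_elim simp
  qed
  then have "AE x in lebesgue. \<forall>i\<in>UNIV. g x $ i = h x $ i" by (intro AE_finite_allI) auto
  then show ?thesis by eventually_elim (simp add: vec_eq_iff)
qed

section \<open>Scaling of the two energies\<close>

lemma wgrad_scale:
  fixes u :: "real^'n::finite \<Rightarrow> real"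
  assumes u: "u \<in> H1"
  shows "(\<lambda>x. c * u x) \<in> H1" "AE x in lebesgue. wgrad (\<lambda>x. c * u x) x = c *\<^sub>R wgrad u x"
proof -
  have L2c: "L2 (\<lambda>x. c * f x)" if "L2 f" for f :: "real^'n \<Rightarrow> real"
    using that by (auto simp: L2_def power_mult_distrib)
  have wg: "weak_gradient (\<lambda>x. c * u x) (\<lambda>x. c *\<^sub>R wgrad u x)"
    using wgrad_H1(2)[OF u] unfolding weak_gradient_def by (simp add: mult.assoc)
  have L2g: "L2 (\<lambda>x. (c *\<^sub>R wgrad u x) $ i)" for i using L2c[OF wgrad_H1(1)[OF u]] by simp
  show H: "(\<lambda>x. c * u x) \<in> H1"
    unfolding H1_def by (intro CollectI conjI exI allI) (rule L2c[OF wgrad_H1(3)[OF u]] L2g wg)+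
  show "AE x in lebesgue. wgrad (\<lambda>x. c * u x) x = c *\<^sub>R wgrad u x"
    by (rule weak_gradient_unique[OF wgrad_H1(2)[OF H] wgrad_H1(1)[OF H] wg L2g])
qed

lemma norm_sq_vec: "(norm (x::real^'n::finite))\<^sup>2 = (\<Sum>i\<in>UNIV. (x $ i)\<^sup>2)"
  by (simp add: norm_vec_def L2_set_def sum_nonneg)

lemma integrable_H1:
  assumes "u \<in> H1"
  shows "integrable lebesgue (\<lambda>x. (norm (wgrad u x))\<^sup>2)" "integrable lebesgue (\<lambda>x. (u x)\<^sup>2)"
  using wgrad_H1[OF assms] unfolding norm_sq_vec by (auto simp: L2_def)

lemma integrable_kinetic:
  "u \<in> H1 \<Longrightarrow> integrable lebesgue (\<lambda>x. (norm (wgrad u x))\<^sup>2 + \<tau> * (u x)\<^sup>2)"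
  by (intro Bochner_Integration.integrable_add integrable_mult_right integrable_H1)

lemma kinetic_scale:
  assumes u: "u \<in> H1"
  shows "kinetic \<tau> (\<lambda>x. c * u x) = c\<^sup>2 * kinetic \<tau> u"
proof -
  have "kinetic \<tau> (\<lambda>x. c * u x) = (\<integral>x. c\<^sup>2 * ((norm (wgrad u x))\<^sup>2 + \<tau> * (u x)\<^sup>2) \<partial>lebesgue)"
    unfolding kinetic_def
  proof (rule integral_cong_AE)
    show "(\<lambda>x. (norm (wgrad (\<lambda>x. c * u x) x))\<^sup>2 + \<tau> * (c * u x)\<^sup>2) \<in> borel_measurable lebesgue"
      by (intro borel_measurable_integrable integrable_kinetic wgrad_scale u)
    show "(\<lambda>x. c\<^sup>2 * ((norm (wgrad u x))\<^sup>2 + \<tau> * (u x)\<^sup>2)) \<in> borel_measurable lebesgue"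
      by (intro borel_measurable_integrable integrable_mult_right integrable_kinetic u)
    show "AE x in lebesgue. (norm (wgrad (\<lambda>x. c * u x) x))\<^sup>2 + \<tau> * (c * u x)\<^sup>2 = c\<^sup>2 * ((norm (wgrad u x))\<^sup>2 + \<tau> * (u x)\<^sup>2)"
      using wgrad_scale(2)[OF u, of c] by eventually_elim (simp add: power_mult_distrib algebra_simps)
  qed
  then show ?thesis by (simp add: kinetic_def)
qed

lemma kinetic_nonneg: "\<tau> \<ge> 0 \<Longrightarrow> kinetic \<tau> u \<ge> 0"
  unfolding kinetic_def by (intro Bochner_Integration.integral_nonneg) auto

lemma kinetic_pos:
  assumes "\<tau> > 0" "u \<in> H1" "nonzero_fun u"
  shows "kinetic \<tau> u > 0"
proof (rule ccontr)
  assume "\<not> ?thesis"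
  then have "kinetic \<tau> u = 0" using kinetic_nonneg[of \<tau> u] assms(1) by simp
  moreover have "integrable lebesgue (\<lambda>x. (norm (wgrad u x))\<^sup>2 + \<tau> * (u x)\<^sup>2)"
    by (rule integrable_kinetic[OF assms(2)])
  ultimately have "AE x in lebesgue. (norm (wgrad u x))\<^sup>2 + \<tau> * (u x)\<^sup>2 = 0"
    unfolding kinetic_def using assms(1) by (subst (asm) integral_nonneg_eq_0_iff_AE) auto
  then have "AE x in lebesgue. u x = 0"
    by eventually_elim (use assms(1) in \<open>auto simp: add_nonneg_eq_0_iff\<close>)
  then show False using assms(3) by (simp add: nonzero_fun_def)
qed

lemma kinetic_cong_AE:
  assumes "u \<in> H1" and ae: "AE x in lebesgue. u x = v x"
  shows "kinetic \<tau> v = kinetic \<tau> u"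
  unfolding kinetic_def
proof (rule integral_cong_AE)
  note v = H1_cong_AE[OF assms]
  show "(\<lambda>x. (norm (wgrad v x))\<^sup>2 + \<tau> * (v x)\<^sup>2) \<in> borel_measurable lebesgue"
     "(\<lambda>x. (norm (wgrad u x))\<^sup>2 + \<tau> * (u x)\<^sup>2) \<in> borel_measurable lebesgue"
    by (intro borel_measurable_integrable integrable_kinetic v(1) assms(1))+
  show "AE x in lebesgue. (norm (wgrad v x))\<^sup>2 + \<tau> * (v x)\<^sup>2 = (norm (wgrad u x))\<^sup>2 + \<tau> * (u x)\<^sup>2"
    using ae by eventually_elim (simp add: v(2))
qed

lemma interaction_scale:
  "interaction \<alpha> p (\<lambda>x. c * u x) (\<lambda>x. d * v x) = \<bar>c\<bar> powr p * \<bar>d\<bar> powr p * interaction \<alpha> p u v"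
proof -
  have "riesz_conv \<alpha> (\<lambda>y. \<bar>c * u y\<bar> powr p) x = \<bar>c\<bar> powr p * riesz_conv \<alpha> (\<lambda>y. \<bar>u y\<bar> powr p) x" for x
    unfolding riesz_conv_def by (simp add: abs_mult powr_mult mult.left_commute[of _ "\<bar>c\<bar> powr p"])
  then show ?thesis
    unfolding interaction_def by (simp add: abs_mult powr_mult flip: integral_mult_right_zero) (simp add: mult_ac)
qed

section \<open>The functionals along rays and their Nehari sets\<close>

lemma Jfun_eq:
  assumes "u \<in> H1" "v \<in> H1"
  shows "Jfun \<tau> \<alpha> p u v = 1/2 * (kinetic \<tau> u + kinetic \<tau> v) - 1/p * interaction \<alpha> p u v"
proof -
  have "kinetic \<tau> u + kinetic \<tau> v = (\<integral>x. ((norm (wgrad u x))\<^sup>2 + \<tau> * (u x)\<^sup>2) + ((norm (wgrad v x))\<^sup>2 + \<tau> * (v x)\<^sup>2) \<partial>lebesgue)"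
    unfolding kinetic_def
    by (intro Bochner_Integration.integral_add[symmetric] integrable_kinetic assms)
  then show ?thesis unfolding Jfun_def interaction_def by (simp add: algebra_simps)
qed

lemma Afun_eq: "Afun \<tau> \<alpha> p u = 1/2 * kinetic \<tau> u - 1/(2*p) * interaction \<alpha> p u u"
  by (simp add: Afun_def kinetic_def interaction_def)

text \<open>Along a ray both functionals have this shape, a quadratic term minus one of degree 2p.
  Its derivative turns the Nehari conditions into algebraic identities between Q and D.\<close>

lemma deriv_fibering:
  fixes p a b :: real
  shows "deriv (\<lambda>t. a * (1 + t)\<^sup>2 - b * (\<bar>1 + t\<bar> powr p * \<bar>1 + t\<bar> powr p)) 0 = 2 * a - 2 * p * b"
proof (rule DERIV_imp_deriv)
  have "((\<lambda>t. a * (1 + t)\<^sup>2 - b * (1 + t) powr (2 * p)) has_real_derivative 2 * a - 2 * p * b) (at 0)"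
    by (auto intro!: derivative_eq_intros)
  moreover have "\<forall>\<^sub>F t in nhds 0. a * (1 + t)\<^sup>2 - b * (\<bar>1 + t\<bar> powr p * \<bar>1 + t\<bar> powr p) = a * (1 + t)\<^sup>2 - b * (1 + t) powr (2 * p)"
  \<comment> \<open>The absolute values disappear for t > -1, a neighbourhood of 0, and the
    derivative depends on nothing else.\<close>
  proof -
    have "\<forall>\<^sub>F t in nhds 0. t \<in> {-1::real<..}" by (intro eventually_nhds_in_open) auto
    then show ?thesis by eventually_elim (simp flip: powr_add)
  qed
  ultimately show "((\<lambda>t. a * (1 + t)\<^sup>2 - b * (\<bar>1 + t\<bar> powr p * \<bar>1 + t\<bar> powr p)) has_real_derivative 2 * a - 2 * p * b) (at 0)"
    by (subst DERIV_cong_ev) auto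
qed

lemma nehari_J_iff:
  assumes p: "p > 0"
  shows "(u, v) \<in> nehari_J \<tau> \<alpha> p \<longleftrightarrow> u \<in> H1 \<and> v \<in> H1 \<and> (nonzero_fun u \<or> nonzero_fun v) \<and> kinetic \<tau> u + kinetic \<tau> v = 2 * interaction \<alpha> p u v"
proof -
  have "deriv (\<lambda>t::real. Jfun \<tau> \<alpha> p (\<lambda>x. (1 + t) * u x) (\<lambda>x. (1 + t) * v x)) 0 = kinetic \<tau> u + kinetic \<tau> v - 2 * interaction \<alpha> p u v"
    if "u \<in> H1" "v \<in> H1"
  proof -
    have "Jfun \<tau> \<alpha> p (\<lambda>x. (1 + t) * u x) (\<lambda>x. (1 + t) * v x) =
       (1/2 * (kinetic \<tau> u + kinetic \<tau> v)) * (1 + t)\<^sup>2 - (1/p * interaction \<alpha> p u v) * (\<bar>1 + t\<bar> powr p * \<bar>1 + t\<bar> powr p)" for t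
      by (simp only: Jfun_eq[OF wgrad_scale(1)[OF that(1)] wgrad_scale(1)[OF that(2)]] kinetic_scale[OF that(1)] kinetic_scale[OF that(2)] interaction_scale) (simp add: algebra_simps)
    then show ?thesis using p by (simp only: deriv_fibering) simp
  qed
  then show ?thesis unfolding nehari_J_def by auto
qed

lemma nehari_A_iff:
  assumes p: "p > 0"
  shows "u \<in> nehari_A \<tau> \<alpha> p \<longleftrightarrow> u \<in> H1 \<and> nonzero_fun u \<and> kinetic \<tau> u = interaction \<alpha> p u u"
proof -
  have "deriv (\<lambda>t::real. Afun \<tau> \<alpha> p (\<lambda>x. (1 + t) * u x)) 0 = kinetic \<tau> u - interaction \<alpha> p u u" if "u \<in> H1"
  proof -
    have "Afun \<tau> \<alpha> p (\<lambda>x. (1 + t) * u x) =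
       (1/2 * kinetic \<tau> u) * (1 + t)\<^sup>2 - (1/(2*p) * interaction \<alpha> p u u) * (\<bar>1 + t\<bar> powr p * \<bar>1 + t\<bar> powr p)" for t
      by (simp only: Afun_eq kinetic_scale[OF that] interaction_scale) (simp add: algebra_simps)
    then show ?thesis using p by (simp only: deriv_fibering) simp
  qed
  then show ?thesis unfolding nehari_A_def by auto
qed

section \<open>The interaction as a finite Riesz energy\<close>

definition subcritical :: "'n::finite itself \<Rightarrow> real \<Rightarrow> real \<Rightarrow> bool" where
  "subcritical _ \<alpha> p \<longleftrightarrow> 0 < \<alpha> \<and> \<alpha> < real CARD('n) \<and> 1 + \<alpha> / real CARD('n) < p \<and>
     (CARD('n) \<ge> 3 \<longrightarrow> p < (real CARD('n) + \<alpha>) / (real CARD('n) - 2))"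

definition riesz_const :: "'n::finite itself \<Rightarrow> real \<Rightarrow> real" where
  "riesz_const _ \<alpha> = Gamma ((real CARD('n) - \<alpha>) / 2) / (Gamma (\<alpha> / 2) * pi powr (real CARD('n) / 2) * 2 powr \<alpha>)"

lemma riesz_const_pos: "0 < \<alpha> \<Longrightarrow> \<alpha> < real CARD('n) \<Longrightarrow> riesz_const TYPE('n::finite) \<alpha> > 0"
  unfolding riesz_const_def by (intro divide_pos_pos mult_pos_pos Gamma_real_pos) auto

lemma riesz_eq: "riesz \<alpha> (x::real^'n::finite) = riesz_const TYPE('n) \<alpha> * norm x powr (- 2 * ((real CARD('n) - \<alpha>) / 2))"
proof -
  have "- 2 * ((real CARD('n) - \<alpha>) / 2) = - (real CARD('n) - \<alpha>)" by simp
  then show ?thesis by (simp only: riesz_def riesz_const_def Let_def)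
qed

lemma lebesgue_measurable_abs_powr:
  fixes u :: "'a::euclidean_space \<Rightarrow> real"
  assumes [measurable]: "u \<in> borel_measurable lebesgue"
  shows "(\<lambda>x. \<bar>u x\<bar> powr p) \<in> borel_measurable lebesgue"
  by measurable

lemma subcritical_p: "subcritical TYPE('n::finite) \<alpha> p \<Longrightarrow> p > 1"
  unfolding subcritical_def by (smt (verit) divide_pos_pos of_nat_0_less_iff zero_less_card_finite)

text \<open>The second function comes first in the energy because its variable is the outer one. The
  obstacle is that \<open>riesz_conv\<close> is a real number even where the inner integral
  diverges; finite energy makes such points harmless.\<close>

lemma interaction_eq_riesz_energy:
  fixes u v u' v' :: "real^'n::finite \<Rightarrow> real"
  assumes \<alpha>: "0 < \<alpha>" "\<alpha> < real CARD('n)"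
    and u: "u \<in> borel_measurable lebesgue" and v: "v \<in> borel_measurable lebesgue"
    and [measurable]: "u' \<in> borel_measurable borel" "v' \<in> borel_measurable borel"
    and uu': "AE x in lebesgue. u x = u' x" and vv': "AE x in lebesgue. v x = v' x"
    and fin: "riesz_energy ((real CARD('n) - \<alpha>) / 2) (\<lambda>x. \<bar>v' x\<bar> powr p) (\<lambda>x. \<bar>u' x\<bar> powr p) < \<infinity>"
  shows "interaction \<alpha> p u v = riesz_const TYPE('n) \<alpha> * enn2real (riesz_energy ((real CARD('n) - \<alpha>) / 2) (\<lambda>x. \<bar>v' x\<bar> powr p) (\<lambda>x. \<bar>u' x\<bar> powr p))"
proof -
  let ?q = "\<lambda>x y. ennreal (riesz_const TYPE('n) \<alpha>) * (ennreal (norm (x - y :: real^'n) powr (- 2 * ((real CARD('n) - \<alpha>) / 2))) * (ennreal (\<bar>v' x\<bar> powr p) * ennreal (\<bar>u' y\<bar> powr p)))"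
  let ?k = "\<lambda>x y. norm (x - y :: real^'n) powr (- 2 * ((real CARD('n) - \<alpha>) / 2))"
  let ?f = "\<lambda>y. ennreal (\<bar>u' y\<bar> powr p)"
  let ?g = "\<lambda>x. ennreal (\<bar>v' x\<bar> powr p)"
  let ?s = "(real CARD('n) - \<alpha>) / 2"
  let ?c = "riesz_const TYPE('n) \<alpha>"
  let ?E = "riesz_energy ?s (\<lambda>x. ?g x) (\<lambda>x. ennreal (\<bar>u' x\<bar> powr p))"
  have c: "?c > 0" using riesz_const_pos[OF \<alpha>] .
  define h where "h x = (\<integral>\<^sup>+y. ennreal (?c * ?k x y * \<bar>u' y\<bar> powr p) \<partial>lborel)" for x :: "real^'n"
  have [measurable]: "h \<in> borel_measurable borel" unfolding h_def by measurable
  have rm: "(\<lambda>y. riesz \<alpha> (x - y)) \<in> borel_measurable borel" for x :: "real^'n"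
    unfolding riesz_eq by measurable
  have conv: "riesz_conv \<alpha> (\<lambda>y. \<bar>u y\<bar> powr p) x = enn2real (h x)" for x
  proof -
    have "riesz_conv \<alpha> (\<lambda>y. \<bar>u y\<bar> powr p) x = (\<integral>y. riesz \<alpha> (x - y) * \<bar>u' y\<bar> powr p \<partial>lborel)"
      unfolding riesz_conv_def
    proof (rule integral_lebesgue_eq_lborel)
      show "(\<lambda>y. riesz \<alpha> (x - y) * \<bar>u y\<bar> powr p) \<in> borel_measurable lebesgue"
        using u borel_imp_lebesgue_measurable[OF rm] by (intro borel_measurable_times lebesgue_measurable_abs_powr) auto
      show "(\<lambda>y. riesz \<alpha> (x - y) * \<bar>u' y\<bar> powr p) \<in> borel_measurable borel"
        unfolding riesz_eq by measurable
      show "AE y in lebesgue. riesz \<alpha> (x - y) * \<bar>u y\<bar> powr p = riesz \<alpha> (x - y) * \<bar>u' y\<bar> powr p"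
        using uu' by eventually_elim simp
    qed
    also have "\<dots> = enn2real (\<integral>\<^sup>+y. ennreal (riesz \<alpha> (x - y) * \<bar>u' y\<bar> powr p) \<partial>lborel)"
    proof (rule integral_eq_nn_integral)
      show "(\<lambda>y. riesz \<alpha> (x - y) * \<bar>u' y\<bar> powr p) \<in> borel_measurable lborel"
        using rm[of x] by measurable
    qed (use c in \<open>auto simp: riesz_eq\<close>)
    finally show ?thesis unfolding h_def riesz_eq .
  qed
  have hE: "(\<integral>\<^sup>+x. h x * ?g x \<partial>lborel) = ennreal ?c * ?E"
  proof -
    have "(\<integral>\<^sup>+x. h x * ?g x \<partial>lborel) = (\<integral>\<^sup>+x. (\<integral>\<^sup>+y. ?q x y \<partial>lborel) \<partial>lborel)"
    proof (intro nn_integral_cong)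
      fix x :: "real^'n"
      have "h x * ?g x = (\<integral>\<^sup>+y. ennreal (?c * ?k x y * \<bar>u' y\<bar> powr p) * ?g x \<partial>lborel)"
        unfolding h_def by (rule nn_integral_multc[symmetric]) measurable
      also have "\<dots> = (\<integral>\<^sup>+y. ?q x y \<partial>lborel)"
      proof (intro nn_integral_cong)
        fix y
        show "ennreal (?c * ?k x y * \<bar>u' y\<bar> powr p) * ?g x
          = ?q x y"
          using c by (simp add: ennreal_mult mult_ac)
      qed
      finally show "h x * ?g x = (\<integral>\<^sup>+y. ?q x y \<partial>lborel)" .
    qed
    also have "\<dots> = (\<integral>\<^sup>+x. ennreal ?c * (\<integral>\<^sup>+y. ennreal (?k x y) * (?g x * ?f y) \<partial>lborel) \<partial>lborel)"
      by (intro nn_integral_cong nn_integral_cmult) measurable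
    also have "\<dots> = ennreal ?c * ?E"
      unfolding riesz_energy_def by (intro nn_integral_cmult) measurable
    finally show ?thesis .
  qed
  have "interaction \<alpha> p u v = (\<integral>x. enn2real (h x) * \<bar>v' x\<bar> powr p \<partial>lborel)"
    unfolding interaction_def conv
  proof (rule integral_lebesgue_eq_lborel)
    have "(\<lambda>x. enn2real (h x)) \<in> borel_measurable lebesgue"
      by (rule borel_imp_lebesgue_measurable) measurable
    then show "(\<lambda>x. enn2real (h x) * \<bar>v x\<bar> powr p) \<in> borel_measurable lebesgue"
      using v by (intro borel_measurable_times lebesgue_measurable_abs_powr) auto
    show "AE y in lebesgue. enn2real (h y) * \<bar>v y\<bar> powr p = enn2real (h y) * \<bar>v' y\<bar> powr p"
      using vv' by eventually_elim simp
  qed measurable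
  also have "\<dots> = enn2real (\<integral>\<^sup>+x. ennreal (enn2real (h x) * \<bar>v' x\<bar> powr p) \<partial>lborel)"
    by (rule integral_eq_nn_integral) auto
  also have "(\<integral>\<^sup>+x. ennreal (enn2real (h x) * \<bar>v' x\<bar> powr p) \<partial>lborel) = (\<integral>\<^sup>+x. h x * ?g x \<partial>lborel)"
  proof (rule nn_integral_cong_AE)
    \<comment> \<open>Where \<open>h x\<close> is infinite, \<open>enn2real\<close> replaces it by
      0. Finiteness of the product almost everywhere forces \<open>v' x = 0\<close> at such points,
      so both sides vanish there.\<close>
    have "AE x in lborel. h x * ?g x \<noteq> \<infinity>"
      using fin unfolding hE[symmetric] by (intro nn_integral_PInf_AE) (auto simp: hE ennreal_mult_eq_top_iff)
    then show "AE x in lborel. ennreal (enn2real (h x) * \<bar>v' x\<bar> powr p) = h x * ?g x"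
    proof eventually_elim
      fix x assume *: "h x * ?g x \<noteq> \<infinity>"
      show "ennreal (enn2real (h x) * \<bar>v' x\<bar> powr p) = h x * ?g x"
      proof (cases "h x")
        case (real r)
        then show ?thesis by (simp add: ennreal_mult)
      next
        case top
        then have "\<bar>v' x\<bar> powr p = 0" using * by (auto simp: ennreal_mult_eq_top_iff)
        then show ?thesis by simp
      qed
    qed
  qed
  finally show ?thesis using c unfolding hE by (simp add: enn2real_mult)
qed

text \<open>The analytic estimates are stated for Borel functions and \<open>lborel\<close>. Both u
  and each component of its weak gradient are replaced by Borel representatives, for which the weak
  identity against bumps survives.\<close>

lemma H1_representative:
  fixes u :: "real^'n::finite \<Rightarrow> real"
  assumes adm: "subcritical TYPE('n) \<alpha> p" and u: "u \<in> H1"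
  obtains u' where "u' \<in> borel_measurable borel" "AE x in lebesgue. u x = u' x"
    "riesz_energy ((real CARD('n) - \<alpha>) / 2) (\<lambda>x. \<bar>u' x\<bar> powr p) (\<lambda>x. \<bar>u' x\<bar> powr p) < \<infinity>"
    "(\<integral>\<^sup>+x. ennreal (exp (- (1/2) * (norm x)\<^sup>2)) * ennreal (\<bar>u' x\<bar> powr p) \<partial>lborel) < \<infinity>"
proof -
  have um: "u \<in> borel_measurable lebesgue" and u2: "integrable lebesgue (\<lambda>x. (u x)\<^sup>2)"
    using wgrad_H1(3)[OF u] by (auto simp: L2_def)
  have gm: "(\<lambda>x. wgrad u x $ i) \<in> borel_measurable lebesgue" and g2: "integrable lebesgue (\<lambda>x. (wgrad u x $ i)\<^sup>2)" for i
    using wgrad_H1(1)[OF u, of i] by (auto simp: L2_def)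
  obtain u' where u': "u' \<in> borel_measurable borel" "AE x in lebesgue. u x = u' x"
    using lebesgue_borel_representative[OF um] .
  have "\<forall>i. \<exists>g'. g' \<in> borel_measurable borel \<and> (AE x in lebesgue. wgrad u x $ i = g' x)"
    using lebesgue_borel_representative[OF gm] by metis
  then obtain G where G: "\<And>i. G i \<in> borel_measurable borel" "\<And>i. AE x in lebesgue. wgrad u x $ i = G i x"
    by metis
  define g where "g x = (\<chi> i. G i x)" for x
  have gi: "(\<lambda>x. g x $ i) = G i" for i by (simp add: g_def)
  have sq: "integrable lborel (\<lambda>x. (f' x)\<^sup>2)"
    if "f \<in> borel_measurable lebesgue" "integrable lebesgue (\<lambda>x. (f x)\<^sup>2)" "f' \<in> borel_measurable borel" "AE x in lebesgue. f x = f' x" for f f' :: "real^'n \<Rightarrow> real"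
  proof -
    have "AE x in lebesgue. (f x)\<^sup>2 = (f' x)\<^sup>2" using that(4) by eventually_elim simp
    then show ?thesis using integrable_lebesgue_iff_lborel[of "\<lambda>x. (f x)\<^sup>2" "\<lambda>x. (f' x)\<^sup>2"] that by auto
  qed
  have weak: "(\<integral>x. u' x * partial_deriv i (bump n a b) x \<partial>lborel) = - (\<integral>x. g x $ i * bump n a b x \<partial>lborel)" for n a b i
  proof -
    have b: "bump n a b \<in> borel_measurable borel" "partial_deriv i (bump n a b) \<in> borel_measurable borel" by measurable
    have "(\<integral>x. u x * partial_deriv i (bump n a b) x \<partial>lebesgue) = (\<integral>x. u' x * partial_deriv i (bump n a b) x \<partial>lborel)"
      using um u' b borel_imp_lebesgue_measurable[OF b(2)] by (intro integral_lebesgue_eq_lborel AE_mp[OF u'(2) AE_I2]; simp)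
    moreover have "(\<integral>x. wgrad u x $ i * bump n a b x \<partial>lebesgue) = (\<integral>x. G i x * bump n a b x \<partial>lborel)"
      using gm G(1) b borel_imp_lebesgue_measurable[OF b(1)] by (intro integral_lebesgue_eq_lborel AE_mp[OF G(2)[of i] AE_I2]; simp)
    moreover have "(\<integral>x. u x * partial_deriv i (bump n a b) x \<partial>lebesgue) = - (\<integral>x. wgrad u x $ i * bump n a b x \<partial>lebesgue)"
      using wgrad_H1(2)[OF u] test_fun_bump[of n a b] unfolding weak_gradient_def by blast
    ultimately show ?thesis by (simp add: g_def)
  qed
  have gsq: "integrable lborel (\<lambda>x. (g x $ i)\<^sup>2)" for i
    using sq[OF gm g2 G(1) G(2), of i] by (simp add: g_def)
  have Lq: "(\<integral>\<^sup>+x. ennreal (\<bar>u' x\<bar> powr q) \<partial>lborel) < \<infinity>" if "q > 2" "1 / q > 1 / 2 - 1 / real DIM(real^'n)" for q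
    using that by (intro sobolev_subcritical[OF u'(1) _ sq[OF um u2 u'] gsq weak]) (auto simp: gi G(1))
  have "riesz_energy ((real DIM(real^'n) - \<alpha>) / 2) (\<lambda>x. \<bar>u' x\<bar> powr p) (\<lambda>x. \<bar>u' x\<bar> powr p) < \<infinity>"
    "(\<integral>\<^sup>+x. ennreal (exp (- (1/2) * (norm x)\<^sup>2)) * ennreal (\<bar>u' x\<bar> powr p) \<partial>lborel) < \<infinity>"
    using adm unfolding subcritical_def by (intro riesz_energy_powr_finite[where \<alpha>=\<alpha>, OF u'(1) Lq]; simp)+
  then show ?thesis using u' by (intro that) auto
qed

lemma riesz_energy_cross_finite:
  fixes f g :: "'a::euclidean_space \<Rightarrow> ennreal"
  assumes "s > 0" "f \<in> borel_measurable borel" "g \<in> borel_measurable borel" "riesz_energy s f f < \<infinity>" "riesz_energy s g g < \<infinity>"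
  shows "riesz_energy s f g < \<infinity>"
proof -
  have "(riesz_energy s f g)\<^sup>2 < \<infinity>"
    using riesz_energy_Cauchy_Schwarz[OF assms(1-3)] assms(4,5) by (auto intro: le_less_trans simp: ennreal_mult_less_top)
  then show ?thesis by (auto simp: power2_eq_square ennreal_mult_less_top)
qed

lemma interaction_Cauchy_Schwarz:
  fixes u v :: "real^'n::finite \<Rightarrow> real"
  assumes adm: "subcritical TYPE('n) \<alpha> p" and u: "u \<in> H1" and v: "v \<in> H1"
  shows "(interaction \<alpha> p u v)\<^sup>2 \<le> interaction \<alpha> p u u * interaction \<alpha> p v v"
    and "interaction \<alpha> p u u = interaction \<alpha> p u v \<Longrightarrow> interaction \<alpha> p v v = interaction \<alpha> p u v \<Longrightarrow> AE x in lebesgue. \<bar>u x\<bar> = \<bar>v x\<bar>"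
proof -
  let ?E = "riesz_energy ((real CARD('n) - \<alpha>) / 2)"
  let ?s = "(real CARD('n) - \<alpha>) / 2"
  let ?c = "riesz_const TYPE('n) \<alpha>"
  have \<alpha>: "0 < \<alpha>" "\<alpha> < real CARD('n)" using adm by (auto simp: subcritical_def)
  have s: "?s > 0" using \<alpha> by simp
  have c: "?c > 0" using riesz_const_pos[OF \<alpha>] .
  have um: "u \<in> borel_measurable lebesgue" and vm: "v \<in> borel_measurable lebesgue"
    using wgrad_H1(3) u v by (auto simp: L2_def)
  obtain u' where u': "u' \<in> borel_measurable borel" "AE x in lebesgue. u x = u' x"
    "?E (\<lambda>x. \<bar>u' x\<bar> powr p) (\<lambda>x. \<bar>u' x\<bar> powr p) < \<infinity>"
    "(\<integral>\<^sup>+x. ennreal (exp (- (1/2) * (norm x)\<^sup>2)) * ennreal (\<bar>u' x\<bar> powr p) \<partial>lborel) < \<infinity>"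
    using H1_representative[OF adm u] .
  obtain v' where v': "v' \<in> borel_measurable borel" "AE x in lebesgue. v x = v' x"
    "?E (\<lambda>x. \<bar>v' x\<bar> powr p) (\<lambda>x. \<bar>v' x\<bar> powr p) < \<infinity>"
    "(\<integral>\<^sup>+x. ennreal (exp (- (1/2) * (norm x)\<^sup>2)) * ennreal (\<bar>v' x\<bar> powr p) \<partial>lborel) < \<infinity>"
    using H1_representative[OF adm v] .
  let ?f = "\<lambda>x. ennreal (\<bar>u' x\<bar> powr p)" and ?g = "\<lambda>x. ennreal (\<bar>v' x\<bar> powr p)"
  note [measurable] = u'(1) v'(1)
  have fm: "?f \<in> borel_measurable borel" and gm: "?g \<in> borel_measurable borel" by measurable
  have fg: "?E ?g ?f < \<infinity>" by (rule riesz_energy_cross_finite[OF s gm fm v'(3) u'(3)])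
  have Iuv: "interaction \<alpha> p u v = ?c * enn2real (?E ?g ?f)"
    by (rule interaction_eq_riesz_energy[OF \<alpha> um vm u'(1) v'(1) u'(2) v'(2) fg])
  have Iuu: "interaction \<alpha> p u u = ?c * enn2real (?E ?f ?f)"
    by (rule interaction_eq_riesz_energy[OF \<alpha> um um u'(1) u'(1) u'(2) u'(2) u'(3)])
  have Ivv: "interaction \<alpha> p v v = ?c * enn2real (?E ?g ?g)"
    by (rule interaction_eq_riesz_energy[OF \<alpha> vm vm v'(1) v'(1) v'(2) v'(2) v'(3)])
  have "(enn2real (?E ?g ?f))\<^sup>2 \<le> enn2real (?E ?g ?g) * enn2real (?E ?f ?f)"
    unfolding power2_eq_square enn2real_mult[symmetric]
    using riesz_energy_Cauchy_Schwarz[OF s gm fm] u'(3) v'(3)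
    by (intro enn2real_mono) (auto simp: power2_eq_square ennreal_mult_less_top)
  then have "?c\<^sup>2 * (enn2real (?E ?g ?f))\<^sup>2 \<le> ?c\<^sup>2 * (enn2real (?E ?g ?g) * enn2real (?E ?f ?f))"
    by (intro mult_left_mono) auto
  then show "(interaction \<alpha> p u v)\<^sup>2 \<le> interaction \<alpha> p u u * interaction \<alpha> p v v"
    unfolding Iuv Iuu Ivv by (simp add: power2_eq_square mult_ac)
  assume eq: "interaction \<alpha> p u u = interaction \<alpha> p u v" "interaction \<alpha> p v v = interaction \<alpha> p u v"
  have ee: "a = b" if "a < \<infinity>" "b < \<infinity>" "enn2real a = enn2real b" for a b :: ennreal
    using that by (metis ennreal_enn2real infinity_ennreal_def)
  \<comment> \<open>All energies are finite, so equality of the real values lifts to equality in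
    \<open>ennreal\<close>, where the rigidity statement lives.\<close>
  have "?E ?f ?f = ?E ?g ?f" "?E ?g ?g = ?E ?g ?f"
    using eq c u'(3) v'(3) fg unfolding Iuv Iuu Ivv by (auto intro!: ee)
  then have "AE x in lborel. ?g x = ?f x"
    using fg by (intro riesz_energy_strict[OF s gm fm v'(4) u'(4)]) auto
  then have "AE x in lebesgue. ?g x = ?f x" by (simp add: AE_completion_iff)
  with u'(2) v'(2) show "AE x in lebesgue. \<bar>u x\<bar> = \<bar>v x\<bar>"
  proof eventually_elim
    fix x assume "u x = u' x" "v x = v' x" "?g x = ?f x"
    then have "\<bar>v x\<bar> powr p = \<bar>u x\<bar> powr p" by simp
    moreover have "p > 0" using subcritical_p[OF adm] by simp
    then have "(\<bar>a\<bar> powr p) powr (1 / p) = \<bar>a\<bar>" for a :: real by (simp add: powr_powr)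
    ultimately show "\<bar>u x\<bar> = \<bar>v x\<bar>" by metis
  qed
qed

lemma interaction_cong_AE:
  fixes u v :: "real^'n::finite \<Rightarrow> real"
  assumes u: "u \<in> borel_measurable lebesgue" and ae: "AE x in lebesgue. u x = v x"
  shows "interaction \<alpha> p u v = interaction \<alpha> p u u" "interaction \<alpha> p v v = interaction \<alpha> p u u"
proof -
  let ?R = "\<lambda>w. riesz_conv \<alpha> (\<lambda>y. \<bar>w y\<bar> powr p)" and ?r = "\<lambda>x y w. riesz \<alpha> (x - y) * \<bar>w y\<bar> powr p"
  note v = measurable_lebesgue_AE_cong[OF assms]
  have rm: "(\<lambda>y. riesz \<alpha> (x - y)) \<in> borel_measurable lebesgue" for x :: "real^'n"
    unfolding riesz_eq by (intro borel_imp_lebesgue_measurable) measurable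
  have conv: "?R v x = ?R u x" for x
    unfolding riesz_conv_def
  proof (rule integral_cong_AE)
    show "(\<lambda>y. ?r x y v) \<in> borel_measurable lebesgue" "(\<lambda>y. ?r x y u) \<in> borel_measurable lebesgue"
      using u v rm by (intro borel_measurable_times lebesgue_measurable_abs_powr; simp)+
    show "AE y in lebesgue. ?r x y v = ?r x y u"
      using ae by eventually_elim simp
  qed
  \<comment> \<open>The Borel representative serves to show that the convolution is measurable in
    its outer variable.\<close>
  obtain u' where u': "u' \<in> borel_measurable borel" "AE x in lebesgue. u x = u' x"
    using lebesgue_borel_representative[OF u] .
  have conv': "?R u x = (\<integral>y. ?r x y u' \<partial>lborel)" for x
    unfolding riesz_conv_def
  proof (rule integral_lebesgue_eq_lborel)
    show "(\<lambda>y. ?r x y u) \<in> borel_measurable lebesgue"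
      using u rm by (intro borel_measurable_times lebesgue_measurable_abs_powr; simp)
    show "(\<lambda>y. ?r x y u') \<in> borel_measurable borel"
      unfolding riesz_eq using u'(1) by measurable
    show "AE y in lebesgue. ?r x y u = ?r x y u'"
      using u'(2) by eventually_elim simp
  qed
  have "(\<lambda>x. ?R u x) \<in> borel_measurable borel"
    unfolding conv' riesz_eq using u'(1) by measurable
  then have cm: "(\<lambda>x. ?R u x) \<in> borel_measurable lebesgue"
    by (rule borel_imp_lebesgue_measurable)
  show 1: "interaction \<alpha> p u v = interaction \<alpha> p u u"
    unfolding interaction_def
  proof (rule integral_cong_AE)
    show "(\<lambda>x. ?R u x * \<bar>v x\<bar> powr p) \<in> borel_measurable lebesgue"
      "(\<lambda>x. ?R u x * \<bar>u x\<bar> powr p) \<in> borel_measurable lebesgue"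
      using u v cm by (intro borel_measurable_times lebesgue_measurable_abs_powr; simp)+
    show "AE x in lebesgue. ?R u x * \<bar>v x\<bar> powr p = ?R u x * \<bar>u x\<bar> powr p"
      using ae by eventually_elim simp
  qed
  show "interaction \<alpha> p v v = interaction \<alpha> p u u"
    using 1 unfolding interaction_def conv .
qed

section \<open>Ground states\<close>

lemma interaction_nonneg:
  fixes u v :: "real^'n::finite \<Rightarrow> real"
  assumes "0 < \<alpha>" "\<alpha> < real CARD('n)"
  shows "interaction \<alpha> p u v \<ge> 0"
  unfolding interaction_def riesz_conv_def riesz_eq
  using riesz_const_pos[OF assms] by (intro Bochner_Integration.integral_nonneg mult_nonneg_nonneg) auto

lemma Jfun_nehari:
  assumes "p > 0" "(u, v) \<in> nehari_J \<tau> \<alpha> p"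
  shows "Jfun \<tau> \<alpha> p u v = (1 - 1/p) * interaction \<alpha> p u v"
  using assms by (simp add: nehari_J_iff Jfun_eq algebra_simps)

lemma Afun_nehari:
  assumes "p > 0" "u \<in> nehari_A \<tau> \<alpha> p"
  shows "Afun \<tau> \<alpha> p u = (1 - 1/p) / 2 * kinetic \<tau> u"
  using assms by (simp add: nehari_A_iff Afun_eq field_simps)

section \<open>Comparison of the two Nehari sets\<close>

lemma nehari_A_lower_bound:
  fixes w :: "real^'n::finite \<Rightarrow> real"
  assumes p: "p > 1" and \<tau>: "\<tau> > 0" and w: "w \<in> H1" "nonzero_fun w" "interaction \<alpha> p w w > 0"
    and L: "L > 0" "\<And>z :: real^'n \<Rightarrow> real. z \<in> nehari_A \<tau> \<alpha> p \<Longrightarrow> L \<le> kinetic \<tau> z"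
  shows "L powr (p - 1) * interaction \<alpha> p w w \<le> kinetic \<tau> w powr p"
proof -
  let ?Q = "kinetic \<tau> w" and ?D = "interaction \<alpha> p w w"
  have Q: "?Q > 0" using kinetic_pos \<tau> w by blast
  \<comment> \<open>Projection onto the Nehari set: c w lies on it when c^2 Q = c^(2p) D, that is
    c^(2(p-1)) = Q/D. The bound then reads L <= c^2 Q, and its power p - 1 is the claim.\<close>
  define c where "c = (?Q / ?D) powr (1 / (2 * (p - 1)))"
  have c: "c > 0" using Q w by (simp add: c_def)
  have c2: "c\<^sup>2 = (?Q / ?D) powr (1 / (p - 1))"
  proof -
    have "1 / (2 * (p - 1)) + 1 / (2 * (p - 1)) = 1 / (p - 1)" using p by (simp add: field_simps)
    then show ?thesis by (simp only: c_def power2_eq_square powr_add[symmetric])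
  qed
  have cp: "c powr p * c powr p = c\<^sup>2 * (?Q / ?D)"
  proof -
    have "c powr p * c powr p = (c\<^sup>2) powr p" using c by (simp add: power2_eq_square powr_mult)
    also have "\<dots> = (?Q / ?D) powr (1 / (p - 1) + 1)"
      unfolding c2 powr_powr using p by (simp add: field_simps)
    also have "\<dots> = c\<^sup>2 * (?Q / ?D)" unfolding c2 powr_add using Q w by simp
    finally show ?thesis .
  qed
  have "(\<lambda>x. c * w x) \<in> nehari_A \<tau> \<alpha> p"
    using p w c wgrad_scale(1)[OF w(1)] unfolding nehari_A_iff[OF less_trans[OF zero_less_one p]] kinetic_scale[OF w(1)] interaction_scale
    by (auto simp: cp nonzero_fun_def)
  then have "L \<le> c\<^sup>2 * ?Q" using L(2) kinetic_scale[OF w(1)] by metis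
  then have "L powr (p - 1) \<le> (c\<^sup>2 * ?Q) powr (p - 1)" using p L by (intro powr_mono2) auto
  also have "\<dots> = (?Q / ?D) * ?Q powr (p - 1)"
    unfolding c2 using p Q w by (simp add: powr_mult powr_powr)
  finally have "L powr (p - 1) * ?D \<le> (?Q / ?D) * ?Q powr (p - 1) * ?D" using w by (intro mult_right_mono) auto
  also have "\<dots> = ?Q powr 1 * ?Q powr (p - 1)" using Q w by simp
  also have "\<dots> = ?Q powr p" unfolding powr_add[symmetric] by simp
  finally show ?thesis .
qed

lemma nehari_product_inequality:
  fixes a b d e K L p :: real
  assumes p: "p > 1" and L: "L > 0" and K: "K = (a + b) / 2" "K > 0" and nn: "a \<ge> 0" "b \<ge> 0" "d > 0" "e > 0"
    and la: "L powr (p - 1) * d \<le> a powr p" and lb: "L powr (p - 1) * e \<le> b powr p" and cs: "K\<^sup>2 \<le> d * e"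
  shows "L \<le> K" and "L = K \<Longrightarrow> a = K \<and> b = K \<and> d = K \<and> e = K"
proof -
  \<comment> \<open>Keeping the defect ((a - b)/2)^2 as an identity pays twice: dropping it gives
    the inequality, and in the equality case it must vanish, so a = b.\<close>
  have amgm: "a * b = K\<^sup>2 - ((a - b) / 2)\<^sup>2" unfolding K(1) by (simp add: power2_eq_square field_simps)
  then have abK: "a * b \<le> K\<^sup>2" using zero_le_power2[of "(a - b) / 2"] by linarith
  have "(L powr (p - 1))\<^sup>2 * K\<^sup>2 \<le> (L powr (p - 1))\<^sup>2 * (d * e)" using cs by (intro mult_left_mono) auto
  also have "\<dots> = (L powr (p - 1) * d) * (L powr (p - 1) * e)" by (simp add: power2_eq_square)
  also have "\<dots> \<le> a powr p * b powr p" using la lb nn by (intro mult_mono) auto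
  also have "\<dots> = (a * b) powr p" using nn by (simp add: powr_mult)
  finally have 1: "(L powr (p - 1))\<^sup>2 * K\<^sup>2 \<le> (a * b) powr p" .
  also have "(a * b) powr p \<le> (K\<^sup>2) powr p" using abK nn p by (intro powr_mono2) auto
  also have "\<dots> = (K powr (p - 1))\<^sup>2 * K\<^sup>2"
  proof -
    have "K powr p = K powr (p - 1) * K" using K(2) powr_add[of K "p - 1" 1] by simp
    then show ?thesis using K(2) by (simp add: power2_eq_square powr_mult)
  qed
  finally have "(L powr (p - 1))\<^sup>2 \<le> (K powr (p - 1))\<^sup>2" using K(2) by simp
  then have "L powr (p - 1) \<le> K powr (p - 1)" by (rule power2_le_imp_le) simp
  then show "L \<le> K" using p L K using powr_less_mono2[of "p - 1" K L] by force
  assume LK: "L = K"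
  have Kp: "(K powr (p - 1))\<^sup>2 * K\<^sup>2 = (K\<^sup>2) powr p"
  proof -
    have "K powr p = K powr (p - 1) * K" using K(2) powr_add[of K "p - 1" 1] by simp
    then show ?thesis using K(2) by (simp add: power2_eq_square powr_mult)
  qed
  have "(K\<^sup>2) powr p \<le> (a * b) powr p" using 1 unfolding LK Kp .
  then have "K\<^sup>2 \<le> a * b" using p nn K using powr_less_mono2[of p "a * b" "K\<^sup>2"] by force
  then have "((a - b) / 2)\<^sup>2 \<le> 0" using amgm by simp
  then have ab: "a = b" by simp
  then have aK: "a = K" "b = K" using K by auto
  have pw: "K powr p = K powr (p - 1) * K" using K(2) powr_add[of K "p - 1" 1] by simp
  \<comment> \<open>With a = b = L = K the scaling bounds become d <= K and e <= K. Since d e >=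
    K^2, neither can be strictly smaller.\<close>
  have "d \<le> K" "e \<le> K" using la lb K unfolding aK LK pw by simp_all
  moreover have "d \<ge> K"
  proof (rule ccontr)
    assume "\<not> d \<ge> K"
    then have "d * e < K * K" using \<open>e \<le> K\<close> nn by (intro mult_less_le_imp_less) auto
    then show False using cs by (simp add: power2_eq_square)
  qed
  moreover have "e \<ge> K"
  proof (rule ccontr)
    assume "\<not> e \<ge> K"
    then have "d * e < K * K" using \<open>d \<le> K\<close> nn by (intro mult_le_less_imp_less) auto
    then show False using cs by (simp add: power2_eq_square)
  qed
  ultimately show "a = K \<and> b = K \<and> d = K \<and> e = K" using aK by simp
qed

lemma nehari_J_diagonal:
  assumes "p > 0" "w \<in> nehari_A \<tau> \<alpha> p"
  shows "(w, w) \<in> nehari_J \<tau> \<alpha> p" "Jfun \<tau> \<alpha> p w w = 2 * Afun \<tau> \<alpha> p w"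
  using assms by (auto simp: nehari_J_iff nehari_A_iff Jfun_eq Afun_eq field_simps)

text \<open>Excludes pairs with one trivial component: the Nehari identity makes D(u,v) = (Q(u) +
  Q(v))/2 positive, and Cauchy-Schwarz passes this on to both self-interactions. Hence each
  component can be projected onto the Nehari set of the equation.\<close>

lemma nehari_J_pos:
  fixes u v :: "real^'n::finite \<Rightarrow> real"
  assumes adm: "subcritical TYPE('n) \<alpha> p" and \<tau>: "\<tau> > 0" and uv: "(u, v) \<in> nehari_J \<tau> \<alpha> p"
  shows "interaction \<alpha> p u v > 0" "interaction \<alpha> p u u > 0" "interaction \<alpha> p v v > 0" "nonzero_fun u" "nonzero_fun v"
proof -
  have p: "p > 0" using subcritical_p[OF adm] by simp
  have \<alpha>: "0 < \<alpha>" "\<alpha> < real CARD('n)" using adm by (auto simp: subcritical_def)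
  have H: "u \<in> H1" "v \<in> H1" "nonzero_fun u \<or> nonzero_fun v" "kinetic \<tau> u + kinetic \<tau> v = 2 * interaction \<alpha> p u v"
    using uv by (auto simp: nehari_J_iff[OF p])
  have "kinetic \<tau> u \<ge> 0" "kinetic \<tau> v \<ge> 0" using kinetic_nonneg[of \<tau>] \<tau> by auto
  then show D: "interaction \<alpha> p u v > 0" using H kinetic_pos[OF \<tau>] by (smt (verit))
  have "interaction \<alpha> p u u * interaction \<alpha> p v v > 0"
    using interaction_Cauchy_Schwarz(1)[OF adm H(1,2)] D by (meson less_le_trans zero_less_power)
  then show uu: "interaction \<alpha> p u u > 0" and vv: "interaction \<alpha> p v v > 0"
    using interaction_nonneg[OF \<alpha>, of p u u] interaction_nonneg[OF \<alpha>, of p v v] by (auto simp: zero_less_mult_iff)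
  have nz: "nonzero_fun w" if "interaction \<alpha> p w w > 0" "w \<in> H1" for w :: "real^'n \<Rightarrow> real"
  proof (rule ccontr)
    assume "\<not> nonzero_fun w"
    \<comment> \<open>Writing the zero function as \<open>0 * w x\<close> lets the scaling rule
      evaluate its interaction.\<close>
    then have "AE x in lebesgue. w x = 0 * w x" by (simp add: nonzero_fun_def)
    moreover have "w \<in> borel_measurable lebesgue" using wgrad_H1(3)[OF that(2)] by (simp add: L2_def)
    ultimately have "interaction \<alpha> p (\<lambda>x. 0 * w x) (\<lambda>x. 0 * w x) = interaction \<alpha> p w w"
      by (intro interaction_cong_AE(2))
    moreover have "interaction \<alpha> p (\<lambda>x. 0 * w x) (\<lambda>x. 0 * w x) = 0" unfolding interaction_scale by simp
    ultimately show False using that(1) by simp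
  qed
  show "nonzero_fun u" "nonzero_fun v" using nz uu vv H by auto
qed

text \<open>\<open>L\<close> is left arbitrary so that it can be the system's minimal K in one
  direction and the equation's minimal Q in the other.\<close>

lemma nehari_J_lower_bound:
  fixes a b :: "real^'n::finite \<Rightarrow> real"
  assumes adm: "subcritical TYPE('n) \<alpha> p" and \<tau>: "\<tau> > 0" and ab: "(a, b) \<in> nehari_J \<tau> \<alpha> p"
    and L: "L > 0" "\<And>z :: real^'n \<Rightarrow> real. z \<in> nehari_A \<tau> \<alpha> p \<Longrightarrow> L \<le> kinetic \<tau> z"
  shows "L \<le> interaction \<alpha> p a b"
    and "L = interaction \<alpha> p a b \<Longrightarrow> kinetic \<tau> a = L \<and> kinetic \<tau> b = L \<and> interaction \<alpha> p a a = L \<and> interaction \<alpha> p b b = L"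
proof -
  have p: "p > 1" using subcritical_p[OF adm] .
  have H: "a \<in> H1" "b \<in> H1" "kinetic \<tau> a + kinetic \<tau> b = 2 * interaction \<alpha> p a b"
    using ab p by (auto simp: nehari_J_iff)
  note pos = nehari_J_pos[OF adm \<tau> ab]
  note la = nehari_A_lower_bound[OF p \<tau> H(1) pos(4) pos(2) L] and lb = nehari_A_lower_bound[OF p \<tau> H(2) pos(5) pos(3) L]
  have K: "interaction \<alpha> p a b = (kinetic \<tau> a + kinetic \<tau> b) / 2" using H by simp
  have nn: "kinetic \<tau> a \<ge> 0" "kinetic \<tau> b \<ge> 0" using kinetic_nonneg[of \<tau>] \<tau> by auto
  note ineq = nehari_product_inequality[OF p L(1) K pos(1) nn pos(2,3) la lb interaction_Cauchy_Schwarz(1)[OF adm H(1,2)]]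
  show "L \<le> interaction \<alpha> p a b" by (rule ineq(1))
  show "L = interaction \<alpha> p a b \<Longrightarrow> kinetic \<tau> a = L \<and> kinetic \<tau> b = L \<and> interaction \<alpha> p a a = L \<and> interaction \<alpha> p b b = L"
    using ineq(2) by simp
qed

lemma system_ground_state_imp:
  fixes u v :: "real^'n::finite \<Rightarrow> real"
  assumes adm: "subcritical TYPE('n) \<alpha> p" and \<tau>: "\<tau> > 0"
    and gs: "ground_state_system \<tau> \<alpha> p u v" and pos: "positive_fun u" "positive_fun v"
  shows "(AE x in lebesgue. u x = v x) \<and> ground_state_eq \<tau> \<alpha> p u"
proof -
  have p: "p > 1" "p > 0" "1 - 1/p > 0" using subcritical_p[OF adm] by auto
  have \<alpha>: "0 < \<alpha>" "\<alpha> < real CARD('n)" using adm by (auto simp: subcritical_def)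
  let ?S = "(\<lambda>(a, b). Jfun \<tau> \<alpha> p a b) ` (nehari_J \<tau> \<alpha> p :: ((real^'n \<Rightarrow> real) \<times> (real^'n \<Rightarrow> real)) set)"
  have uv: "(u, v) \<in> nehari_J \<tau> \<alpha> p" and inf: "Jfun \<tau> \<alpha> p u v = Inf ?S"
    using gs by (auto simp: ground_state_system_def)
  \<comment> \<open>\<open>Inf\<close> on the reals is informative only for sets bounded below; here
    the Nehari identity makes the functional nonnegative.\<close>
  have bdd: "bdd_below ?S"
  proof (rule bdd_belowI)
    fix y assume "y \<in> ?S"
    then obtain a b :: "real^'n \<Rightarrow> real" where ab: "(a, b) \<in> nehari_J \<tau> \<alpha> p" "y = Jfun \<tau> \<alpha> p a b" by auto
    show "0 \<le> y" unfolding ab(2) Jfun_nehari[OF p(2) ab(1)]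
      using interaction_nonneg[OF \<alpha>, of p a b] p(3) by (intro mult_nonneg_nonneg) auto
  qed
  let ?K = "interaction \<alpha> p u v"
  have H: "u \<in> H1" "v \<in> H1" using uv p by (auto simp: nehari_J_iff)
  \<comment> \<open>The diagonal pair (w, w) is a competitor for the system, with energy 2 A(w) = (1
    - 1/p) Q(w).\<close>
  have Kle: "?K \<le> kinetic \<tau> w" if w: "w \<in> nehari_A \<tau> \<alpha> p" for w :: "real^'n \<Rightarrow> real"
  proof -
    have "Jfun \<tau> \<alpha> p u v \<le> Jfun \<tau> \<alpha> p w w"
      unfolding inf using nehari_J_diagonal(1)[OF p(2) w] by (intro cInf_lower[OF _ bdd]) force
    then have "(1 - 1/p) * ?K \<le> (1 - 1/p) * kinetic \<tau> w"
      using nehari_J_diagonal(2)[OF p(2) w] Afun_nehari[OF p(2) w] Jfun_nehari[OF p(2) uv] by simp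
    then show ?thesis using p(3) by (simp only: mult_le_cancel_left_pos)
  qed
  \<comment> \<open>By \<open>Kle\<close>, K itself is an admissible lower bound L, so the pair is
    automatically in the equality case L = K.\<close>
  have eqs: "kinetic \<tau> u = ?K" "interaction \<alpha> p u u = ?K" "interaction \<alpha> p v v = ?K"
    using nehari_J_lower_bound(2)[OF adm \<tau> uv nehari_J_pos(1)[OF adm \<tau> uv] Kle] by auto
  have "AE x in lebesgue. \<bar>u x\<bar> = \<bar>v x\<bar>"
    using interaction_Cauchy_Schwarz(2)[OF adm H] eqs by simp
  \<comment> \<open>Rigidity yields only equal absolute values; positivity of both components
    removes the signs.\<close>
  with pos have ae: "AE x in lebesgue. u x = v x"
    unfolding positive_fun_def by eventually_elim auto
  have uA: "u \<in> nehari_A \<tau> \<alpha> p"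
    using H eqs nehari_J_pos(4)[OF adm \<tau> uv] by (simp add: nehari_A_iff[OF p(2)])
  have "Afun \<tau> \<alpha> p u = Inf (Afun \<tau> \<alpha> p ` (nehari_A \<tau> \<alpha> p :: (real^'n \<Rightarrow> real) set))"
  proof (rule cInf_eq_minimum[symmetric])
    show "Afun \<tau> \<alpha> p u \<in> Afun \<tau> \<alpha> p ` (nehari_A \<tau> \<alpha> p :: (real^'n \<Rightarrow> real) set)" using uA by simp
    fix y assume "y \<in> Afun \<tau> \<alpha> p ` (nehari_A \<tau> \<alpha> p :: (real^'n \<Rightarrow> real) set)"
    then obtain w :: "real^'n \<Rightarrow> real" where w: "w \<in> nehari_A \<tau> \<alpha> p" "y = Afun \<tau> \<alpha> p w" by auto
    show "Afun \<tau> \<alpha> p u \<le> y"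
      unfolding w(2) Afun_nehari[OF p(2) w(1)] Afun_nehari[OF p(2) uA] eqs(1)
      using Kle[OF w(1)] p(3) by (intro mult_left_mono) auto
  qed
  then show ?thesis using ae uA by (simp add: ground_state_eq_def)
qed

lemma equation_ground_state_imp:
  fixes u v :: "real^'n::finite \<Rightarrow> real"
  assumes adm: "subcritical TYPE('n) \<alpha> p" and \<tau>: "\<tau> > 0"
    and gs: "ground_state_eq \<tau> \<alpha> p u" and ae: "AE x in lebesgue. u x = v x"
  shows "ground_state_system \<tau> \<alpha> p u v"
proof -
  have p: "p > 1" "p > 0" "1 - 1/p > 0" using subcritical_p[OF adm] by auto
  let ?S = "Afun \<tau> \<alpha> p ` (nehari_A \<tau> \<alpha> p :: (real^'n \<Rightarrow> real) set)"
  have uA: "u \<in> nehari_A \<tau> \<alpha> p" and inf: "Afun \<tau> \<alpha> p u = Inf ?S"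
    using gs by (auto simp: ground_state_eq_def)
  then have H: "u \<in> H1" "nonzero_fun u" "kinetic \<tau> u = interaction \<alpha> p u u" by (auto simp: nehari_A_iff[OF p(2)])
  have um: "u \<in> borel_measurable lebesgue" using wgrad_H1(3)[OF H(1)] by (simp add: L2_def)
  have bdd: "bdd_below ?S"
  proof (rule bdd_belowI)
    fix y assume "y \<in> ?S"
    then obtain w :: "real^'n \<Rightarrow> real" where w: "w \<in> nehari_A \<tau> \<alpha> p" "y = Afun \<tau> \<alpha> p w" by auto
    show "0 \<le> y" unfolding w(2) Afun_nehari[OF p(2) w(1)]
      using kinetic_nonneg[of \<tau> w] \<tau> p(3) by (intro mult_nonneg_nonneg) auto
  qed
  let ?L = "kinetic \<tau> u"
  have L: "?L > 0" using kinetic_pos[OF \<tau> H(1,2)] .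
  have Lle: "?L \<le> kinetic \<tau> w" if w: "w \<in> nehari_A \<tau> \<alpha> p" for w :: "real^'n \<Rightarrow> real"
  proof -
    have "Afun \<tau> \<alpha> p u \<le> Afun \<tau> \<alpha> p w" unfolding inf using w by (intro cInf_lower[OF _ bdd]) auto
    then show ?thesis unfolding Afun_nehari[OF p(2) w] Afun_nehari[OF p(2) uA] using p(3)
      by (simp add: mult_le_cancel_left_pos)
  qed
  have v: "v \<in> H1" "kinetic \<tau> v = ?L" using H1_cong_AE(1)[OF H(1) ae] kinetic_cong_AE[OF H(1) ae] by auto
  have I: "interaction \<alpha> p u v = ?L" using interaction_cong_AE(1)[OF um ae] H(3) by simp
  have uv: "(u, v) \<in> nehari_J \<tau> \<alpha> p" using H v I by (simp add: nehari_J_iff[OF p(2)])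
  have "Jfun \<tau> \<alpha> p u v = Inf ((\<lambda>(a, b). Jfun \<tau> \<alpha> p a b) ` (nehari_J \<tau> \<alpha> p :: ((real^'n \<Rightarrow> real) \<times> (real^'n \<Rightarrow> real)) set))"
  proof (rule cInf_eq_minimum[symmetric])
    show "Jfun \<tau> \<alpha> p u v \<in> (\<lambda>(a, b). Jfun \<tau> \<alpha> p a b) ` (nehari_J \<tau> \<alpha> p :: ((real^'n \<Rightarrow> real) \<times> (real^'n \<Rightarrow> real)) set)" by (rule image_eqI[OF _ uv]) simp
    fix y assume "y \<in> (\<lambda>(a, b). Jfun \<tau> \<alpha> p a b) ` (nehari_J \<tau> \<alpha> p :: ((real^'n \<Rightarrow> real) \<times> (real^'n \<Rightarrow> real)) set)"
    then obtain a b :: "real^'n \<Rightarrow> real" where ab: "(a, b) \<in> nehari_J \<tau> \<alpha> p" "y = Jfun \<tau> \<alpha> p a b" by auto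
    \<comment> \<open>On the Nehari set the energy is (1 - 1/p) times the interaction, so it
      suffices that Q(u), by \<open>Lle\<close> an admissible L, lies below every interaction
      D(a,b).\<close>
    show "Jfun \<tau> \<alpha> p u v \<le> y"
      unfolding ab(2) Jfun_nehari[OF p(2) ab(1)] Jfun_nehari[OF p(2) uv] I
      using nehari_J_lower_bound(1)[OF adm \<tau> ab(1) L Lle] p(3) by (intro mult_left_mono) auto
  qed
  then show ?thesis using uv by (simp add: ground_state_system_def)
qed

theorem theorem1p2:
  fixes \<tau> \<alpha> p :: real and u v :: "real^'n \<Rightarrow> real"
  assumes "\<tau> > 0" and "0 < \<alpha>" and "\<alpha> < real CARD('n)"
    and "1 + \<alpha> / real CARD('n) < p"
    and "CARD('n) \<ge> 3 \<Longrightarrow> p < (real CARD('n) + \<alpha>) / (real CARD('n) - 2)"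
  shows "(ground_state_system \<tau> \<alpha> p u v \<and> positive_fun u \<and> positive_fun v) \<longleftrightarrow>
         ((AE x in lebesgue. u x = v x) \<and> ground_state_eq \<tau> \<alpha> p u \<and> positive_fun u)"
proof -
  have adm: "subcritical TYPE('n) \<alpha> p" using assms by (simp add: subcritical_def)
  have "positive_fun v" if "AE x in lebesgue. u x = v x" "positive_fun u"
    using that unfolding positive_fun_def by eventually_elim simp
  then show ?thesis
    using system_ground_state_imp[OF adm assms(1)] equation_ground_state_imp[OF adm assms(1)] by blast
qed

end
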